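(* Let $P$ be a poset for which one of the following holds: (1) $X\in\mathbb Z^{r\times N}$ is an integer matrix of rank $r$ representing the arithmetic matroid $\mathcal A=(E_X,\Delta_X,m_X)$ of rank $r$, and $P=\mathrm{ind}(E_X,\Delta_X,\mathcal G_X)$ is the independence poset derived from $X$; (2) $\mathcal A=(E,\Delta,m)$ is a weak quasi-arithmetic matroid of rank $r$ and $P=\mathrm{ind}(E,\Delta,\mathcal G_m)$ is its cyclic independence poset. In both cases, if $\mathcal A$ is torsion-free, i.e. $m(\emptyset)=1$, then $$\mathrm{Hilb}(\mathbb K[P],t)=\frac{t^r\,\mathfrak M_{\mathcal A}(1/t,1)}{(1-t)^r},$$ and in general $$\mathrm{Hilb}(\mathbb K[\tilde P],t)=\frac{1}{m(\emptyset)}\cdot\frac{t^r\,\mathfrak M_{\mathcal A}(1/t,1)}{(1-t)^r},$$ where $\tilde P$ is the independence poset of the torsion-free structure associated with the group structure defining $P$.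
   Context: $\mathbb K$ is a field. Surjective finite abelian group structure: for a simplicial complex $\Delta$ on $E$, an assignment of a finite abelian group $\mathcal G(S)$ to each $S\in\Delta$ and surjective homomorphisms $\pi_{S,a}:\mathcal G(S\cup\{a\})\to\mathcal G(S)$ (for $a\notin S$, $S\cup\{a\}\in\Delta$) with $\pi_{S,a}\circ\pi_{S\cup\{a\},b}=\pi_{S,b}\circ\pi_{S\cup\{b\},a}$. With $\pi_S:\mathcal G(S)\to\mathcal G(\emptyset)$ the composite of these maps, the associated torsion-free structure is $\tilde{\mathcal G}(S)=\ker\pi_S$ with restricted maps. The independence poset $\mathrm{ind}(E,\Delta,\mathcal G)$ has elements $(S,g)$, $S\in\Delta$, $g\in\mathcal G(S)$, order generated by $(S\cup\{a\},g)$ covering $(S,h)$ iff $\pi_{S,a}(g)=h$. Case (1): $E_X=[N]$, $\Delta_X$ is the set of $S\subseteq[N]$ indexing linearly independent columns, $m_X(A)=|(\langle A\rangle_{\mathbb R}\cap\mathbb Z^r)/\langle A\rangle|$, where $\langle A\rangle$ is the subgroup of $\mathbb Z^r$ generated by the columns indexed by $A$ and $\langle A\rangle_{\mathbb R}$ their real span. For $S\in\Delta_X$, let $X[S]$ be the submatrix of columns in $S$, $W(S)=X[S]^T\mathbb R^r\cap\mathbb Z^S$, $I(S)=X[S]^T\mathbb Z^r$, $\mathcal G_X(S)=W(S)/I(S)$, and for $S\cup\{s\}\in\Delta_X$ let $\pi_{S,s}$ be the homomorphism induced by the coordinate projection $\mathbb Z^{S\cup\{s\}}\to\mathbb Z^S$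 forgetting coordinate $s$. Case (2): a weak quasi-arithmetic matroid is a matroid $(E,\Delta)$ (with $\Delta$ its independence complex) with $m:\Delta\to\mathbb Z_{\ge1}$ such that $m(S)\mid m(S\cup\{x\})$ whenever $S\cup\{x\}\in\Delta$; $\mathcal G_m(S)=\mathbb Z/m(S)\mathbb Z$ with $\pi_{S,a}$ the canonical projection sending $\bar1$ to $\bar1$. In both cases $r$ is the matroid rank and $\mathfrak M_{\mathcal A}(x,1)=\sum_{A\in\Delta}m(A)(x-1)^{r-|A|}$ is the specialization at $y=1$ of the arithmetic Tutte polynomial $\sum_{A\subseteq E}m(A)(x-1)^{r-\mathrm{rk}(A)}(y-1)^{|A|-\mathrm{rk}(A)}$. The Stanley--Reisner ring of a simplicial poset $Q$ with elements $\hat 0=y_0,\dots,y_p$ is $\mathbb K[y_0,\dots,y_p]/I_Q$, with $I_Q$ generated by $y_iy_j$ if $y_i,y_j$ have no common upper bound, $y_iy_j-(y_i\wedge y_j)\sum_z z$ (sum over minimal upper bounds $z$) otherwise, and $y_0-1$; it is graded by $\deg y_i=$ rank of the Boolean interval $[\hat0,y_i]$, and $\mathrm{Hilb}$ is its Hilbert series. *)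

theory Defs
  imports
    "HOL-Algebra.Embedded_Algebras"
    "HOL-Algebra.QuotRing"
    "HOL-Algebra.Product_Groups"
    "HOL-Algebra.Elementary_Groups"
    "HOL-Library.Poly_Mapping"
    "HOL-Computational_Algebra.Formal_Laurent_Series"
    "Jordan_Normal_Form.DL_Rank"
begin

section \<open>Stanley--Reisner rings of simplicial posets\<close>

text \<open>A poset is given by its reflexive order relation \<open>Q\<close>; the elements are \<open>Field Q\<close>
  and \<open>(x, y) \<in> Q\<close> means \<open>x \<le> y\<close>.\<close>

definition poset_bot :: "'p rel \<Rightarrow> 'p" where
  "poset_bot Q = (THE z. z \<in> Field Q \<and> (\<forall>x\<in>Field Q. (z, x) \<in> Q))"

definition poset_meet :: "'p rel \<Rightarrow> 'p \<Rightarrow> 'p \<Rightarrow> 'p" where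
  "poset_meet Q x y =
     (THE z. (z, x) \<in> Q \<and> (z, y) \<in> Q \<and> (\<forall>w. (w, x) \<in> Q \<and> (w, y) \<in> Q \<longrightarrow> (w, z) \<in> Q))"

definition upper_bounds :: "'p rel \<Rightarrow> 'p \<Rightarrow> 'p \<Rightarrow> 'p set" where
  "upper_bounds Q x y = {z. (x, z) \<in> Q \<and> (y, z) \<in> Q}"

definition minimal_upper_bounds :: "'p rel \<Rightarrow> 'p \<Rightarrow> 'p \<Rightarrow> 'p set" where
  "minimal_upper_bounds Q x y =
     {z \<in> upper_bounds Q x y. \<forall>w\<in>upper_bounds Q x y. (w, z) \<in> Q \<longrightarrow> w = z}"

text \<open>The rank of the interval from the bottom element to \<open>y\<close>: the maximal length of a chain.\<close>

definition poset_rank :: "'p rel \<Rightarrow> 'p \<Rightarrow> nat" where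
  "poset_rank Q y =
     Max {card C - 1 | C. C \<in> Chains Q \<and> C \<subseteq> {x. (poset_bot Q, x) \<in> Q \<and> (x, y) \<in> Q}}"

text \<open>Polynomials with variables in \<open>'v\<close> are finitely supported maps from monomials
  (finitely supported exponent functions) to coefficients, with the convolution product.\<close>

type_synonym ('v, 'k) mpoly = "('v \<Rightarrow>\<^sub>0 nat) \<Rightarrow>\<^sub>0 'k"

definition var :: "'v \<Rightarrow> ('v, 'k::field) mpoly" where
  "var v = Poly_Mapping.single (Poly_Mapping.single v 1) 1"

definition const :: "'k::field \<Rightarrow> ('v, 'k) mpoly" where
  "const c = Poly_Mapping.single 0 c"

definition mpoly_ring :: "'v set \<Rightarrow> ('v, 'k::field) mpoly ring" where
  "mpoly_ring V =
     \<lparr>carrier = {f. \<forall>e\<in>Poly_Mapping.keys f. Poly_Mapping.keys e \<subseteq> V},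
      monoid.mult = (*), one = 1, zero = 0, add = (+)\<rparr>"

definition sr_generators :: "'p rel \<Rightarrow> ('p, 'k::field) mpoly set" where
  "sr_generators Q =
     {var x * var y | x y. x \<in> Field Q \<and> y \<in> Field Q \<and> upper_bounds Q x y = {}} \<union>
     {var x * var y - var (poset_meet Q x y) * (\<Sum>z\<in>minimal_upper_bounds Q x y. var z) | x y.
        x \<in> Field Q \<and> y \<in> Field Q \<and> upper_bounds Q x y \<noteq> {}} \<union>
     {var (poset_bot Q) - 1}"

definition sr_ideal :: "'p rel \<Rightarrow> ('p, 'k::field) mpoly set" where
  "sr_ideal Q = Idl\<^bsub>mpoly_ring (Field Q)\<^esub> (sr_generators Q)"

definition sr_ring :: "'p rel \<Rightarrow> ('p, 'k::field) mpoly set ring" where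
  "sr_ring Q = mpoly_ring (Field Q) Quot sr_ideal Q"

definition sr_scalars :: "'p rel \<Rightarrow> ('p, 'k::field) mpoly set set" where
  "sr_scalars Q = {sr_ideal Q +>\<^bsub>mpoly_ring (Field Q)\<^esub> const c | c. True}"

definition sr_degree :: "'p rel \<Rightarrow> ('p \<Rightarrow>\<^sub>0 nat) \<Rightarrow> nat" where
  "sr_degree Q e =
     (\<Sum>v\<in>Poly_Mapping.keys e. Poly_Mapping.lookup e v * poset_rank Q v)"

definition sr_graded_part :: "'p rel \<Rightarrow> nat \<Rightarrow> ('p, 'k::field) mpoly set set" where
  "sr_graded_part Q d =
     {sr_ideal Q +>\<^bsub>mpoly_ring (Field Q)\<^esub> f | f.
        f \<in> carrier (mpoly_ring (Field Q)) \<and> (\<forall>e\<in>Poly_Mapping.keys f. sr_degree Q e = d)}"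

text \<open>\<open>ring.dim\<close> is the dimension of a subspace of a ring over a subfield of that ring, here
  over the copy \<open>sr_scalars Q\<close> of the coefficient field inside the quotient ring.\<close>

definition Hilb :: "'k::field itself \<Rightarrow> 'p rel \<Rightarrow> rat fps" where
  "Hilb (_ :: 'k itself) Q =
     Abs_fps (\<lambda>d. of_nat (ring.dim (sr_ring Q) (sr_scalars Q)
                            (sr_graded_part Q d :: ('p, 'k) mpoly set set)))"


section \<open>Independence posets\<close>

text \<open>A group structure on a simplicial complex \<open>\<Delta>\<close> is given by the groups \<open>G S\<close> for
  \<open>S \<in> \<Delta>\<close> and the maps \<open>\<pi> S a\<close> from \<open>G (insert a S)\<close> to \<open>G S\<close>.\<close>

definition ind_poset ::
  "'e set set \<Rightarrow> ('e set \<Rightarrow> ('g, 'z) monoid_scheme) \<Rightarrow> ('e set \<Rightarrow> 'e \<Rightarrow> 'g \<Rightarrow> 'g) \<Rightarrow>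
     ('e set \<times> 'g) rel" where
  "ind_poset \<Delta> G \<pi> =
     (let elems = (SIGMA S:\<Delta>. carrier (G S));
          covers = {((S, h), (insert a S, g)) | S a g h.
             a \<notin> S \<and> insert a S \<in> \<Delta> \<and> g \<in> carrier (G (insert a S)) \<and> \<pi> S a g = h}
      in covers\<^sup>* \<inter> elems \<times> elems)"

text \<open>The composite from \<open>G S\<close> to \<open>G {}\<close> removes the elements of \<open>S\<close> one after another;
  by the commutation axiom for \<open>\<pi>\<close> the order does not matter.\<close>

fun proj_along :: "('e set \<Rightarrow> 'e \<Rightarrow> 'g \<Rightarrow> 'g) \<Rightarrow> 'e list \<Rightarrow> 'g \<Rightarrow> 'g" where
  "proj_along \<pi> [] g = g"
| "proj_along \<pi> (a # as) g = proj_along \<pi> as (\<pi> (set as) a g)"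

definition proj_to_empty :: "('e set \<Rightarrow> 'e \<Rightarrow> 'g \<Rightarrow> 'g) \<Rightarrow> 'e set \<Rightarrow> 'g \<Rightarrow> 'g" where
  "proj_to_empty \<pi> S = proj_along \<pi> (SOME as. distinct as \<and> set as = S)"

definition torsion_free_part ::
  "('e set \<Rightarrow> ('g, 'z) monoid_scheme) \<Rightarrow> ('e set \<Rightarrow> 'e \<Rightarrow> 'g \<Rightarrow> 'g) \<Rightarrow>
     'e set \<Rightarrow> ('g, 'z) monoid_scheme" where
  "torsion_free_part G \<pi> S = (G S)\<lparr>carrier := kernel (G S) (G {}) (proj_to_empty \<pi> S)\<rparr>"

definition tf_ind_poset ::
  "'e set set \<Rightarrow> ('e set \<Rightarrow> ('g, 'z) monoid_scheme) \<Rightarrow> ('e set \<Rightarrow> 'e \<Rightarrow> 'g \<Rightarrow> 'g) \<Rightarrow>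
     ('e set \<times> 'g) rel" where
  "tf_ind_poset \<Delta> G \<pi> = ind_poset \<Delta> (torsion_free_part G \<pi>) \<pi>"


section \<open>Matroids and the arithmetic Tutte polynomial\<close>

definition matroid :: "'e set \<Rightarrow> 'e set set \<Rightarrow> bool" where
  "matroid E \<Delta> \<longleftrightarrow>
     finite E \<and> \<Delta> \<subseteq> Pow E \<and> {} \<in> \<Delta> \<and>
     (\<forall>S\<in>\<Delta>. \<forall>T. T \<subseteq> S \<longrightarrow> T \<in> \<Delta>) \<and>
     (\<forall>S\<in>\<Delta>. \<forall>T\<in>\<Delta>. card S < card T \<longrightarrow> (\<exists>x\<in>T - S. insert x S \<in> \<Delta>))"

definition matroid_rank :: "'e set set \<Rightarrow> 'e set \<Rightarrow> nat" where
  "matroid_rank \<Delta> A = Max {card S | S. S \<in> \<Delta> \<and> S \<subseteq> A}"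

definition arith_tutte ::
  "'e set \<Rightarrow> 'e set set \<Rightarrow> ('e set \<Rightarrow> nat) \<Rightarrow> 'a::comm_ring_1 \<Rightarrow> 'a \<Rightarrow> 'a" where
  "arith_tutte E \<Delta> m x y =
     (\<Sum>A\<in>Pow E. of_nat (m A) * (x - 1) ^ (matroid_rank \<Delta> E - matroid_rank \<Delta> A)
                            * (y - 1) ^ (card A - matroid_rank \<Delta> A))"

text \<open>At \<open>y = 1\<close> only the values of \<open>m\<close> on \<open>\<Delta>\<close> matter, so the specialization makes sense
  for a multiplicity function that is only meaningful on independent sets.\<close>

lemma arith_tutte_y1:
  assumes "matroid E \<Delta>"
  shows "arith_tutte E \<Delta> m x 1 =
    (\<Sum>A\<in>\<Delta>. of_nat (m A) * (x - 1) ^ (matroid_rank \<Delta> E - card A))"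
proof -
  have fin: "finite E" and sub: "\<Delta> \<subseteq> Pow E" and e: "{} \<in> \<Delta>"
    using assms by (auto simp: matroid_def)
  have ind: "matroid_rank \<Delta> A = card A" if "A \<in> \<Delta>" for A
  proof -
    have "finite A" using that sub fin by (auto intro: finite_subset)
    then show ?thesis unfolding matroid_rank_def
      by (intro Max_eqI) (use that in \<open>auto intro: card_mono\<close>)
  qed
  have dep: "matroid_rank \<Delta> A < card A" if A: "A \<in> Pow E - \<Delta>" for A
  proof -
    have fA: "finite A" using A fin by (auto intro: finite_subset)
    have "{card S | S. S \<in> \<Delta> \<and> S \<subseteq> A} \<subseteq> card ` Pow A" by auto
    then have f: "finite {card S | S. S \<in> \<Delta> \<and> S \<subseteq> A}" using fA by (meson finite_Pow_iff finite_imageI finite_subset)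
    moreover have "\<forall>n\<in>{card S | S. S \<in> \<Delta> \<and> S \<subseteq> A}. n < card A"
      using A fA by (auto intro!: psubset_card_mono)
    moreover have "{card S | S. S \<in> \<Delta> \<and> S \<subseteq> A} \<noteq> {}" using e by auto
    ultimately show ?thesis unfolding matroid_rank_def by (subst Max_less_iff) auto
  qed
  have "arith_tutte E \<Delta> m x 1 =
    (\<Sum>A\<in>\<Delta>. of_nat (m A) * (x - 1) ^ (matroid_rank \<Delta> E - matroid_rank \<Delta> A)
                            * (1 - 1) ^ (card A - matroid_rank \<Delta> A))"
    unfolding arith_tutte_def
  proof (rule sum.mono_neutral_right)
    show "\<forall>A\<in>Pow E - \<Delta>. of_nat (m A) * (x - 1) ^ (matroid_rank \<Delta> E - matroid_rank \<Delta> A)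
                            * (1 - 1) ^ (card A - matroid_rank \<Delta> A) = 0"
      using dep by (simp add: zero_power)
  qed (use fin sub in auto)
  also have "\<dots> = (\<Sum>A\<in>\<Delta>. of_nat (m A) * (x - 1) ^ (matroid_rank \<Delta> E - card A))"
    by (intro sum.cong) (auto simp: ind)
  finally show ?thesis .
qed


section \<open>The structure derived from an integer matrix\<close>

text \<open>The ground set of an \<open>r \<times> N\<close> matrix is \<open>{..<N}\<close>.  Distinct indices may carry equal
  columns, whence the injectivity condition in the definition of independence.\<close>

definition mat_ground :: "int mat \<Rightarrow> nat set" where
  "mat_ground X = {..<dim_col X}"

definition real_col :: "int mat \<Rightarrow> nat \<Rightarrow> real vec" where
  "real_col X j = map_vec real_of_int (col X j)"

definition mat_indep :: "int mat \<Rightarrow> nat set set" where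
  "mat_indep X = {S. S \<subseteq> mat_ground X \<and> inj_on (real_col X) S \<and>
     \<not> LinearCombinations.module.lin_dep class_ring (module_vec TYPE(real) (dim_row X))
         (real_col X ` S)}"

definition col_lattice :: "int mat \<Rightarrow> nat set \<Rightarrow> int vec set" where
  "col_lattice X A = generate (monoid_vec TYPE(int) (dim_row X)) (col X ` A)"

definition col_saturation :: "int mat \<Rightarrow> nat set \<Rightarrow> int vec set" where
  "col_saturation X A = {v \<in> carrier_vec (dim_row X). map_vec real_of_int v \<in>
     LinearCombinations.module.span class_ring (module_vec TYPE(real) (dim_row X))
       (real_col X ` A)}"

definition mat_mult :: "int mat \<Rightarrow> nat set \<Rightarrow> nat" where
  "mat_mult X A = Coset.order
     ((monoid_vec TYPE(int) (dim_row X))\<lparr>carrier := col_saturation X A\<rparr> Mod col_lattice X A)"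

abbreviation int_power :: "nat set \<Rightarrow> (nat \<Rightarrow> int) monoid" where
  "int_power S \<equiv> product_group S (\<lambda>_. integer_group)"

text \<open>The entry of \<open>X[S]\<^sup>T u\<close> at \<open>s \<in> S\<close> is the scalar product of column \<open>s\<close> with \<open>u\<close>.\<close>

definition mat_W :: "int mat \<Rightarrow> nat set \<Rightarrow> (nat \<Rightarrow> int) set" where
  "mat_W X S = {w \<in> carrier (int_power S). \<exists>u\<in>carrier_vec (dim_row X).
     \<forall>s\<in>S. real_of_int (w s) = real_col X s \<bullet> u}"

definition mat_I :: "int mat \<Rightarrow> nat set \<Rightarrow> (nat \<Rightarrow> int) set" where
  "mat_I X S = {w \<in> carrier (int_power S). \<exists>u\<in>carrier_vec (dim_row X).
     \<forall>s\<in>S. w s = col X s \<bullet> u}"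

definition mat_group :: "int mat \<Rightarrow> nat set \<Rightarrow> (nat \<Rightarrow> int) set monoid" where
  "mat_group X S = (int_power S)\<lparr>carrier := mat_W X S\<rparr> Mod mat_I X S"

text \<open>Restriction to \<open>S\<close> induces a map on cosets; the union below is over a family consisting
  of a single coset of \<open>mat_I X S\<close>.\<close>

definition mat_proj :: "int mat \<Rightarrow> nat set \<Rightarrow> nat \<Rightarrow> (nat \<Rightarrow> int) set \<Rightarrow> (nat \<Rightarrow> int) set" where
  "mat_proj X S s C = (\<Union>w\<in>C. mat_I X S #>\<^bsub>int_power S\<^esub> restrict w S)"


section \<open>Weak quasi-arithmetic matroids\<close>

definition weak_quasi_arith_matroid :: "'e set \<Rightarrow> 'e set set \<Rightarrow> ('e set \<Rightarrow> nat) \<Rightarrow> bool" where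
  "weak_quasi_arith_matroid E \<Delta> m \<longleftrightarrow> matroid E \<Delta> \<and> (\<forall>S\<in>\<Delta>. 1 \<le> m S) \<and>
     (\<forall>S x. S \<in> \<Delta> \<and> insert x S \<in> \<Delta> \<longrightarrow> m S dvd m (insert x S))"

definition zmod_group :: "('e set \<Rightarrow> nat) \<Rightarrow> 'e set \<Rightarrow> int monoid" where
  "zmod_group m S = integer_mod_group (m S)"

text \<open>Residue classes are represented by \<open>{0..<m S}\<close>, so the canonical projection is reduction.\<close>

definition zmod_proj :: "('e set \<Rightarrow> nat) \<Rightarrow> 'e set \<Rightarrow> 'e \<Rightarrow> int \<Rightarrow> int" where
  "zmod_proj m S a k = k mod int (m S)"

end

theory Submission
  imports Defs
begin

text \<open>In the independence poset of a system of projections the interval below \<open>(S, g)\<close> is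
  the Boolean lattice of the subsets of \<open>S\<close>.  For such a poset the monomials supported on
  chains of non-bottom elements form a basis of the Stanley--Reisner ring: replacing a product of
  incomparable variables by meet times minimal upper bounds terminates, and the restriction
  homomorphisms to the polynomial rings of the Boolean intervals separate these monomials.  A chain
  monomial is determined by its greatest factor \<open>(S, g)\<close> and by its image there, a monomial
  with support \<open>S\<close>, so the Hilbert series is the sum of \<open>(t / (1 - t))\<^bsup>|S|\<^esup>\<close>
  over the poset.

  For an integer matrix it remains to see that \<open>\<int>\<^sup>S / X[S]\<^sup>T\<int>\<^sup>r\<close> has order
  \<open>m_X(S)\<close>.  Both numbers count the points \<open>q\<close> of \<open>[0,1)\<^sup>S\<close> with
  \<open>X[S] q\<close> integral, i.e. the classes modulo \<open>\<int>\<^sup>S\<close> of the lattice dual to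
  \<open>X[S]\<^sup>T\<int>\<^sup>r\<close>.\<close>

text \<open>A straightening relation vanishes on every face because indicator functions satisfy 1_A
  + 1_B = 1_(A \<inter> B) + 1_(A \<union> B). Conversely, the chain belonging to an exponent vector
  consists of its superlevel sets. Spanning and independence of the chain monomials are separate
  arguments, so straightening is not shown to be confluent.

  The poset of a group structure has a minimal element for each element of the group at the empty
  face. Passing to the kernels of the maps to that group yields a single least element, and these
  kernels have m(S)/m({}) elements, whence the factor 1/m({}). For a matrix the group at the empty
  face is trivial and the two posets agree. The Tutte specialization then appears from (t/(1-t))^|S|
  = t^r (1/t - 1)^(r-|S|) / (1-t)^r.

  The points of the cube are a meeting ground for two quotients living in different spaces: q
  \<mapsto> X[S] q leads to the saturation modulo the column lattice, while the index of X[S]^T Z^r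
  equals the number of dual points by an induction over the coordinates. No determinant or Smith
  normal form enters.\<close>

abbreviation (input) keys :: "('a \<Rightarrow>\<^sub>0 'b::zero) \<Rightarrow> 'a set" where "keys \<equiv> Poly_Mapping.keys"
abbreviation (input) lookup :: "('a \<Rightarrow>\<^sub>0 'b::zero) \<Rightarrow> 'a \<Rightarrow> 'b" where "lookup \<equiv> Poly_Mapping.lookup"
abbreviation (input) single :: "'a \<Rightarrow> 'b \<Rightarrow> 'a \<Rightarrow>\<^sub>0 'b::zero" where "single \<equiv> Poly_Mapping.single"

subsection \<open>Quotients of polynomial rings\<close>

lemma mpoly_ring_sel [simp]:
  "monoid.mult (mpoly_ring V) = (*)" "one (mpoly_ring V) = 1"
  "zero (mpoly_ring V) = 0" "add (mpoly_ring V) = (+)"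
  by (auto simp: mpoly_ring_def)

lemma keys_plus_nat: "keys (e + e' :: 'a \<Rightarrow>\<^sub>0 nat) = keys e \<union> keys e'"
  by (auto simp: in_keys_iff lookup_add)

lemma mpoly_carrier_iff:
  "f \<in> carrier (mpoly_ring V) \<longleftrightarrow> (\<forall>e\<in>keys f. keys e \<subseteq> V)"
  by (simp add: mpoly_ring_def)

lemma mpoly_carrier_zero [simp]: "0 \<in> carrier (mpoly_ring V)"
  and mpoly_carrier_one [simp]: "1 \<in> carrier (mpoly_ring V)"
  and mpoly_carrier_single: "keys e \<subseteq> V \<Longrightarrow> single e c \<in> carrier (mpoly_ring V)"
  and mpoly_carrier_const [simp]: "const c \<in> carrier (mpoly_ring V)"
  and mpoly_carrier_var: "v \<in> V \<Longrightarrow> var v \<in> carrier (mpoly_ring V)"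
  by (auto simp: mpoly_carrier_iff const_def var_def split: if_splits)

lemma mpoly_carrier_add:
  "f \<in> carrier (mpoly_ring V) \<Longrightarrow> g \<in> carrier (mpoly_ring V) \<Longrightarrow> f + g \<in> carrier (mpoly_ring V)"
  unfolding mpoly_carrier_iff using keys_add[of f g] by blast

lemma mpoly_carrier_uminus:
  "f \<in> carrier (mpoly_ring V) \<Longrightarrow> - f \<in> carrier (mpoly_ring V)"
  by (simp add: mpoly_carrier_iff)

lemma mpoly_carrier_diff:
  "f \<in> carrier (mpoly_ring V) \<Longrightarrow> g \<in> carrier (mpoly_ring V) \<Longrightarrow> f - g \<in> carrier (mpoly_ring V)"
  using mpoly_carrier_add[OF _ mpoly_carrier_uminus, of f V g] by simp

lemma mpoly_carrier_mult:
  assumes "f \<in> carrier (mpoly_ring V)" "g \<in> carrier (mpoly_ring V)"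
  shows "f * g \<in> carrier (mpoly_ring V)"
  unfolding mpoly_carrier_iff
proof
  fix e assume "e \<in> keys (f * g)"
  then obtain a b where "e = a + b" "a \<in> keys f" "b \<in> keys g" using keys_mult[of f g] by blast
  then show "keys e \<subseteq> V" using assms by (auto simp: mpoly_carrier_iff keys_plus_nat)
qed

lemma mpoly_carrier_sum:
  "(\<And>x. x \<in> A \<Longrightarrow> f x \<in> carrier (mpoly_ring V)) \<Longrightarrow> sum f A \<in> carrier (mpoly_ring V)"
  by (induction A rule: infinite_finite_induct) (auto intro: mpoly_carrier_add)

lemma cring_mpoly_ring: "cring (mpoly_ring V :: ('v, 'k::field) mpoly ring)"
proof (rule cringI)
  show "abelian_group (mpoly_ring V :: ('v, 'k) mpoly ring)"
    by (rule abelian_groupI)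
      (auto simp: add_ac intro: mpoly_carrier_add bexI[of _ "- x" for x] mpoly_carrier_uminus)
  show "comm_monoid (mpoly_ring V :: ('v, 'k) mpoly ring)"
    by (rule comm_monoidI) (auto simp: mult_ac intro: mpoly_carrier_mult)
qed (auto simp: algebra_simps)

lemma mpoly_ring_uminus:
  assumes "f \<in> carrier (mpoly_ring V)"
  shows "\<ominus>\<^bsub>mpoly_ring V\<^esub> f = - f"
proof -
  interpret cring "mpoly_ring V :: ('a, 'b) mpoly ring" by (rule cring_mpoly_ring)
  show ?thesis
    by (rule minus_equality) (use assms in \<open>auto intro: mpoly_carrier_uminus\<close>)
qed

lemma mpoly_ring_minus:
  assumes "f \<in> carrier (mpoly_ring V)" "g \<in> carrier (mpoly_ring V)"
  shows "f \<ominus>\<^bsub>mpoly_ring V\<^esub> g = f - g"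
  using assms by (simp add: a_minus_def mpoly_ring_uminus)

lemma const_simps:
  "const (a + b) = const a + const b" "const (a * b) = const a * const b"
  "const 0 = 0" "const 1 = 1" "const (- a) = - const a"
  by (auto simp: const_def single_add mult_single single_uminus)

lemma subfield_consts: "subfield (range const) (mpoly_ring V :: ('v, 'k::field) mpoly ring)"
proof -
  interpret cring "mpoly_ring V :: ('v, 'k) mpoly ring" by (rule cring_mpoly_ring)
  have sr: "subring (range const) (mpoly_ring V :: ('v, 'k) mpoly ring)"
    by (rule subringI)
      (auto simp: mpoly_ring_uminus simp flip: const_simps intro: range_eqI[of _ _ 1])
  have "Units (mpoly_ring V\<lparr>carrier := range const\<rparr>) = range const - {0 :: ('v, 'k) mpoly}" (is "?U = ?R")
  proof
    show "?U \<subseteq> ?R" by (auto simp: Units_def)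
    show "?R \<subseteq> ?U"
    proof
      fix x assume "x \<in> ?R"
      then obtain c where c: "x = const c" and "x \<noteq> 0" by blast
      then have "c \<noteq> 0" by (auto simp: const_simps)
      have "const (inverse c) * const c = 1" "const c * const (inverse c) = 1"
        using \<open>c \<noteq> 0\<close> by (simp_all flip: const_simps(2,4))
      then show "x \<in> ?U" using c by (auto simp: Units_def)
    qed
  qed
  then show ?thesis
    by (intro subfieldI subcringI' sr) simp
qed

lemma poly_mapping_sum_singles:
  assumes "finite B" "keys g \<subseteq> B"
  shows "g = (\<Sum>b\<in>B. single b (lookup g b))"
proof (rule poly_mapping_eqI)
  fix k
  show "lookup g k = lookup (\<Sum>b\<in>B. single b (lookup g b)) k"
    using assms by (auto simp: lookup_sum lookup_single when_def sum.delta in_keys_iff)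
qed

text \<open>Properness makes the classes of the constants a field inside the quotient, over which
  \<open>ring.dim\<close> is meaningful.\<close>

locale mpoly_quotient =
  fixes V :: "'v set" and I :: "('v, 'k::field) mpoly set"
  assumes ideal: "ideal I (mpoly_ring V)" and proper: "1 \<notin> I"
begin

sublocale ideal I "mpoly_ring V" by (rule ideal)
sublocale cring "mpoly_ring V :: ('v, 'k) mpoly ring" by (rule cring_mpoly_ring)
sublocale Q: ring_hom_ring "mpoly_ring V" "mpoly_ring V Quot I" "(+>\<^bsub>mpoly_ring V\<^esub>) I"
  by (rule rcos_ring_hom_ring)

abbreviation "cls \<equiv> (+>\<^bsub>mpoly_ring V\<^esub>) I"

lemma cls_eq_iff:
  "f \<in> carrier (mpoly_ring V) \<Longrightarrow> g \<in> carrier (mpoly_ring V) \<Longrightarrow> cls f = cls g \<longleftrightarrow> f - g \<in> I"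
  using quotient_eq_iff_same_a_r_cos[OF ideal, of f g] by (simp add: mpoly_ring_minus)

lemma cls_zero_iff: "f \<in> carrier (mpoly_ring V) \<Longrightarrow> cls f = \<zero>\<^bsub>mpoly_ring V Quot I\<^esub> \<longleftrightarrow> f \<in> I"
  using cls_eq_iff[of f 0] Q.hom_zero by simp

lemma subfield_scalars: "subfield (cls ` range const) (mpoly_ring V Quot I)"
proof (rule Q.img_is_subfield(2)[OF subfield_consts])
  show "\<one>\<^bsub>mpoly_ring V Quot I\<^esub> \<noteq> \<zero>\<^bsub>mpoly_ring V Quot I\<^esub>"
    using cls_zero_iff[of 1] Q.hom_one proper by simp
qed

text \<open>\<open>combine\<close> stops at the end of the shorter list, as \<open>zip\<close> does,
  so coefficient lists of any length are covered. The second fact supplies the carrier conditions of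
  the homomorphism rules in the induction.\<close>

lemma combine_cls:
  assumes "\<forall>b\<in>set bs. keys b \<subseteq> V"
  shows "Q.S.combine (map (\<lambda>c. cls (const c)) cs) (map (\<lambda>b. cls (single b 1)) bs)
         = cls (\<Sum>(c, b)\<leftarrow>zip cs bs. single b c)"
    and "(\<Sum>(c, b)\<leftarrow>zip cs bs. single b c) \<in> carrier (mpoly_ring V)"
  using assms
proof (induction bs arbitrary: cs)
  case Nil
  { case 1 then show ?case using Q.hom_zero by simp next case 2 then show ?case by simp }
next
  case (Cons b bs)
  have b: "keys b \<subseteq> V" if "\<forall>b\<in>set (b # bs). keys b \<subseteq> V" using that by simp
  {
    case 1
    show ?case
    proof (cases cs)
      case Nil then show ?thesis using Q.hom_zero by simp
    next
      case (Cons c cs')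
      let ?s = "\<Sum>(c, b)\<leftarrow>zip cs' bs. single b c"
      have s: "?s \<in> carrier (mpoly_ring V)" using Cons.IH(2) 1 by simp
      have 2: "cls (const c) \<otimes>\<^bsub>mpoly_ring V Quot I\<^esub> cls (single b 1)
              = cls (single b c)"
        using Q.hom_mult[of "const c" "single b 1"] b[OF 1]
        by (simp add: mpoly_carrier_single const_def mult_single)
      show ?thesis
        using Cons Cons.IH(1)[of cs'] 1 2 s b[OF 1]
          Q.hom_add[of "single b c" ?s]
        by (simp add: mpoly_carrier_single)
    qed
  next
    case 2
    then show ?case using b[OF 2] Cons.IH(2)
      by (cases cs) (auto intro!: mpoly_carrier_add mpoly_carrier_single)
  }
qed

lemma keys_sum_zip: "keys (\<Sum>(c, b)\<leftarrow>zip cs bs. single b c) \<subseteq> set bs"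
proof (induction bs arbitrary: cs)
  case (Cons b bs)
  then show ?case
  proof (cases cs)
    case (Cons c cs')
    then show ?thesis using Cons.IH[of cs'] keys_add by (fastforce split: if_splits)
  qed auto
qed auto

lemma sum_zip_eq_zero:
  assumes "distinct bs" "(\<Sum>(c, b)\<leftarrow>zip cs bs. single b c) = (0 :: ('v, 'k) mpoly)"
  shows "set (take (length bs) cs) \<subseteq> {0}"
  using assms
proof (induction bs arbitrary: cs)
  case (Cons b bs)
  show ?case
  proof (cases cs)
    case (Cons c cs')
    let ?s = "\<Sum>(c, b)\<leftarrow>zip cs' bs. single b c"
    have 0: "single b c + ?s = 0" using Cons Cons.prems by simp
    have "lookup (single b c + ?s) b = c"
      using keys_sum_zip[of cs' bs] Cons.prems by (auto simp: lookup_add in_keys_iff)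
    then have "c = 0" using 0 by simp
    then show ?thesis using Cons.IH[of cs'] Cons.prems Cons 0 by simp
  qed simp
qed simp

text \<open>\<open>span\<close> makes the classes of the monomials in \<open>B\<close> generate the
  image of \<open>H\<close>, and \<open>indep\<close> makes them linearly independent. In the
  application \<open>H\<close> consists of the homogeneous polynomials of one degree.\<close>

lemma dim_eq_card:
  assumes B: "finite B" "\<And>b. b \<in> B \<Longrightarrow> keys b \<subseteq> V"
    and H: "H \<subseteq> carrier (mpoly_ring V)" "\<And>g. keys g \<subseteq> B \<Longrightarrow> g \<in> H"
    and span: "\<And>f. f \<in> H \<Longrightarrow> \<exists>g. keys g \<subseteq> B \<and> f - g \<in> I"
    and indep: "\<And>g. g \<in> I \<Longrightarrow> keys g \<subseteq> B \<Longrightarrow> g = 0"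
  shows "ring.dim (mpoly_ring V Quot I) {cls (const c) | c. True} {cls f | f. f \<in> H} = card B"
proof -
  obtain bs where bs: "set bs = B" "distinct bs" using B(1) finite_distinct_list by blast
  let ?K = "cls ` range const"
  let ?Us = "map (\<lambda>b. cls (single b 1)) bs"
  let ?S = "\<lambda>cs. \<Sum>(c, b)\<leftarrow>zip cs bs. single b c"
  have bV: "\<forall>b\<in>set bs. keys b \<subseteq> V" using bs B by auto
  have Us: "set ?Us \<subseteq> carrier (mpoly_ring V Quot I)"
    using bV by (auto intro!: Q.hom_closed mpoly_carrier_single)
  \<comment> \<open>Scalars are cosets; constant representatives allow a combination to be computed
    in the polynomial ring.\<close>
  have Ks: "\<exists>cs. Ks = map (\<lambda>c. cls (const c)) cs" if "set Ks \<subseteq> ?K" for Ks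
    using that by (induction Ks) (auto, metis list.simps(9))
  have kS: "keys (?S cs) \<subseteq> B" for cs using keys_sum_zip bs(1) by fast
  have "Q.S.independent ?K ?Us"
  proof (rule Q.S.trivial_combine_imp_independent[OF subfield_scalars Us])
    fix Ks assume "set Ks \<subseteq> ?K" and 0: "Q.S.combine Ks ?Us = \<zero>\<^bsub>mpoly_ring V Quot I\<^esub>"
    then obtain cs where cs: "Ks = map (\<lambda>c. cls (const c)) cs" using Ks by blast
    have "?S cs \<in> I" using 0 combine_cls[OF bV] cs cls_zero_iff by metis
    then have "?S cs = 0" using indep kS by blast
    then have "set (take (length bs) cs) \<subseteq> {0}" using sum_zip_eq_zero bs(2) by blast
    moreover have "cls (const 0) = \<zero>\<^bsub>mpoly_ring V Quot I\<^esub>" using Q.hom_zero by (simp add: const_simps)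
    ultimately show "set (take (length ?Us) Ks) \<subseteq> {\<zero>\<^bsub>mpoly_ring V Quot I\<^esub>}"
      unfolding cs by (auto simp: take_map)
  qed
  then have "Q.S.dimension (length ?Us) ?K (Q.S.Span ?K ?Us)" by (rule Q.S.dimension_independent)
  moreover have "Q.S.Span ?K ?Us = {cls f | f. f \<in> H}"
  proof -
    have "Q.S.Span ?K ?Us = {cls g | g. keys g \<subseteq> B}"
    proof (intro equalityI subsetI)
      fix x assume "x \<in> Q.S.Span ?K ?Us"
      then obtain Ks where "set Ks \<subseteq> ?K" "x = Q.S.combine Ks ?Us"
        using Q.S.Span_eq_combine_set[OF subfield_scalars Us] by auto
      then show "x \<in> {cls g | g. keys g \<subseteq> B}" using Ks combine_cls(1)[OF bV] kS by fast
    next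
      fix x assume "x \<in> {cls g | g. keys g \<subseteq> B}"
      then obtain g where g: "x = cls g" "keys g \<subseteq> B" by blast
      have "g = (\<Sum>b\<in>B. single b (lookup g b))"
        by (rule poly_mapping_sum_singles) (use B g in auto)
      also have "\<dots> = ?S (map (lookup g) bs)"
        unfolding bs(1)[symmetric] sum.distinct_set_conv_list[OF bs(2)]
        by (simp add: zip_map1 zip_same_conv_map comp_def)
      finally have "x = Q.S.combine (map (\<lambda>c. cls (const c)) (map (lookup g) bs)) ?Us"
        using g combine_cls(1)[OF bV] by metis
      moreover have "set (map (\<lambda>c. cls (const c)) (map (lookup g) bs)) \<subseteq> ?K" by auto
      ultimately show "x \<in> Q.S.Span ?K ?Us"
        unfolding Q.S.Span_eq_combine_set[OF subfield_scalars Us] by blast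
    qed
    also have "\<dots> = {cls f | f. f \<in> H}"
    proof (intro equalityI subsetI)
      fix x assume "x \<in> {cls f | f. f \<in> H}"
      then obtain f where f: "x = cls f" "f \<in> H" by blast
      then obtain g where "keys g \<subseteq> B" "f - g \<in> I" using span by blast
      then show "x \<in> {cls g | g. keys g \<subseteq> B}" using f cls_eq_iff[of f g] H by blast
    qed (use H in blast)
    finally show ?thesis .
  qed
  ultimately have "Q.S.dimension (card B) ?K {cls f | f. f \<in> H}"
    using distinct_card[OF bs(2)] bs(1) by simp
  moreover have "?K = {cls (const c) | c. True}" by auto
  ultimately show ?thesis using Q.S.dimI subfield_scalars by (auto simp: over_def)
qed

end


subsection \<open>Simplicial posets with labelled atoms\<close>

text \<open>Additive extension of a function on variables to monomials. Degree, label exponents and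
  the termination measure are instances.\<close>

definition weight :: "('p \<Rightarrow> nat) \<Rightarrow> ('p \<Rightarrow>\<^sub>0 nat) \<Rightarrow> nat" where
  "weight g e = (\<Sum>v\<in>keys e. lookup e v * g v)"

lemma weight_eq_sum: "finite A \<Longrightarrow> keys e \<subseteq> A \<Longrightarrow> weight g e = (\<Sum>v\<in>A. lookup e v * g v)"
  unfolding weight_def by (rule sum.mono_neutral_left) (auto simp: in_keys_iff)

lemma weight_add: "weight g (e + e') = weight g e + weight g e'"
  using weight_eq_sum[of "keys e \<union> keys e'" _ g]
  by (simp add: keys_plus_nat lookup_add distrib_right sum.distrib)

lemma weight_zero [simp]: "weight g 0 = 0"
  by (simp add: weight_def)

lemma weight_single [simp]: "weight g (single v n) = n * g v"
  by (simp add: weight_def)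

lemma weight_mono:
  "(\<And>v. v \<in> keys e \<Longrightarrow> g v \<le> N * h v) \<Longrightarrow> weight g e \<le> N * weight h e"
  unfolding weight_def sum_distrib_left
  by (intro sum_mono) (metis mult.left_commute mult_le_mono2)

lemma weight_cong: "(\<And>v. v \<in> keys e \<Longrightarrow> g v = h v) \<Longrightarrow> weight g e = weight h e"
  by (simp add: weight_def)

lemma weight_eq_0_iff: "weight g e = 0 \<longleftrightarrow> (\<forall>v\<in>keys e. g v = 0)"
  by (auto simp: weight_def in_keys_iff)

lemma split_off_factor:
  fixes e :: "'a \<Rightarrow>\<^sub>0 nat"
  assumes "v \<in> keys e"
  obtains e' where "e = e' + single v 1"
proof
  show "e = (e - single v 1) + single v 1"
    using assms by (intro poly_mapping_eqI) (auto simp: lookup_add lookup_minus lookup_single when_def in_keys_iff)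
qed

text \<open>\<open>supp x\<close> is a set of labels of the atoms below \<open>x\<close>; distinct atoms may share a
  label as long as they have no common upper bound.\<close>

locale labelled_simplicial_poset =
  fixes Q :: "'p rel" and supp :: "'p \<Rightarrow> 'e set" and bot :: 'p
  assumes finite_Field: "finite (Field Q)"
    and refl_Q: "x \<in> Field Q \<Longrightarrow> (x, x) \<in> Q"
    and trans_Q: "(x, y) \<in> Q \<Longrightarrow> (y, z) \<in> Q \<Longrightarrow> (x, z) \<in> Q"
    and le_iff: "(x, z) \<in> Q \<Longrightarrow> (y, z) \<in> Q \<Longrightarrow> (x, y) \<in> Q \<longleftrightarrow> supp x \<subseteq> supp y"
    and supp_inj: "(x, z) \<in> Q \<Longrightarrow> (y, z) \<in> Q \<Longrightarrow> supp x = supp y \<Longrightarrow> x = y"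
    and face_exists: "z \<in> Field Q \<Longrightarrow> T \<subseteq> supp z \<Longrightarrow> \<exists>x. (x, z) \<in> Q \<and> supp x = T"
    and bot_Field: "bot \<in> Field Q" and bot_le: "x \<in> Field Q \<Longrightarrow> (bot, x) \<in> Q"
    and finite_supp: "z \<in> Field Q \<Longrightarrow> finite (supp z)"
begin

section \<open>Meets, minimal upper bounds and ranks in terms of supports\<close>

lemma FieldQ: "(x, y) \<in> Q \<Longrightarrow> x \<in> Field Q" "(x, y) \<in> Q \<Longrightarrow> y \<in> Field Q"
  by (auto simp: Field_def)

lemma supp_mono: "(x, y) \<in> Q \<Longrightarrow> supp x \<subseteq> supp y"
  using le_iff[of x y y] refl_Q FieldQ by blast

lemma antisym_Q: "(x, y) \<in> Q \<Longrightarrow> (y, x) \<in> Q \<Longrightarrow> x = y"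
  using supp_inj[of x y y] supp_mono refl_Q FieldQ by blast

lemma supp_bot [simp]: "supp bot = {}"
  using face_exists[OF bot_Field, of "{}"] antisym_Q bot_le FieldQ by blast

lemma supp_eq_empty_iff: "x \<in> Field Q \<Longrightarrow> supp x = {} \<longleftrightarrow> x = bot"
  using supp_inj[OF bot_le refl_Q, of x] by auto

lemma poset_bot_eq: "poset_bot Q = bot"
  unfolding poset_bot_def using bot_Field bot_le antisym_Q by blast

text \<open>The bound \<open>w\<close> places \<open>x\<close> and \<open>y\<close> in one Boolean
  interval, where the face with support \<open>supp x \<inter> supp y\<close> is the greatest lower
  bound. Every common lower bound lies below \<open>w\<close> too, so this is the meet in the whole
  poset.\<close>

lemma poset_meet_props:
  assumes "(x, w) \<in> Q" "(y, w) \<in> Q"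
  shows "(poset_meet Q x y, x) \<in> Q" "(poset_meet Q x y, y) \<in> Q"
    "supp (poset_meet Q x y) = supp x \<inter> supp y"
proof -
  have "supp x \<inter> supp y \<subseteq> supp w" using supp_mono[OF assms(1)] by blast
  then obtain m where m: "(m, w) \<in> Q" "supp m = supp x \<inter> supp y"
    using face_exists[OF FieldQ(2)[OF assms(1)]] by metis
  have mx: "(m, x) \<in> Q" "(m, y) \<in> Q"
    using le_iff[OF m(1) assms(1)] le_iff[OF m(1) assms(2)] m(2) by simp_all
  have gr: "(u, m) \<in> Q" if u: "(u, x) \<in> Q" "(u, y) \<in> Q" for u
    using le_iff[OF trans_Q[OF u(1) assms(1)] m(1)] m(2) supp_mono[OF u(1)] supp_mono[OF u(2)] by simp
  have "poset_meet Q x y = m"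
    unfolding poset_meet_def
  proof (rule the_equality)
    fix z assume z: "(z, x) \<in> Q \<and> (z, y) \<in> Q \<and> (\<forall>w. (w, x) \<in> Q \<and> (w, y) \<in> Q \<longrightarrow> (w, z) \<in> Q)"
    then show "z = m" using gr[of z] mx antisym_Q by blast
  qed (use mx gr in blast)
  then show "(poset_meet Q x y, x) \<in> Q" "(poset_meet Q x y, y) \<in> Q"
    "supp (poset_meet Q x y) = supp x \<inter> supp y" using mx m by auto
qed

lemma upper_bound_above_join:
  assumes "(x, w) \<in> Q" "(y, w) \<in> Q"
  obtains z where "(x, z) \<in> Q" "(y, z) \<in> Q" "(z, w) \<in> Q" "supp z = supp x \<union> supp y"
proof -
  have "supp x \<union> supp y \<subseteq> supp w" using supp_mono[OF assms(1)] supp_mono[OF assms(2)] by blast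
  then obtain z where z: "(z, w) \<in> Q" "supp z = supp x \<union> supp y"
    using face_exists[OF FieldQ(2)[OF assms(1)]] by metis
  then show thesis using that[of z] le_iff[OF assms(1) z(1)] le_iff[OF assms(2) z(1)] by simp
qed

text \<open>Every upper bound has below it a face with support \<open>supp x \<union> supp y\<close>
  that is already an upper bound. Different upper bounds may yield different such faces.\<close>

lemma minimal_upper_bounds_eq:
  "minimal_upper_bounds Q x y = {z. (x, z) \<in> Q \<and> (y, z) \<in> Q \<and> supp z = supp x \<union> supp y}"
    (is "?L = ?R")
proof (intro equalityI subsetI)
  fix w assume w: "w \<in> ?L"
  then have xw: "(x, w) \<in> Q" "(y, w) \<in> Q" by (auto simp: minimal_upper_bounds_def upper_bounds_def)
  obtain z where "(x, z) \<in> Q" "(y, z) \<in> Q" "(z, w) \<in> Q" "supp z = supp x \<union> supp y"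
    using upper_bound_above_join[OF xw] .
  moreover from this have "z = w" using w by (auto simp: minimal_upper_bounds_def upper_bounds_def)
  ultimately show "w \<in> ?R" by auto
next
  fix w assume w: "w \<in> ?R"
  have "u = w" if u: "(x, u) \<in> Q" "(y, u) \<in> Q" "(u, w) \<in> Q" for u
  proof (rule supp_inj[OF u(3) refl_Q[OF FieldQ(2)[OF u(3)]]])
    show "supp u = supp w"
      using w supp_mono[OF u(1)] supp_mono[OF u(2)] supp_mono[OF u(3)] by auto
  qed
  then show "w \<in> ?L" using w by (auto simp: minimal_upper_bounds_def upper_bounds_def)
qed

lemma chain_has_greatest:
  assumes "finite C" "C \<noteq> {}" "C \<subseteq> Field Q" "\<forall>x\<in>C. \<forall>y\<in>C. (x, y) \<in> Q \<or> (y, x) \<in> Q"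
  shows "\<exists>v\<in>C. \<forall>u\<in>C. (u, v) \<in> Q"
  using assms
proof (induction C rule: finite_ne_induct)
  case (singleton x)
  then show ?case by auto
next
  case (insert x F)
  then obtain v where v: "v \<in> F" "\<forall>u\<in>F. (u, v) \<in> Q" by auto
  have "(x, v) \<in> Q \<or> (v, x) \<in> Q" "(x, x) \<in> Q" using insert.prems v by auto
  then show ?case using v trans_Q by (metis insert_iff)
qed

text \<open>Deleting one label at a time leads from \<open>z\<close> down to \<open>bot\<close>;
  this chain attains the maximum in the definition of the rank.\<close>

lemma chain_of_length_rank:
  assumes "z \<in> Field Q"
  shows "\<exists>C. C \<in> Chains Q \<and> C \<subseteq> {x. (x, z) \<in> Q} \<and> card C = Suc (card (supp z))"
  using assms
proof (induction "card (supp z)" arbitrary: z)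
  case 0
  then show ?case by (intro exI[of _ "{z}"]) (auto simp: Chains_def refl_Q)
next
  case (Suc n)
  then obtain a where a: "a \<in> supp z" by (metis card.empty ex_in_conv nat.distinct(1))
  obtain y where y: "(y, z) \<in> Q" "supp y = supp z - {a}"
    using face_exists[of z "supp z - {a}"] Suc.prems by blast
  have n: "n = card (supp y)" using y a Suc.hyps finite_supp[OF Suc.prems] by simp
  obtain C where C: "C \<in> Chains Q" "C \<subseteq> {x. (x, y) \<in> Q}" "card C = Suc n"
    using Suc.hyps(1)[OF n] FieldQ[OF y(1)] n by auto
  have "z \<notin> C" using C(2) supp_mono[of z y] y(2) a by auto
  moreover have "finite C" using C(3) card.infinite by fastforce
  ultimately have "card (insert z C) = Suc (card (supp z))" using C Suc.hyps by simp
  moreover have "insert z C \<subseteq> {x. (x, z) \<in> Q}" using C(2) y(1) trans_Q refl_Q[OF Suc.prems] by blast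
  moreover from this have "insert z C \<in> Chains Q" using C(1) by (auto simp: Chains_def)
  ultimately show ?case by blast
qed

lemma poset_rank_eq:
  assumes "z \<in> Field Q"
  shows "poset_rank Q z = card (supp z)"
  unfolding poset_rank_def poset_bot_eq
proof (rule Max_eqI)
  let ?M = "{card C - 1 | C. C \<in> Chains Q \<and> C \<subseteq> {x. (bot, x) \<in> Q \<and> (x, z) \<in> Q}}"
  show le: "n \<le> card (supp z)" if n: "n \<in> ?M" for n
  proof -
    obtain C where C: "C \<in> Chains Q" "C \<subseteq> {x. (x, z) \<in> Q}" "n = card C - 1" using n by blast
    \<comment> \<open>Comparable faces whose finite supports are equally large have the same
      support, and below \<open>z\<close> the support determines the face.\<close>
    have "inj_on (\<lambda>x. card (supp x)) C"
    proof (rule inj_onI)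
      fix x y assume xy: "x \<in> C" "y \<in> C" "card (supp x) = card (supp y)"
      then have z: "(x, z) \<in> Q" "(y, z) \<in> Q" using C by auto
      have "(x, y) \<in> Q \<or> (y, x) \<in> Q" using C(1) xy by (auto simp: Chains_def)
      then have "supp x = supp y"
        using supp_mono xy(3) finite_supp z FieldQ by (metis card_subset_eq)
      then show "x = y" using supp_inj z by blast
    qed
    moreover have "(\<lambda>x. card (supp x)) ` C \<subseteq> {..card (supp z)}"
      using C(2) card_mono[OF finite_supp[OF assms] supp_mono] by auto
    ultimately have "card C \<le> card {..card (supp z)}"
      by (metis card_image card_mono finite_atMost)
    then show ?thesis using C(3) by simp
  qed
  show "finite ?M" using le by (meson finite_nat_set_iff_bounded_le)
  obtain C where "C \<in> Chains Q" "C \<subseteq> {x. (x, z) \<in> Q}" "card C = Suc (card (supp z))"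
    using chain_of_length_rank[OF assms] by blast
  then show "card (supp z) \<in> ?M"
    using bot_le FieldQ by (intro CollectI exI[of _ C]) auto
qed

text \<open>The exponent of the label \<open>a\<close> after each variable \<open>v\<close> is
  replaced by the product of the labels in \<open>supp v\<close>.\<close>

definition content :: "('p \<Rightarrow>\<^sub>0 nat) \<Rightarrow> 'e \<Rightarrow> nat" where
  "content e a = weight (\<lambda>v. of_bool (a \<in> supp v)) e"

text \<open>Repeated factors are allowed. \<open>bot\<close> is excluded because its variable
  becomes 1 in the Stanley--Reisner ring.\<close>

definition chain :: "('p \<Rightarrow>\<^sub>0 nat) \<Rightarrow> bool" where
  "chain e \<longleftrightarrow> bot \<notin> keys e \<and> (\<forall>x\<in>keys e. \<forall>y\<in>keys e. (x, y) \<in> Q \<or> (y, x) \<in> Q)"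

definition down :: "'p \<Rightarrow> 'p set" where
  "down z = {x. (x, z) \<in> Q}"

lemma down_Field: "down z \<subseteq> Field Q"
  by (auto simp: down_def Field_def)

lemma content_add: "content (e + e') a = content e a + content e' a"
  by (simp add: content_def weight_add)

lemma content_zero [simp]: "content 0 a = 0"
  by (simp add: content_def)

lemma content_single [simp]: "content (single v n) a = n * of_bool (a \<in> supp v)"
  by (simp add: content_def)

lemma content_eq_0_iff: "content e a = 0 \<longleftrightarrow> (\<forall>v\<in>keys e. a \<notin> supp v)"
  by (simp add: content_def weight_eq_0_iff)

lemma degree_eq_weight: "keys e \<subseteq> Field Q \<Longrightarrow> sr_degree Q e = weight (\<lambda>v. card (supp v)) e"
  unfolding sr_degree_def weight_def[symmetric] by (intro weight_cong) (auto simp: poset_rank_eq)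

text \<open>Double counting of the pairs of a factor and a label in its support.\<close>

lemma degree_eq_content:
  assumes "keys e \<subseteq> down z" "z \<in> Field Q"
  shows "sr_degree Q e = (\<Sum>a\<in>supp z. content e a)"
proof -
  have "card (supp v) = (\<Sum>a\<in>supp z. of_bool (a \<in> supp v))" if "v \<in> keys e" for v
  proof -
    have "supp v \<subseteq> supp z" using that assms supp_mono by (auto simp: down_def)
    then show ?thesis using finite_supp[OF assms(2)]
      by (simp add: Int_absorb1 flip: sum.inter_restrict)
  qed
  then have "weight (\<lambda>v. card (supp v)) e = (\<Sum>a\<in>supp z. content e a)"
    unfolding content_def weight_def
    by (subst sum.swap) (intro sum.cong refl, simp add: sum_distrib_left)
  then show ?thesis using assms(1) down_Field degree_eq_weight by (metis subset_trans)
qed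

lemma supp_greatest_factor:
  assumes "v \<in> keys e" "keys e \<subseteq> down v"
  shows "supp v = {a. content e a \<noteq> 0}"
proof -
  have "supp u \<subseteq> supp v" if "u \<in> keys e" for u
    using supp_mono[of u v] that assms by (auto simp: down_def)
  then show ?thesis using assms(1) by (auto simp: content_eq_0_iff)
qed

lemma chain_top:
  assumes "chain e" "keys e \<subseteq> Field Q" "e \<noteq> 0"
  obtains v where "v \<in> keys e" "keys e \<subseteq> down v" "supp v = {a. content e a \<noteq> 0}"
proof -
  obtain v where v: "v \<in> keys e" "\<forall>u\<in>keys e. (u, v) \<in> Q"
    using chain_has_greatest[of "keys e"] assms by (auto simp: chain_def)
  then have "keys e \<subseteq> down v" by (auto simp: down_def)
  then show thesis using that supp_greatest_factor v(1) by blast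
qed

lemma chain_content_zero: "chain e \<Longrightarrow> keys e \<subseteq> Field Q \<Longrightarrow> content e = (\<lambda>_. 0) \<Longrightarrow> e = 0"
  using chain_top[of e] supp_eq_empty_iff by (metis (mono_tags, lifting) Collect_empty_eq chain_def subsetD)

text \<open>The labels with non-zero exponent form the support of the greatest factor, and below
  \<open>z\<close> a support determines its face. Both monomials therefore have the same greatest
  factor; splitting it off lowers the number of factors.\<close>

lemma chain_content_inj:
  assumes "chain e" "chain e'" "keys e \<subseteq> down z" "keys e' \<subseteq> down z" "content e = content e'"
  shows "e = e'"
  using assms
proof (induction "weight (\<lambda>_. 1) e" arbitrary: e e')
  case 0
  then have "e = 0" by (auto simp: weight_eq_0_iff)
  then show ?case using chain_content_zero[of e'] 0 down_Field by fastforce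
next
  case (Suc n)
  have F: "keys e \<subseteq> Field Q" "keys e' \<subseteq> Field Q" using Suc.prems down_Field by blast+
  have "e \<noteq> 0" using Suc.hyps by auto
  then have "e' \<noteq> 0" using chain_content_zero[of e] Suc.prems F by fastforce
  obtain v where v: "v \<in> keys e" "supp v = {a. content e a \<noteq> 0}"
    by (rule chain_top[OF Suc.prems(1) F(1) \<open>e \<noteq> 0\<close>])
  obtain v' where v': "v' \<in> keys e'" "supp v' = {a. content e' a \<noteq> 0}"
    by (rule chain_top[OF Suc.prems(2) F(2) \<open>e' \<noteq> 0\<close>])
  have vz: "(v, z) \<in> Q" "(v', z) \<in> Q" using v(1) v'(1) Suc.prems(3,4) by (auto simp: down_def)
  have "supp v = supp v'" unfolding v(2) v'(2) Suc.prems(5) ..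
  have "v = v'" by (rule supp_inj[OF vz \<open>supp v = supp v'\<close>])
  obtain e1 where e1: "e = e1 + single v 1" by (rule split_off_factor[OF v(1)])
  obtain e1' where e1': "e' = e1' + single v 1"
    by (rule split_off_factor[OF v'(1)[folded \<open>v = v'\<close>]])
  have "e1 = e1'"
  proof (rule Suc.hyps(1))
    show "n = weight (\<lambda>_. 1) e1" using Suc.hyps(2) by (simp add: e1 weight_add)
    show "content e1 = content e1'"
      using Suc.prems(5) unfolding e1 e1' by (auto simp: fun_eq_iff content_add)
  qed (use Suc.prems in \<open>auto simp: e1 e1' chain_def keys_plus_nat\<close>)
  then show ?case by (simp add: e1 e1')
qed

text \<open>Layer-cake decomposition: the sets of labels with \<open>f a \<ge> i\<close>, for i = 1,
  2, ..., are nested subsets of \<open>supp z\<close>, and the corresponding faces of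
  \<open>z\<close> are the factors.\<close>

lemma chain_with_content_exists:
  assumes "z \<in> Field Q" "{a. f a \<noteq> 0} = supp z"
  shows "\<exists>e. chain e \<and> keys e \<subseteq> down z \<and> content e = f"
  using assms
proof (induction "\<Sum>a\<in>supp z. f a" arbitrary: z f rule: less_induct)
  case less
  show ?case
  proof (cases "supp z = {}")
    case True
    then show ?thesis using less.prems
      by (intro exI[of _ 0]) (auto simp: chain_def content_def fun_eq_iff)
  next
    case False
    \<comment> \<open>The lowest layer, whose face is \<open>z\<close> itself, is peeled off.
      Truncated subtraction keeps the exponents outside \<open>supp z\<close> at 0.\<close>
    define f' where "f' a = f a - 1" for a
    have "{a. f' a \<noteq> 0} \<subseteq> supp z" using less.prems(2) by (auto simp: f'_def)
    then obtain z' where z': "(z', z) \<in> Q" "supp z' = {a. f' a \<noteq> 0}"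
      using face_exists[OF less.prems(1)] by metis
    have fz: "finite (supp z)" using finite_supp less.prems by blast
    have "sum f' (supp z') \<le> sum f' (supp z)"
      using supp_mono[OF z'(1)] fz by (intro sum_mono2) auto
    \<comment> \<open>Every label of the non-empty set \<open>supp z\<close> loses exactly one, so
      the induction measure drops.\<close>
    also have "\<dots> < sum f (supp z)"
    proof (intro sum_strict_mono fz False)
      show "f' a < f a" if "a \<in> supp z" for a
        using that less.prems(2)[symmetric] by (auto simp: f'_def)
    qed
    finally obtain e where e: "chain e" "keys e \<subseteq> down z'" "content e = f'"
      using less.hyps[of f' z'] z' FieldQ by metis
    have "keys e \<subseteq> down z" using e(2) z'(1) trans_Q by (auto simp: down_def)
    moreover have "(z, z) \<in> Q" using refl_Q less.prems by blast
    moreover have "z \<noteq> bot" using False by auto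
    moreover have "content (e + single z 1) = f"
    proof
      fix a
      have "f a > 0 \<longleftrightarrow> a \<in> supp z" using less.prems(2) by auto
      then show "content (e + single z 1) a = f a"
        by (cases "a \<in> supp z") (simp_all add: content_add e(3) f'_def)
    qed
    moreover have K: "keys (e + single z 1) = insert z (keys e)" by (simp add: keys_plus_nat)
    ultimately have "keys (e + single z 1) \<subseteq> down z" "content (e + single z 1) = f"
      by (simp_all add: down_def)
    moreover have "chain (e + single z 1)"
      using e(1) \<open>keys e \<subseteq> down z\<close> \<open>(z, z) \<in> Q\<close> \<open>z \<noteq> bot\<close>
      unfolding chain_def K down_def by blast
    ultimately show ?thesis by blast
  qed
qed

definition standard :: "nat \<Rightarrow> ('p \<Rightarrow>\<^sub>0 nat) set" where
  "standard d = {e. chain e \<and> keys e \<subseteq> Field Q \<and> sr_degree Q e = d}"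

text \<open>The empty monomial has no greatest factor; with \<open>bot\<close> as its value, the
  support of the top is always the set of labels that occur.\<close>

definition top_of :: "('p \<Rightarrow>\<^sub>0 nat) \<Rightarrow> 'p" where
  "top_of e = (if e = 0 then bot else SOME v. v \<in> keys e \<and> keys e \<subseteq> down v)"

lemma top_of:
  assumes "chain e" "keys e \<subseteq> Field Q"
  shows "top_of e \<in> Field Q" "keys e \<subseteq> down (top_of e)" "supp (top_of e) = {a. content e a \<noteq> 0}"
proof -
  have "top_of e \<in> Field Q \<and> keys e \<subseteq> down (top_of e) \<and> supp (top_of e) = {a. content e a \<noteq> 0}"
  proof (cases "e = 0")
    case True
    then show ?thesis using bot_Field by (simp add: top_of_def)
  next
    case False
    obtain v where "v \<in> keys e" "keys e \<subseteq> down v" by (rule chain_top[OF assms False])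
    then have t: "top_of e \<in> keys e \<and> keys e \<subseteq> down (top_of e)"
      using False unfolding top_of_def by simp (rule someI[of _ v], simp)
    then show ?thesis using supp_greatest_factor assms(2) by blast
  qed
  then show "top_of e \<in> Field Q" "keys e \<subseteq> down (top_of e)" "supp (top_of e) = {a. content e a \<noteq> 0}"
    by auto
qed

text \<open>Injectivity: equal tops put both chains below one face, where the content decides.
  Surjectivity: the chain built below \<open>z\<close> has a top below \<open>z\<close> with the
  same support, which is then \<open>z\<close>.\<close>

lemma bij_betw_standard:
  "bij_betw (\<lambda>e. (top_of e, content e)) (standard d)
     (SIGMA z:Field Q. {f. {a. f a \<noteq> 0} = supp z \<and> sum f (supp z) = d})"
proof (rule bij_betwI')
  fix e e' assume "e \<in> standard d" "e' \<in> standard d"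
  then have e: "chain e" "keys e \<subseteq> Field Q" and e': "chain e'" "keys e' \<subseteq> Field Q"
    by (simp_all add: standard_def)
  show "(top_of e, content e) = (top_of e', content e') \<longleftrightarrow> e = e'"
  proof
    assume eq: "(top_of e, content e) = (top_of e', content e')"
    show "e = e'"
      by (rule chain_content_inj[OF e(1) e'(1) top_of(2)[OF e]]) (use eq top_of(2)[OF e'] in simp_all)
  qed simp
next
  fix e assume e: "e \<in> standard d"
  then have ch: "chain e" "keys e \<subseteq> Field Q" and d: "sr_degree Q e = d" by (simp_all add: standard_def)
  note t = top_of[OF ch]
  show "(top_of e, content e) \<in> (SIGMA z:Field Q. {f. {a. f a \<noteq> 0} = supp z \<and> sum f (supp z) = d})"
    using degree_eq_content[OF t(2,1)] d t(1,3) by simp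
next
  fix p assume "p \<in> (SIGMA z:Field Q. {f. {a. f a \<noteq> 0} = supp z \<and> sum f (supp z) = d})"
  then obtain z f where p: "p = (z, f)" "z \<in> Field Q" "{a. f a \<noteq> 0} = supp z" "sum f (supp z) = d"
    by auto
  obtain e where e: "chain e" "keys e \<subseteq> down z" "content e = f"
    using chain_with_content_exists p by blast
  have eF: "keys e \<subseteq> Field Q" using e down_Field by blast
  have "top_of e = z"
  proof (cases "e = 0")
    case True
    then have "supp z = {}" using p(3) e(3) by auto
    then show ?thesis using True supp_eq_empty_iff[OF p(2)] by (simp add: top_of_def)
  next
    case False
    obtain v where "v \<in> keys e" "keys e \<subseteq> down v" by (rule chain_top[OF e(1) eF False])
    then have "top_of e \<in> keys e \<and> keys e \<subseteq> down (top_of e)"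
      using False unfolding top_of_def by simp (rule someI[of _ v], simp)
    then have "(top_of e, z) \<in> Q" using e(2) by (auto simp: down_def)
    moreover have "supp (top_of e) = supp z" using p(3) e(3) top_of(3)[OF e(1) eF] by simp
    ultimately show ?thesis using supp_inj[OF _ refl_Q[OF p(2)]] by blast
  qed
  then show "\<exists>e\<in>standard d. p = (top_of e, content e)"
    using p e eF degree_eq_content[OF e(2) p(2)] by (intro bexI[of _ e]) (simp_all add: standard_def)
qed

end


subsection \<open>The standard monomial basis of the Stanley--Reisner ring\<close>

lemma poly_mapping_mult_expand:
  fixes p q :: "'a::monoid_add \<Rightarrow>\<^sub>0 'b::semiring_0"
  shows "p * q = (\<Sum>a\<in>keys p. \<Sum>b\<in>keys q. single (a + b) (lookup p a * lookup q b))"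
proof -
  have "p * q = (\<Sum>a\<in>keys p. single a (lookup p a)) * (\<Sum>b\<in>keys q. single b (lookup q b))"
    using poly_mapping_sum_singles[of "keys p" p] poly_mapping_sum_singles[of "keys q" q] by simp
  then show ?thesis by (simp add: sum_product mult_single)
qed

lemma finite_functions_with_support:
  fixes A :: "'e set"
  assumes "finite A"
  shows "finite {f :: 'e \<Rightarrow> nat. {a. f a \<noteq> 0} = A \<and> sum f A = d}"
proof (rule finite_subset)
  show "{f. {a. f a \<noteq> 0} = A \<and> sum f A = d} \<subseteq> {f. \<forall>a. (a \<in> A \<longrightarrow> f a \<in> {..d}) \<and> (a \<notin> A \<longrightarrow> f a = 0)}"
    using assms member_le_sum[of _ A] by fastforce
  show "finite {f. \<forall>a. (a \<in> A \<longrightarrow> f a \<in> {..d}) \<and> (a \<notin> A \<longrightarrow> f a = (0::nat))}"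
    using finite_set_of_finite_funs[OF assms, of "{..d}" 0] by simp
qed

context labelled_simplicial_poset
begin

section \<open>Restriction to faces and linear independence of chain monomials\<close>

abbreviation R :: "('p, 'k::field) mpoly ring" where "R \<equiv> mpoly_ring (Field Q)"

text \<open>The coefficient of \<open>f\<close> in the image of a polynomial under the ring homomorphism to the
  polynomial ring in the atoms below \<open>z\<close> which sends \<open>v \<le> z\<close> to the product of the atoms
  below \<open>v\<close> and all other variables to \<open>0\<close>.\<close>

definition face_coeff :: "'p \<Rightarrow> ('e \<Rightarrow> nat) \<Rightarrow> ('p, 'k::field) mpoly \<Rightarrow> 'k" where
  "face_coeff z f p = (\<Sum>e\<in>keys p. lookup p e * of_bool (keys e \<subseteq> down z \<and> content e = f))"

lemma face_coeff_eq_sum: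
  "finite A \<Longrightarrow> keys p \<subseteq> A \<Longrightarrow>
    face_coeff z f p = (\<Sum>e\<in>A. lookup p e * of_bool (keys e \<subseteq> down z \<and> content e = f))"
  unfolding face_coeff_def by (rule sum.mono_neutral_left) (auto simp: in_keys_iff)

lemma face_coeff_zero [simp]: "face_coeff z f 0 = 0"
  by (simp add: face_coeff_def)

lemma face_coeff_single:
  "face_coeff z f (single e c) = c * of_bool (keys e \<subseteq> down z \<and> content e = f)"
  by (simp add: face_coeff_def)

lemma face_coeff_one: "face_coeff z f 1 = of_bool (content 0 = f)"
  using face_coeff_single[of z f 0 1] by simp

lemma face_coeff_add: "face_coeff z f (p + q) = face_coeff z f p + face_coeff z f q"
  using face_coeff_eq_sum[of "keys p \<union> keys q" "p + q" z f] keys_add[of p q]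
    face_coeff_eq_sum[of "keys p \<union> keys q" p z f] face_coeff_eq_sum[of "keys p \<union> keys q" q z f]
  by (simp add: lookup_add distrib_right sum.distrib del: sum_mult_of_bool_eq)

lemma face_coeff_uminus: "face_coeff z f (- p) = - face_coeff z f p"
  by (simp add: face_coeff_def sum_negf)

lemma face_coeff_diff: "face_coeff z f (p - q) = face_coeff z f p - face_coeff z f q"
  using face_coeff_add[of z f p "- q"] by (simp add: face_coeff_uminus)

lemma face_coeff_sum: "face_coeff z f (sum g A) = (\<Sum>x\<in>A. face_coeff z f (g x))"
  by (induction A rule: infinite_finite_induct) (auto simp: face_coeff_add)

text \<open>A multiple inherits a vanishing image under the face homomorphism. For one monomial
  \<open>a\<close> of \<open>q\<close>, the coefficient at \<open>f\<close> is a multiple of that of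
  \<open>p\<close> at \<open>f\<close> minus the content of \<open>a\<close>.\<close>

lemma face_coeff_mult_eq_0:
  fixes p q :: "('p, 'k::field) mpoly"
  assumes "\<And>f. face_coeff z f p = 0"
  shows "face_coeff z f (q * p) = 0"
proof -
  have "(\<Sum>b\<in>keys p. face_coeff z f (single (a + b) (lookup q a * lookup p b))) = 0" for a
  \<comment> \<open>If \<open>a\<close> dies on the face or some exponent exceeds \<open>f\<close>,
    it contributes nothing. Otherwise the truncated subtraction from \<open>f\<close> is
    exact.\<close>
  proof (cases "keys a \<subseteq> down z \<and> (\<forall>x. content a x \<le> f x)")
    case True
    have "content (a + b) = f \<longleftrightarrow> content b = (\<lambda>x. f x - content a x)" for b
      using True by (auto simp: fun_eq_iff content_add) (metis add_diff_cancel_left' le_add_diff_inverse)+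
    then have "(\<Sum>b\<in>keys p. face_coeff z f (single (a + b) (lookup q a * lookup p b)))
      = lookup q a * face_coeff z (\<lambda>x. f x - content a x) p"
      using True unfolding face_coeff_def[of z _ p]
      by (simp add: face_coeff_single keys_plus_nat sum_distrib_left mult.assoc del: sum_mult_of_bool_eq)
    then show ?thesis using assms by simp
  next
    case False
    then have "\<not> (keys (a + b) \<subseteq> down z \<and> content (a + b) = f)" for b
      by (auto simp: keys_plus_nat content_add)
    then have "face_coeff z f (single (a + b) c) = 0" for b and c :: 'k
      by (auto simp: face_coeff_single)
    then show ?thesis by simp
  qed
  then show ?thesis by (simp add: poly_mapping_mult_expand face_coeff_sum)
qed

text \<open>The intersection of the kernels of all face homomorphisms, stated by coefficients
  instead of constructing the target rings.\<close>

definition face_kernel :: "('p, 'k::field) mpoly set" where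
  "face_kernel = {p \<in> carrier R. \<forall>z\<in>Field Q. \<forall>f. face_coeff z f p = 0}"

lemma ideal_face_kernel: "ideal (face_kernel :: ('p, 'k::field) mpoly set) R"
proof -
  interpret cring "R :: ('p, 'k) mpoly ring" by (rule cring_mpoly_ring)
  show ?thesis
  proof (rule idealI)
    show "subgroup (face_kernel :: ('p, 'k) mpoly set) (add_monoid R)"
    proof (rule add.subgroupI)
      show "\<ominus>\<^bsub>R\<^esub> a \<in> face_kernel" if "a \<in> face_kernel" for a :: "('p, 'k) mpoly"
        using that by (auto simp: face_kernel_def mpoly_ring_uminus mpoly_carrier_uminus face_coeff_uminus)
      have "0 \<in> (face_kernel :: ('p, 'k) mpoly set)" by (simp add: face_kernel_def)
      then show "(face_kernel :: ('p, 'k) mpoly set) \<noteq> {}" by blast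
    qed (auto simp: face_kernel_def face_coeff_add mpoly_carrier_add)
    show *: "x \<otimes>\<^bsub>R\<^esub> a \<in> face_kernel"
      if "a \<in> face_kernel" "x \<in> carrier R" for a x :: "('p, 'k) mpoly"
      using that by (simp add: face_kernel_def mpoly_carrier_mult face_coeff_mult_eq_0)
    show "a \<otimes>\<^bsub>R\<^esub> x \<in> face_kernel"
      if "a \<in> face_kernel" "x \<in> carrier R" for a x :: "('p, 'k) mpoly"
      using *[OF that] by (simp add: mult.commute)
  qed (rule ring_axioms)
qed

lemma var_mult: "var x * var y = single (single x 1 + single y 1) 1"
  by (simp add: var_def mult_single)

text \<open>On a face above both \<open>x\<close> and \<open>y\<close> exactly one minimal upper
  bound survives, and its product with the meet has the label exponents of the product of
  \<open>x\<close> and \<open>y\<close>. On any other face all terms of the relation vanish. The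
  variable of \<open>bot\<close> maps to the empty product.\<close>

lemma generators_face_kernel: "sr_generators Q \<subseteq> (face_kernel :: ('p, 'k::field) mpoly set)"
proof
  fix p :: "('p, 'k) mpoly" assume "p \<in> sr_generators Q"
  then consider x y where "p = var x * var y" "x \<in> Field Q" "y \<in> Field Q" "upper_bounds Q x y = {}"
    | x y where "p = var x * var y - var (poset_meet Q x y) * (\<Sum>z\<in>minimal_upper_bounds Q x y. var z)"
        "x \<in> Field Q" "y \<in> Field Q" "upper_bounds Q x y \<noteq> {}"
    | "p = var (poset_bot Q) - 1"
    unfolding sr_generators_def by blast
  then show "p \<in> face_kernel"
  proof cases
    case 1
    then have "face_coeff z f p = 0" for z f
      by (auto simp: upper_bounds_def var_mult face_coeff_single keys_plus_nat down_def)
    then show ?thesis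
      using 1 by (simp add: face_kernel_def mpoly_carrier_mult mpoly_carrier_var)
  next
    case 2
    let ?m = "poset_meet Q x y" and ?U = "minimal_upper_bounds Q x y"
    obtain w where w: "(x, w) \<in> Q" "(y, w) \<in> Q" using 2(4) by (auto simp: upper_bounds_def)
    note m = poset_meet_props[OF w]
    have fU: "finite ?U"
      by (rule finite_subset[OF _ finite_Field]) (auto simp: minimal_upper_bounds_eq intro: FieldQ)
    have car: "p \<in> carrier R"
      unfolding 2(1) using m(1) 2(2,3) FieldQ
      by (intro mpoly_carrier_diff mpoly_carrier_mult mpoly_carrier_sum mpoly_carrier_var)
        (auto simp: minimal_upper_bounds_eq)
    have "face_coeff z f p = 0" if z: "z \<in> Field Q" for z f
    proof -
      let ?c = "\<lambda>u v. of_bool (keys (single u 1 + single v (1::nat)) \<subseteq> down z \<and>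
                  content (single u 1 + single v 1) = f) :: 'k"
      have eq: "face_coeff z f p = ?c x y - (\<Sum>u\<in>?U. ?c ?m u)"
        unfolding 2(1) by (simp add: sum_distrib_left face_coeff_diff face_coeff_sum var_mult face_coeff_single)
      show ?thesis
      proof (cases "(x, z) \<in> Q \<and> (y, z) \<in> Q")
        case True
        obtain u where u: "(x, u) \<in> Q" "(y, u) \<in> Q" "(u, z) \<in> Q" "supp u = supp x \<union> supp y"
          using upper_bound_above_join True by metis
        have uU: "u \<in> ?U" using u by (simp add: minimal_upper_bounds_eq)
        \<comment> \<open>Minimal upper bounds share their support, and two faces of
          \<open>z\<close> with equal support coincide; hence no other one lies below
          \<open>z\<close>.\<close>
        have "?c ?m v = 0" if v: "v \<in> ?U - {u}" for v
        proof -
          have "(v, z) \<notin> Q" using supp_inj[OF _ u(3), of v] v u(4) by (auto simp: minimal_upper_bounds_eq)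
          then show ?thesis by (simp add: keys_plus_nat down_def)
        qed
        then have "(\<Sum>v\<in>?U. ?c ?m v) = ?c ?m u"
          using sum.neutral[of "?U - {u}" "?c ?m"] by (subst sum.remove[OF fU uU]) simp
        moreover have "content (single x 1 + single y 1) = content (single ?m 1 + single u 1)"
          by (auto simp: fun_eq_iff content_add m(3) u(4))
        moreover have "(?m, z) \<in> Q" using m(1) True trans_Q by blast
        ultimately show ?thesis using True u(3) unfolding eq by (simp add: keys_plus_nat down_def)
      next
        case False
        have "?c ?m v = 0" if v: "v \<in> ?U" for v
        proof -
          have "(v, z) \<notin> Q" using v False trans_Q[of x v z] trans_Q[of y v z]
            by (auto simp: minimal_upper_bounds_eq)
          then show ?thesis by (simp add: keys_plus_nat down_def)
        qed
        moreover have "?c x y = 0" using False by (auto simp: keys_plus_nat down_def)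
        ultimately show ?thesis unfolding eq by simp
      qed
    qed
    then show ?thesis using car by (simp add: face_kernel_def)
  next
    case 3
    have "content (single bot 1) = content 0" by (simp add: fun_eq_iff)
    then have "face_coeff z f p = 0" if "z \<in> Field Q" for z f
      using bot_le[OF that] unfolding 3
      by (simp add: poset_bot_eq face_coeff_diff var_def face_coeff_single face_coeff_one down_def)
    moreover have "p \<in> carrier R"
      unfolding 3 poset_bot_eq by (intro mpoly_carrier_diff mpoly_carrier_var bot_Field) simp
    ultimately show ?thesis by (simp add: face_kernel_def)
  qed
qed

lemma sr_generators_carrier: "sr_generators Q \<subseteq> carrier R"
  using generators_face_kernel by (auto simp: face_kernel_def)

lemma sr_ideal_face_kernel: "sr_ideal Q \<subseteq> (face_kernel :: ('p, 'k::field) mpoly set)"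
proof -
  interpret cring "R :: ('p, 'k) mpoly ring" by (rule cring_mpoly_ring)
  show ?thesis
    unfolding sr_ideal_def by (rule genideal_minimal[OF ideal_face_kernel generators_face_kernel])
qed

lemma mpoly_quotient_sr_ideal: "mpoly_quotient (Field Q) (sr_ideal Q :: ('p, 'k::field) mpoly set)"
proof (rule mpoly_quotient.intro)
  interpret cring "R :: ('p, 'k) mpoly ring" by (rule cring_mpoly_ring)
  show "ideal (sr_ideal Q :: ('p, 'k) mpoly set) R"
    unfolding sr_ideal_def by (rule genideal_ideal[OF sr_generators_carrier])
  \<comment> \<open>The unit has coefficient 1 on the face \<open>bot\<close>, so it lies outside
    the kernel and the ideal is proper.\<close>
  have "face_coeff bot (content 0) (1 :: ('p, 'k) mpoly) = 1" by (simp add: face_coeff_one)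
  then have "\<exists>z\<in>Field Q. \<exists>f. face_coeff z f (1 :: ('p, 'k) mpoly) \<noteq> 0"
    using bot_Field by (metis one_neq_zero)
  then have "(1 :: ('p, 'k) mpoly) \<notin> face_kernel" by (auto simp: face_kernel_def)
  then show "(1 :: ('p, 'k) mpoly) \<notin> sr_ideal Q" using sr_ideal_face_kernel by blast
qed

lemma ideal_sr_ideal: "ideal (sr_ideal Q :: ('p, 'k::field) mpoly set) R"
  using mpoly_quotient_sr_ideal by (rule mpoly_quotient.ideal)

lemma sr_ideal_add: "p \<in> sr_ideal Q \<Longrightarrow> q \<in> sr_ideal Q \<Longrightarrow> p + q \<in> sr_ideal Q"
  using additive_subgroup.a_closed[OF ideal.axioms(1)[OF ideal_sr_ideal], of p q] by simp

lemma sr_ideal_zero: "0 \<in> sr_ideal Q"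
  using additive_subgroup.zero_closed[OF ideal.axioms(1)[OF ideal_sr_ideal]] by simp

lemma sr_ideal_mult: "p \<in> sr_ideal Q \<Longrightarrow> q \<in> carrier R \<Longrightarrow> q * p \<in> sr_ideal Q"
  using ideal.I_l_closed[OF ideal_sr_ideal, of p q] by simp

lemma sr_generator_ideal:
  fixes p :: "('p, 'k::field) mpoly"
  assumes "p \<in> sr_generators Q"
  shows "p \<in> sr_ideal Q"
proof -
  interpret cring "R :: ('p, 'k) mpoly ring" by (rule cring_mpoly_ring)
  show ?thesis using genideal_self[OF sr_generators_carrier] assms by (auto simp: sr_ideal_def)
qed

text \<open>On the face given by the top of a monomial \<open>e\<close> of \<open>p\<close>, no
  other chain monomial has the content of \<open>e\<close>. The coefficient there is that of
  \<open>e\<close> in \<open>p\<close>, yet it vanishes on the ideal.\<close>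

lemma standard_independent:
  assumes "p \<in> sr_ideal Q" "keys p \<subseteq> standard d"
  shows "p = (0 :: ('p, 'k::field) mpoly)"
proof (rule ccontr)
  assume "p \<noteq> 0"
  then obtain e where e: "e \<in> keys p" using keys_eq_empty by blast
  have ch: "chain e'" "keys e' \<subseteq> Field Q" if "e' \<in> keys p" for e'
    using that assms(2) by (auto simp: standard_def)
  let ?z = "top_of e"
  have "of_bool (keys e' \<subseteq> down ?z \<and> content e' = content e) = (of_bool (e' = e) :: 'k)"
    if "e' \<in> keys p" for e'
    using chain_content_inj[of e' e ?z] ch[OF that] ch[OF e] top_of[OF ch[OF e]] by auto
  then have "face_coeff ?z (content e) p = (\<Sum>e'\<in>keys p. lookup p e' * of_bool (e' = e))"
    unfolding face_coeff_def by (intro sum.cong) auto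
  also have "\<dots> = lookup p e" using e by (simp add: sum.remove[of _ e])
  finally have "face_coeff ?z (content e) p \<noteq> 0" using e by (simp add: in_keys_iff)
  moreover have "?z \<in> Field Q" using top_of ch[OF e] by blast
  ultimately show False using assms(1) sr_ideal_face_kernel by (auto simp: face_kernel_def)
qed

section \<open>Straightening into chain monomials\<close>

definition reducible_to_standard :: "nat \<Rightarrow> ('p, 'k::field) mpoly \<Rightarrow> bool" where
  "reducible_to_standard d p \<longleftrightarrow> (\<exists>g. keys g \<subseteq> standard d \<and> p - g \<in> sr_ideal Q)"

lemma reducible_add:
  assumes "reducible_to_standard d p" "reducible_to_standard d q"
  shows "reducible_to_standard d (p + q)"
proof -
  obtain g h where gh: "keys g \<subseteq> standard d" "p - g \<in> sr_ideal Q"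
    "keys h \<subseteq> standard d" "q - h \<in> sr_ideal Q"
    using assms by (auto simp: reducible_to_standard_def)
  have "p + q - (g + h) = (p - g) + (q - h)" by simp
  also have "\<dots> \<in> sr_ideal Q" by (rule sr_ideal_add[OF gh(2,4)])
  finally have "p + q - (g + h) \<in> sr_ideal Q" .
  moreover have "keys (g + h) \<subseteq> standard d" using gh(1,3) keys_add[of g h] by blast
  ultimately show ?thesis unfolding reducible_to_standard_def by blast
qed

lemma reducible_ideal: "p \<in> sr_ideal Q \<Longrightarrow> reducible_to_standard d p"
  unfolding reducible_to_standard_def by (intro exI[of _ 0]) simp

lemma reducible_cong:
  assumes "p - q \<in> sr_ideal Q" "reducible_to_standard d q"
  shows "reducible_to_standard d p"
  using reducible_add[OF reducible_ideal[OF assms(1)] assms(2)] by simp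

lemma reducible_sum:
  "(\<And>x. x \<in> A \<Longrightarrow> reducible_to_standard d (f x)) \<Longrightarrow> reducible_to_standard d (sum f A)"
  by (induction A rule: infinite_finite_induct)
    (auto intro: reducible_add reducible_ideal sr_ideal_zero)

text \<open>Replacing two incomparable factors by their meet and a minimal upper bound keeps the degree
  but increases the sum of the squares of the ranks, which bounds the number of steps.\<close>

definition spread :: "('p \<Rightarrow>\<^sub>0 nat) \<Rightarrow> nat" where
  "spread e = weight (\<lambda>v. (card (supp v))\<^sup>2) e"

text \<open>The bound depends only on the degree, which straightening preserves, so the distance to
  the bound can serve as a decreasing measure.\<close>

lemma spread_le:
  assumes "keys e \<subseteq> Field Q"
  shows "spread e \<le> (\<Sum>v\<in>Field Q. card (supp v)) * sr_degree Q e"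
  unfolding spread_def degree_eq_weight[OF assms]
proof (rule weight_mono)
  fix v assume "v \<in> keys e"
  then have "card (supp v) \<le> (\<Sum>v\<in>Field Q. card (supp v))"
    using assms finite_Field by (intro member_le_sum) auto
  then show "(card (supp v))\<^sup>2 \<le> (\<Sum>v\<in>Field Q. card (supp v)) * card (supp v)"
    by (simp add: power2_eq_square)
qed

text \<open>With c = |A \<inter> B|, |A| = c + a and |B| = c + b, the right side exceeds the left by
  2ab.\<close>

lemma spread_increases:
  assumes "finite A" "finite B" "\<not> A \<subseteq> B" "\<not> B \<subseteq> A"
  shows "(card A)\<^sup>2 + (card B)\<^sup>2 < (card (A \<inter> B))\<^sup>2 + (card (A \<union> B))\<^sup>2"
proof -
  obtain a where a: "card A = card (A \<inter> B) + a" "a > 0"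
    using psubset_card_mono[of A "A \<inter> B"] assms by (metis Int_lower1 inf.absorb_iff1 less_imp_add_positive psubsetI)
  obtain b where b: "card B = card (A \<inter> B) + b" "b > 0"
    using psubset_card_mono[of B "A \<inter> B"] assms by (metis Int_lower2 inf.absorb_iff2 less_imp_add_positive psubsetI)
  have "card (A \<union> B) = card (A \<inter> B) + a + b"
    using card_Un_Int[OF assms(1,2)] a b by simp
  then show ?thesis using a b by (simp add: power2_eq_square algebra_simps)
qed

lemma monomial_reducible:
  assumes "keys e \<subseteq> Field Q"
  shows "reducible_to_standard (sr_degree Q e) (single e (c :: 'k::field))"
proof -
  let ?N = "\<Sum>v\<in>Field Q. card (supp v)"
  \<comment> \<open>Straightening lowers the first component, even if the meet it creates is
    \<open>bot\<close>. Removing a factor \<open>bot\<close> keeps the first component and lowers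
    the second.\<close>
  define r where "r = measures [\<lambda>e. ?N * sr_degree Q e - spread e, \<lambda>e. lookup e bot]"
  have "wf r" unfolding r_def by (rule wf_measures)
  then show ?thesis using assms
  proof (induction e rule: wf_induct_rule)
    case (less e)
    note IH = less.IH and eF = less.prems
    show ?case
    proof (cases "bot \<in> keys e")
      case True
      obtain e' where e': "e = e' + single bot 1" by (rule split_off_factor[OF True])
      have F: "keys e' \<subseteq> Field Q" using eF by (simp add: e' keys_plus_nat)
      have deg: "sr_degree Q e' = sr_degree Q e"
        unfolding degree_eq_weight[OF F] degree_eq_weight[OF eF] by (simp add: e' weight_add)
      have "spread e' = spread e" by (simp add: e' spread_def weight_add)
      then have red: "reducible_to_standard (sr_degree Q e') (single e' c)"
        using F deg by (intro IH) (simp_all add: r_def e' lookup_add)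
      have "single e c - single e' c = single e' c * (var (poset_bot Q) - 1)"
        by (simp add: e' poset_bot_eq var_def right_diff_distrib mult_single)
      also have "\<dots> \<in> sr_ideal Q"
        by (intro sr_ideal_mult sr_generator_ideal mpoly_carrier_single F) (simp add: sr_generators_def)
      finally show ?thesis using reducible_cong red deg by metis
    next
      case bot: False
      show ?thesis
      proof (cases "chain e")
        case True
        then have "keys (single e c) \<subseteq> standard (sr_degree Q e)" using eF by (simp add: standard_def)
        then show ?thesis unfolding reducible_to_standard_def
          by (intro exI[of _ "single e c"]) (simp add: sr_ideal_zero)
      next
        case False
        then obtain x y where xy: "x \<in> keys e" "y \<in> keys e" "(x, y) \<notin> Q" "(y, x) \<notin> Q"
          using bot by (auto simp: chain_def)
        have xyF: "x \<in> Field Q" "y \<in> Field Q" using xy eF by auto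
        obtain e1 where e1: "e = e1 + single y 1" by (rule split_off_factor[OF xy(2)])
        have "x \<in> keys e1" using xy refl_Q[OF xyF(1)] by (auto simp: e1 keys_plus_nat)
        then obtain e' where e': "e1 = e' + single x 1" by (rule split_off_factor)
        have e: "e = e' + (single x 1 + single y 1)" by (simp add: e1 e' add.assoc)
        have F: "keys e' \<subseteq> Field Q" using eF by (simp add: e keys_plus_nat)
        have sF: "single e' c \<in> carrier R" by (rule mpoly_carrier_single[OF F])
        have se: "single e c = single e' c * (var x * var y)"
          by (simp add: e var_mult mult_single)
        show ?thesis
        proof (cases "upper_bounds Q x y = {}")
          case True
          then have "var x * var y \<in> sr_ideal Q"
            using xyF by (intro sr_generator_ideal) (auto simp: sr_generators_def)
          then show ?thesis unfolding se by (intro reducible_ideal sr_ideal_mult[OF _ sF])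
        next
          case False
          let ?m = "poset_meet Q x y" and ?U = "minimal_upper_bounds Q x y"
          obtain w where w: "(x, w) \<in> Q" "(y, w) \<in> Q" using False by (auto simp: upper_bounds_def)
          note m = poset_meet_props[OF w]
          have inc: "\<not> supp x \<subseteq> supp y" "\<not> supp y \<subseteq> supp x"
            using xy le_iff[OF w] le_iff[OF w(2,1)] by auto
          have "reducible_to_standard (sr_degree Q e) (single (e' + (single ?m 1 + single u 1)) c)"
            if u: "u \<in> ?U" for u
          proof -
            let ?e = "e' + (single ?m 1 + single u 1)"
            have su: "supp u = supp x \<union> supp y" and uF: "u \<in> Field Q" and mF: "?m \<in> Field Q"
              using u FieldQ m(1) by (auto simp: minimal_upper_bounds_eq)
            have F': "keys ?e \<subseteq> Field Q" using F uF mF by (simp add: keys_plus_nat)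
            have fin: "finite (supp x)" "finite (supp y)" using finite_supp xyF by auto
            have deg: "sr_degree Q ?e = sr_degree Q e"
              unfolding degree_eq_weight[OF F'] degree_eq_weight[OF eF]
              using card_Un_Int[OF fin] by (simp add: e weight_add su m(3))
            have "spread e < spread ?e"
              using spread_increases[OF fin inc] by (simp add: spread_def e weight_add su m(3))
            \<comment> \<open>The larger spread still obeys \<open>spread_le\<close>, so the
              truncated difference falls strictly.\<close>
            then have "?N * sr_degree Q ?e - spread ?e < ?N * sr_degree Q e - spread e"
              using spread_le[OF F'] deg by simp
            then have "reducible_to_standard (sr_degree Q ?e) (single ?e c)"
              by (intro IH F') (simp add: r_def)
            then show ?thesis unfolding deg .
          qed
          then have "reducible_to_standard (sr_degree Q e)
                       (\<Sum>u\<in>?U. single (e' + (single ?m 1 + single u 1)) c)"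
            by (rule reducible_sum)
          moreover have "(\<Sum>u\<in>?U. single (e' + (single ?m 1 + single u 1)) c)
                  = single e' c * (var ?m * (\<Sum>u\<in>?U. var u))"
            by (simp add: sum_distrib_left var_mult mult_single)
          moreover have "single e c - single e' c * (var ?m * (\<Sum>u\<in>?U. var u))
                  = single e' c * (var x * var y - var ?m * (\<Sum>u\<in>?U. var u))"
            unfolding se by (simp add: right_diff_distrib)
          moreover have "\<dots> \<in> sr_ideal Q"
            using xyF False by (intro sr_ideal_mult[OF _ sF] sr_generator_ideal) (auto simp: sr_generators_def)
          ultimately show ?thesis using reducible_cong by metis
        qed
      qed
    qed
  qed
qed

theorem dim_graded_part:
  "ring.dim (sr_ring Q) (sr_scalars Q) (sr_graded_part Q d :: ('p, 'k::field) mpoly set set)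
     = (\<Sum>z\<in>Field Q. card {f :: 'e \<Rightarrow> nat. {a. f a \<noteq> 0} = supp z \<and> sum f (supp z) = d})"
proof -
  interpret q: mpoly_quotient "Field Q" "sr_ideal Q :: ('p, 'k) mpoly set"
    by (rule mpoly_quotient_sr_ideal)
  let ?H = "{f :: ('p, 'k) mpoly. f \<in> carrier R \<and> (\<forall>e\<in>keys f. sr_degree Q e = d)}"
  let ?P = "SIGMA z:Field Q. {f :: 'e \<Rightarrow> nat. {a. f a \<noteq> 0} = supp z \<and> sum f (supp z) = d}"
  have finP: "finite ?P"
    by (intro finite_SigmaI finite_Field finite_functions_with_support finite_supp)
  have "ring.dim (sr_ring Q) (sr_scalars Q) (sr_graded_part Q d :: ('p, 'k) mpoly set set)
      = card (standard d)"
    unfolding sr_ring_def sr_scalars_def sr_graded_part_def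
  proof (rule q.dim_eq_card[of "standard d" ?H, simplified mem_Collect_eq])
    show "finite (standard d)" using bij_betw_finite[OF bij_betw_standard] finP by blast
    show "\<exists>g. keys g \<subseteq> standard d \<and> f - g \<in> sr_ideal Q"
      if f: "f \<in> carrier R \<and> (\<forall>e\<in>keys f. sr_degree Q e = d)" for f :: "('p, 'k) mpoly"
    proof -
      have "reducible_to_standard d (\<Sum>e\<in>keys f. single e (lookup f e))"
        using f monomial_reducible by (intro reducible_sum) (fastforce simp: mpoly_carrier_iff)
      then show ?thesis
        using poly_mapping_sum_singles[of "keys f" f] by (simp add: reducible_to_standard_def)
    qed
  qed (auto simp: standard_def mpoly_carrier_iff intro: standard_independent[unfolded standard_def])
  also have "\<dots> = card ?P" by (rule bij_betw_same_card[OF bij_betw_standard])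
  also have "\<dots> = (\<Sum>z\<in>Field Q. card {f :: 'e \<Rightarrow> nat. {a. f a \<noteq> 0} = supp z \<and> sum f (supp z) = d})"
    by (intro card_SigmaI finite_Field ballI finite_functions_with_support finite_supp)
  finally show ?thesis .
qed

end


subsection \<open>The Hilbert series\<close>

text \<open>The series t + t^2 + ... = t / (1 - t), which records the positive exponents of a single
  label.\<close>

definition pos_fps :: "rat fps" where
  "pos_fps = Abs_fps (\<lambda>k. of_bool (k > 0))"

lemma fps_to_fls_pos_fps: "fps_to_fls pos_fps = fls_X / (1 - fls_X)"
proof -
  have "pos_fps = fps_X + fps_X * pos_fps"
    by (rule fps_ext) (simp add: pos_fps_def)
  then have "fps_to_fls pos_fps = fls_X + fls_X * fps_to_fls pos_fps"
    by (metis fls_times_fps_to_fls fps_X_to_fls fps_to_fls_plus)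
  moreover have "1 - fls_X \<noteq> (0 :: rat fls)"
    using fps_to_fls_eq_0_iff[of "1 - fps_X :: rat fps"] by (simp add: fps_eq_iff) (metis fps_X_nth zero_neq_one)
  ultimately show ?thesis by (simp add: field_simps)
qed

text \<open>Split off the value k of the function at \<open>a\<close>: it is positive and at most
  \<open>d\<close>, and the rest has support \<open>A\<close> and sum \<open>d - k\<close>.\<close>

lemma card_functions_with_support_insert:
  fixes A :: "'e set"
  assumes "finite A" "a \<notin> A"
  shows "card {f :: 'e \<Rightarrow> nat. {x. f x \<noteq> 0} = insert a A \<and> sum f (insert a A) = d}
    = (\<Sum>k\<in>{1..d}. card {f :: 'e \<Rightarrow> nat. {x. f x \<noteq> 0} = A \<and> sum f A = d - k})"
proof -
  let ?F = "\<lambda>A d. {f :: 'e \<Rightarrow> nat. {x. f x \<noteq> 0} = A \<and> sum f A = d}"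
  have "bij_betw (\<lambda>f. (f a, f(a := 0))) (?F (insert a A) d) (SIGMA k:{1..d}. ?F A (d - k))"
  proof (rule bij_betw_byWitness[of _ "\<lambda>(k, g). g(a := k)"])
    show "(\<lambda>f. (f a, f(a := 0))) ` ?F (insert a A) d \<subseteq> (SIGMA k:{1..d}. ?F A (d - k))"
    proof
      fix p assume "p \<in> (\<lambda>f. (f a, f(a := 0))) ` ?F (insert a A) d"
      then obtain f where p: "p = (f a, f(a := 0))" and f: "{x. f x \<noteq> 0} = insert a A"
        and s: "sum f (insert a A) = d" by blast
      have fa: "f a > 0" using f by blast
      have "sum f (insert a A) = f a + sum (f(a := 0)) A"
        using assms by (simp add: sum.insert) (intro sum.cong; auto)
      moreover have "{x. (f(a := 0)) x \<noteq> 0} = {x. f x \<noteq> 0} - {a}" by auto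
      then have "{x. (f(a := 0)) x \<noteq> 0} = A" unfolding f using assms(2) by blast
      ultimately show "p \<in> (SIGMA k:{1..d}. ?F A (d - k))" using fa s by (simp add: p)
    qed
    show "(\<lambda>(k, g). g(a := k)) ` (SIGMA k:{1..d}. ?F A (d - k)) \<subseteq> ?F (insert a A) d"
    proof
      fix f assume "f \<in> (\<lambda>(k, g). g(a := k)) ` (SIGMA k:{1..d}. ?F A (d - k))"
      then obtain k g where f: "f = g(a := k)" and k: "1 \<le> k" "k \<le> d"
        and g: "{x. g x \<noteq> 0} = A" "sum g A = d - k" by auto
      have "sum f (insert a A) = k + sum g A"
        using assms by (simp add: f sum.insert) (intro sum.cong; auto)
      moreover have "{x. f x \<noteq> 0} = insert a {x. g x \<noteq> 0}" using k by (auto simp: f)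
      ultimately show "f \<in> ?F (insert a A) d" using g k by simp
    qed
    show "\<forall>p\<in>SIGMA k:{1..d}. ?F A (d - k).
            ((case p of (k, g) \<Rightarrow> g(a := k)) a, (case p of (k, g) \<Rightarrow> g(a := k))(a := 0)) = p"
    proof
      fix p assume "p \<in> (SIGMA k:{1..d}. ?F A (d - k))"
      then obtain k g where p: "p = (k, g)" and g: "{x. g x \<noteq> 0} = A" by auto
      have "g a = 0" using g assms(2) by blast
      then have "g(a := 0) = g" by auto
      then show "((case p of (k, g) \<Rightarrow> g(a := k)) a, (case p of (k, g) \<Rightarrow> g(a := k))(a := 0)) = p"
        by (simp add: p)
    qed
  qed auto
  then have "card (?F (insert a A) d) = card (SIGMA k:{1..d}. ?F A (d - k))"
    by (rule bij_betw_same_card)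
  also have "\<dots> = (\<Sum>k\<in>{1..d}. card (?F A (d - k)))"
    by (intro card_SigmaI ballI finite_functions_with_support assms) simp
  finally show ?thesis .
qed

lemma fps_card_functions_with_support:
  fixes A :: "'e set"
  assumes "finite A"
  shows "Abs_fps (\<lambda>d. of_nat (card {f :: 'e \<Rightarrow> nat. {x. f x \<noteq> 0} = A \<and> sum f A = d})) = pos_fps ^ card A"
  using assms
proof (induction A)
  case empty
  have "{f :: 'e \<Rightarrow> nat. {x. f x \<noteq> 0} = {} \<and> sum f {} = d} = (if d = 0 then {\<lambda>_. 0} else {})" for d
    by auto
  then show ?case by (intro fps_ext) simp
next
  case (insert a A)
  show ?case
  proof (rule fps_ext)
    fix d
    have "(pos_fps ^ card (insert a A)) $ d = (pos_fps * pos_fps ^ card A) $ d"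
      using insert by simp
    also have "\<dots> = (\<Sum>k=0..d. of_bool (k > 0) *
        of_nat (card {f :: 'e \<Rightarrow> nat. {x. f x \<noteq> 0} = A \<and> sum f A = d - k}))"
      unfolding insert.IH[symmetric] by (simp add: fps_mult_nth pos_fps_def)
    also have "\<dots> = (\<Sum>k\<in>{1..d}. of_nat (card {f :: 'e \<Rightarrow> nat. {x. f x \<noteq> 0} = A \<and> sum f A = d - k}))"
      by (intro sum.mono_neutral_cong_right) auto
    finally show "Abs_fps (\<lambda>d. of_nat (card {f :: 'e \<Rightarrow> nat. {x. f x \<noteq> 0} = insert a A \<and>
        sum f (insert a A) = d})) $ d = (pos_fps ^ card (insert a A)) $ d"
      using card_functions_with_support_insert[OF insert.hyps, of d] by simp
  qed
qed

lemma (in labelled_simplicial_poset) Hilb_eq: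
  "Hilb TYPE('k::field) Q = (\<Sum>z\<in>Field Q. pos_fps ^ card (supp z))"
proof -
  have "Hilb TYPE('k) Q = (\<Sum>z\<in>Field Q.
      Abs_fps (\<lambda>d. of_nat (card {f :: 'e \<Rightarrow> nat. {x. f x \<noteq> 0} = supp z \<and> sum f (supp z) = d})))"
    unfolding Hilb_def dim_graded_part by (rule fps_ext) (simp add: fps_sum_nth)
  also have "\<dots> = (\<Sum>z\<in>Field Q. pos_fps ^ card (supp z))"
    by (intro sum.cong refl fps_card_functions_with_support finite_supp)
  finally show ?thesis .
qed


subsection \<open>Independence posets of compatible systems of projections\<close>

text \<open>\<open>\<rho> T\<close> stands for the iterated projections from all \<open>C S\<close>
  with \<open>T \<subseteq> S\<close>, hence is indexed by its target alone. Bare sets allow a full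
  structure and its torsion-free part to be treated alike.\<close>

locale projection_system =
  fixes \<Delta> :: "'e set set" and C :: "'e set \<Rightarrow> 'g set" and \<rho> :: "'e set \<Rightarrow> 'g \<Rightarrow> 'g"
  assumes finite_complex: "finite \<Delta>" and finite_face: "S \<in> \<Delta> \<Longrightarrow> finite S"
    and subset_face: "S \<in> \<Delta> \<Longrightarrow> T \<subseteq> S \<Longrightarrow> T \<in> \<Delta>" and empty_face: "{} \<in> \<Delta>"
    and finite_C: "S \<in> \<Delta> \<Longrightarrow> finite (C S)"
    and proj_closed: "S \<in> \<Delta> \<Longrightarrow> T \<subseteq> S \<Longrightarrow> g \<in> C S \<Longrightarrow> \<rho> T g \<in> C T"
    and proj_id: "S \<in> \<Delta> \<Longrightarrow> g \<in> C S \<Longrightarrow> \<rho> S g = g"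
    and proj_comp: "S \<in> \<Delta> \<Longrightarrow> U \<subseteq> T \<Longrightarrow> T \<subseteq> S \<Longrightarrow> g \<in> C S \<Longrightarrow> \<rho> U (\<rho> T g) = \<rho> U g"
begin

definition face_order :: "('e set \<times> 'g) rel" where
  "face_order = {((T, \<rho> T g), (S, g)) | S T g. S \<in> \<Delta> \<and> g \<in> C S \<and> T \<subseteq> S}"

lemma face_order_iff:
  "((T, h), (S, g)) \<in> face_order \<longleftrightarrow> S \<in> \<Delta> \<and> g \<in> C S \<and> T \<subseteq> S \<and> h = \<rho> T g"
  by (auto simp: face_order_def)

text \<open>A path of covers deletes labels one at a time, and its projections compose to the single
  map \<open>\<rho> T\<close>. Conversely, deleting the elements of \<open>S - T\<close> in
  succession produces such a path.\<close>

lemma ind_poset_eq_face_order: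
  assumes G: "\<And>S. S \<in> \<Delta> \<Longrightarrow> carrier (G S) = C S"
    and \<pi>: "\<And>S a g. insert a S \<in> \<Delta> \<Longrightarrow> g \<in> C (insert a S) \<Longrightarrow> \<pi> S a g = \<rho> S g"
  shows "ind_poset \<Delta> G \<pi> = face_order"
proof -
  define covers where "covers = {((S, h), (insert a S, g)) | S a g h.
             a \<notin> S \<and> insert a S \<in> \<Delta> \<and> g \<in> carrier (G (insert a S)) \<and> \<pi> S a g = h}"
  have below: "T \<subseteq> S \<and> h = \<rho> T g"
    if "((T, h), p) \<in> covers\<^sup>*" "p = (S, g)" "S \<in> \<Delta>" "g \<in> C S" for T h p S g
    using that
  proof (induction arbitrary: S g rule: rtrancl_induct)
    case base
    then show ?case using proj_id by auto
  next
    case (step y z)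
    then obtain S' a where S': "S = insert a S'" "y = (S', \<rho> S' g)" "a \<notin> S'"
      using \<pi> G by (auto simp: covers_def)
    have sub: "S' \<subseteq> S" "S' \<in> \<Delta>" using S' subset_face[OF step.prems(2)] by auto
    have "T \<subseteq> S' \<and> h = \<rho> T (\<rho> S' g)"
      using step.IH[OF S'(2) sub(2)] proj_closed[OF step.prems(2) sub(1) step.prems(3)] by blast
    then show ?case using proj_comp[OF step.prems(2) _ sub(1) step.prems(3)] sub by blast
  qed
  have above: "((T, \<rho> T g), (S, g)) \<in> covers\<^sup>*" if "S \<in> \<Delta>" "g \<in> C S" "T \<subseteq> S" for T S g
    using that
  proof (induction "card (S - T)" arbitrary: S g)
    case 0
    then have "S = T" using finite_face by auto
    then show ?case using proj_id 0 by simp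
  next
    case (Suc n)
    then obtain a where a: "a \<in> S - T" by (metis card.empty ex_in_conv nat.distinct(1))
    let ?S = "S - {a}"
    have sub: "?S \<subseteq> S" "?S \<in> \<Delta>" "insert a ?S = S" using a subset_face[OF Suc.prems(1)] by auto
    have "S - T = insert a (?S - T)" "a \<notin> ?S - T" using a by auto
    then have "n = card (?S - T)"
      using Suc.hyps(2) finite_face[OF Suc.prems(1)] by (metis Suc_inject card_insert_disjoint finite_Diff)
    then have "((T, \<rho> T (\<rho> ?S g)), (?S, \<rho> ?S g)) \<in> covers\<^sup>*"
      using Suc.prems a proj_closed sub by (intro Suc.hyps(1)) auto
    moreover have "((?S, \<rho> ?S g), (S, g)) \<in> covers"
      unfolding covers_def using sub(3) Suc.prems G \<pi>[of a ?S g]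
      by (intro CollectI exI[of _ ?S] exI[of _ a]) simp
    ultimately show ?case
      using proj_comp[OF Suc.prems(1) _ sub(1) Suc.prems(2), of T] Suc.prems(3) a
      by (metis Diff_iff rtrancl.rtrancl_into_rtrancl singletonD subsetI subset_Diff_insert Diff_empty)
  qed
  have "x \<in> ind_poset \<Delta> G \<pi> \<longleftrightarrow> x \<in> face_order" for x
  proof -
    obtain T h S g where x: "x = ((T, h), (S, g))" by (metis surj_pair)
    have "x \<in> ind_poset \<Delta> G \<pi> \<longleftrightarrow>
        ((T, h), (S, g)) \<in> covers\<^sup>* \<and> T \<in> \<Delta> \<and> h \<in> C T \<and> S \<in> \<Delta> \<and> g \<in> C S"
      using G by (auto simp: ind_poset_def Let_def covers_def x)
    also have "\<dots> \<longleftrightarrow> S \<in> \<Delta> \<and> g \<in> C S \<and> T \<subseteq> S \<and> h = \<rho> T g"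
      using below[of T h _ S g] above[of S g T] subset_face proj_closed by blast
    finally show ?thesis by (simp add: x face_order_iff)
  qed
  then show ?thesis by blast
qed

lemma Field_face_order: "Field face_order = Sigma \<Delta> C"
proof -
  have "(S, g) \<in> Field face_order \<longleftrightarrow> S \<in> \<Delta> \<and> g \<in> C S" for S g
  proof
    assume "(S, g) \<in> Field face_order"
    then show "S \<in> \<Delta> \<and> g \<in> C S"
      using subset_face proj_closed by (auto simp: Field_def Domain_iff Range_iff face_order_iff)
  next
    assume "S \<in> \<Delta> \<and> g \<in> C S"
    then have "((S, g), (S, g)) \<in> face_order" by (simp add: face_order_iff proj_id)
    then show "(S, g) \<in> Field face_order" by (rule FieldI1)
  qed
  then show ?thesis by auto
qed

text \<open>Below (S, g) there is exactly one element over each subset of \<open>S\<close>, its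
  projection, so intervals are Boolean. The one-point set \<open>C {}\<close> provides the least
  element.\<close>

lemma labelled_simplicial_poset_face_order:
  assumes "C {} = {g0}"
  shows "labelled_simplicial_poset face_order fst ({}, g0)"
proof
  show "finite (Field face_order)"
    unfolding Field_face_order by (intro finite_SigmaI finite_complex finite_C)
  show "(x, x) \<in> face_order" if "x \<in> Field face_order" for x
    using that by (cases x) (auto simp: Field_face_order face_order_iff proj_id)
  show "(x, z) \<in> face_order" if "(x, y) \<in> face_order" "(y, z) \<in> face_order" for x y z
    using that proj_comp[of "fst z" "fst x" "fst y" "snd z"]
    by (cases x; cases y; cases z) (auto simp: face_order_iff)
  show "(x, y) \<in> face_order \<longleftrightarrow> fst x \<subseteq> fst y" if "(x, z) \<in> face_order" "(y, z) \<in> face_order" for x y z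
    using that subset_face[of "fst z" "fst y"] proj_closed[of "fst z" "fst y" "snd z"]
      proj_comp[of "fst z" "fst x" "fst y" "snd z"]
    by (cases x; cases y; cases z) (auto simp: face_order_iff)
  show "x = y" if "(x, z) \<in> face_order" "(y, z) \<in> face_order" "fst x = fst y" for x y z
    using that by (cases x; cases y; cases z) (auto simp: face_order_iff)
  show "\<exists>x. (x, z) \<in> face_order \<and> fst x = T" if "z \<in> Field face_order" "T \<subseteq> fst z" for z T
    using that by (cases z) (auto simp: Field_face_order face_order_iff)
  show "({}, g0) \<in> Field face_order" by (simp add: Field_face_order empty_face assms)
  show "(({}, g0), x) \<in> face_order" if "x \<in> Field face_order" for x
    using that proj_closed[of "fst x" "{}" "snd x"] assms
    by (cases x) (auto simp: Field_face_order face_order_iff)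
  show "finite (fst z)" if "z \<in> Field face_order" for z
    using that by (cases z) (auto simp: Field_face_order finite_face)
qed

lemma Hilb_face_order:
  assumes "C {} = {g0}"
  shows "Hilb TYPE('k::field) face_order = (\<Sum>S\<in>\<Delta>. of_nat (card (C S)) * pos_fps ^ card S)"
proof -
  interpret labelled_simplicial_poset face_order fst "({}, g0)"
    by (rule labelled_simplicial_poset_face_order[OF assms])
  have "Hilb TYPE('k) face_order = (\<Sum>p\<in>Sigma \<Delta> C. pos_fps ^ card (fst p))"
    unfolding Hilb_eq Field_face_order ..
  also have "\<dots> = (\<Sum>S\<in>\<Delta>. \<Sum>g\<in>C S. pos_fps ^ card S)"
    by (subst sum.Sigma) (auto simp: finite_complex finite_C case_prod_unfold)
  finally show ?thesis by simp
qed

text \<open>Projecting first to an intermediate face does not change the image at the empty face, so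
  projections preserve fibres over it. The fibre over the identity is the torsion-free
  structure.\<close>

lemma fiber_projection_system: "projection_system \<Delta> (\<lambda>S. {g \<in> C S. \<rho> {} g = g0}) \<rho>"
  by unfold_locales
    (auto simp: finite_complex finite_face empty_face finite_C intro: subset_face proj_closed proj_id,
      (metis proj_comp empty_subsetI)+)

text \<open>Successive projections telescope by \<open>proj_comp\<close>; hence the list chosen in
  \<open>proj_to_empty\<close> does not influence the result.\<close>

lemma proj_along_eq:
  assumes "\<And>S a g. insert a S \<in> \<Delta> \<Longrightarrow> g \<in> C (insert a S) \<Longrightarrow> \<pi> S a g = \<rho> S g"
    and "set as \<in> \<Delta>" "g \<in> C (set as)"
  shows "proj_along \<pi> as g = \<rho> {} g"
  using assms(2,3)
proof (induction as arbitrary: g)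
  case Nil
  then show ?case by (simp add: proj_id)
next
  case (Cons a as)
  have "set as \<in> \<Delta>" "\<rho> (set as) g \<in> C (set as)"
    using Cons.prems subset_face proj_closed[OF Cons.prems(1)] by auto
  then show ?case using Cons assms(1)[of a "set as" g] by (simp add: proj_comp[OF Cons.prems(1)] subset_insertI)
qed

lemma carrier_torsion_free_part:
  assumes "carrier (G S) = C S" "S \<in> \<Delta>"
    and "\<And>S a g. insert a S \<in> \<Delta> \<Longrightarrow> g \<in> C (insert a S) \<Longrightarrow> \<pi> S a g = \<rho> S g"
  shows "carrier (torsion_free_part G \<pi> S) = {g \<in> C S. \<rho> {} g = \<one>\<^bsub>G {}\<^esub>}"
proof -
  have "\<exists>as. distinct as \<and> set as = S" using finite_distinct_list finite_face[OF assms(2)] by blast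
  from someI_ex[OF this] have as: "set (SOME as. distinct as \<and> set as = S) = S" by (rule conjunct2)
  have "proj_to_empty \<pi> S g = \<rho> {} g" if "g \<in> C S" for g
    unfolding proj_to_empty_def by (rule proj_along_eq) (use as assms(2,3) that in simp_all)
  then show ?thesis using assms(1) by (auto simp: torsion_free_part_def kernel_def)
qed

text \<open>The relation between \<open>m S\<close> and \<open>card (C S)\<close> fits two uses: the
  full structure if \<open>m {} = 1\<close>, and the kernels of the maps to the empty face in
  general.\<close>

lemma Hilb_ind_poset:
  fixes m :: "'e set \<Rightarrow> nat"
  assumes "matroid E \<Delta>" "matroid_rank \<Delta> E = r"
    and C: "C {} = {g0}" "\<And>S. S \<in> \<Delta> \<Longrightarrow> m S = m {} * card (C S)" "m {} > 0"
    and "\<And>S. S \<in> \<Delta> \<Longrightarrow> carrier (G S) = C S"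
    and "\<And>S a g. insert a S \<in> \<Delta> \<Longrightarrow> g \<in> C (insert a S) \<Longrightarrow> \<pi> S a g = \<rho> S g"
  shows "fps_to_fls (Hilb TYPE('k::field) (ind_poset \<Delta> G \<pi>))
    = 1 / of_nat (m {}) * (fls_X ^ r * arith_tutte E \<Delta> m (1 / fls_X) 1 / (1 - fls_X) ^ r)"
proof -
  have X: "fls_X \<noteq> (0 :: rat fls)" by simp
  have X1: "1 - fls_X \<noteq> (0 :: rat fls)"
    using fps_to_fls_eq_0_iff[of "1 - fps_X :: rat fps"] by (simp add: fps_eq_iff) (metis fps_X_nth zero_neq_one)
  have rank: "card S \<le> r" if S: "S \<in> \<Delta>" for S
    unfolding assms(2)[symmetric] matroid_rank_def
  proof (rule Max_ge)
    show "finite {card S | S. S \<in> \<Delta> \<and> S \<subseteq> E}" using finite_complex by simp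
    show "card S \<in> {card S | S. S \<in> \<Delta> \<and> S \<subseteq> E}" using S assms(1) by (auto simp: matroid_def)
  qed
  \<comment> \<open>The claim holds term by term; \<open>card S \<le> r\<close> makes the natural
    subtraction in the exponent exact.\<close>
  have term_eq: "of_nat (card (C S)) * (fls_X / (1 - fls_X)) ^ card S
     = 1 / of_nat (m {}) * (fls_X ^ r * (of_nat (m S) * (1 / fls_X - 1) ^ (r - card S)) / (1 - fls_X) ^ r :: rat fls)"
    if S: "S \<in> \<Delta>" for S
  proof -
    obtain k where k: "r = card S + k" using rank[OF S] le_Suc_ex by blast
    have "c * (x / (1 - x)) ^ a = 1 / d * (x ^ (a + k) * (d * c * (1 / x - 1) ^ k) / (1 - x) ^ (a + k))"
      if "x \<noteq> 0" "1 - x \<noteq> 0" "d \<noteq> 0" for c d x :: "rat fls" and a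
    proof -
      have "1 / x - 1 = (1 - x) / x" using that by (simp add: field_simps)
      then show ?thesis using that by (simp add: power_add power_divide)
    qed
    from this[OF X X1, of "of_nat (m {})" "of_nat (card (C S))" "card S"] show ?thesis
      using C(3) unfolding k C(2)[OF S] by simp
  qed
  have eq: "ind_poset \<Delta> G \<pi> = face_order"
    by (rule ind_poset_eq_face_order) (use assms(6,7) in auto)
  have "fps_to_fls (\<Sum>S\<in>A. f S) = (\<Sum>S\<in>A. fps_to_fls (f S))" for A :: "'e set set" and f :: "'e set \<Rightarrow> rat fps"
    by (induction A rule: infinite_finite_induct) simp_all
  then have "fps_to_fls (Hilb TYPE('k) (ind_poset \<Delta> G \<pi>))
      = (\<Sum>S\<in>\<Delta>. of_nat (card (C S)) * (fls_X / (1 - fls_X)) ^ card S)"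
    unfolding eq Hilb_face_order[OF C(1)]
    by (simp add: fls_times_fps_to_fls fps_to_fls_power fps_to_fls_pos_fps)
  also have "\<dots> = 1 / of_nat (m {}) * (fls_X ^ r * arith_tutte E \<Delta> m (1 / fls_X) 1 / (1 - fls_X) ^ r)"
    unfolding arith_tutte_y1[OF assms(1)] assms(2) sum_distrib_left sum_divide_distrib
    by (intro sum.cong refl term_eq)
  finally show ?thesis .
qed

end


subsection \<open>Weak quasi-arithmetic matroids\<close>

text \<open>For positive \<open>n\<close> this is the order of the kernel of the projection from
  Z/dn to Z/d.\<close>

lemma card_multiples_below:
  assumes "d > 0"
  shows "card {k \<in> {0..<int (d * n)}. k mod int d = 0} = n"
proof -
  have "{k \<in> {0..<int (d * n)}. k mod int d = 0} = (\<lambda>i. int d * int i) ` {..<n}"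
  proof (intro equalityI subsetI)
    fix k assume k: "k \<in> {k \<in> {0..<int (d * n)}. k mod int d = 0}"
    then have "int d dvd k" by auto
    then obtain j where j: "k = int d * j" by (elim dvdE)
    have "0 \<le> j" "j < int n" using k j assms by (auto simp: zero_le_mult_iff)
    then show "k \<in> (\<lambda>i. int d * int i) ` {..<n}" using j by (intro image_eqI[of _ _ "nat j"]) auto
  qed (use assms in auto)
  moreover have "inj_on (\<lambda>i. int d * int i) {..<n}" using assms by (auto simp: inj_on_def)
  ultimately show ?thesis by (simp add: card_image)
qed

context
  fixes E :: "'e set" and \<Delta> :: "'e set set" and m :: "'e set \<Rightarrow> nat"
  assumes wqam: "weak_quasi_arith_matroid E \<Delta> m"
begin

lemma wqam_matroid: "matroid E \<Delta>"
  using wqam by (simp add: weak_quasi_arith_matroid_def)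

text \<open>The axiom treats the addition of one element; the elements of \<open>S - T\<close> are
  added one after another.\<close>

lemma wqam_dvd:
  assumes "S \<in> \<Delta>" "T \<subseteq> S"
  shows "m T dvd m S"
proof -
  have "finite S" using assms wqam_matroid by (auto simp: matroid_def intro: finite_subset)
  then have "finite (S - T)" by simp
  moreover have "m T dvd m (T \<union> U)" if "finite U" "T \<union> U \<in> \<Delta>" for U
    using that
  proof (induction U)
    case (insert x U)
    have "T \<union> U \<in> \<Delta>"
      using insert.prems wqam_matroid unfolding matroid_def by (metis Un_insert_right subset_insertI)
    then show ?case using insert wqam unfolding weak_quasi_arith_matroid_def
      by (metis Un_insert_right dvd_trans)
  qed simp
  ultimately show ?thesis using assms by (metis Un_Diff_cancel Un_absorb1)
qed

lemma carrier_zmod_group: "S \<in> \<Delta> \<Longrightarrow> carrier (zmod_group m S) = {0..<int (m S)}"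
  using wqam unfolding weak_quasi_arith_matroid_def
  by (auto simp: zmod_group_def carrier_integer_mod_group)

lemma projection_system_zmod:
  "projection_system \<Delta> (\<lambda>S. {0..<int (m S)}) (\<lambda>S k. k mod int (m S))"
proof
  have fin: "finite E" "\<Delta> \<subseteq> Pow E" using wqam_matroid by (auto simp: matroid_def)
  then show "finite \<Delta>" by (meson finite_Pow_iff finite_subset)
  show "finite S" if "S \<in> \<Delta>" for S using that fin by (auto intro: finite_subset)
  show sub: "T \<in> \<Delta>" if "S \<in> \<Delta>" "T \<subseteq> S" for S T using that wqam_matroid by (auto simp: matroid_def)
  show "{} \<in> \<Delta>" using wqam_matroid by (auto simp: matroid_def)
  show "k mod int (m T) \<in> {0..<int (m T)}" if "S \<in> \<Delta>" "T \<subseteq> S" for S T k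
    using sub[OF that] wqam by (force simp: weak_quasi_arith_matroid_def)
  show "k mod int (m T) mod int (m U) = k mod int (m U)" if "S \<in> \<Delta>" "U \<subseteq> T" "T \<subseteq> S" for S T U k
    using wqam_dvd[OF sub[OF that(1,3)] that(2)] by (simp add: mod_mod_cancel)
qed auto

theorem Hilb_zmod:
  fixes r :: nat
  assumes "matroid_rank \<Delta> E = r"
  shows "m {} = 1 \<Longrightarrow> fps_to_fls (Hilb TYPE('k::field) (ind_poset \<Delta> (zmod_group m) (zmod_proj m)))
      = fls_X ^ r * arith_tutte E \<Delta> m (1 / fls_X) 1 / (1 - fls_X) ^ r"
    and "fps_to_fls (Hilb TYPE('k) (tf_ind_poset \<Delta> (zmod_group m) (zmod_proj m)))
      = 1 / of_nat (m {}) * (fls_X ^ r * arith_tutte E \<Delta> m (1 / fls_X) 1 / (1 - fls_X) ^ r)"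
proof -
  interpret Z: projection_system \<Delta> "\<lambda>S. {0..<int (m S)}" "\<lambda>S k. k mod int (m S)"
    by (rule projection_system_zmod)
  have m0: "m {} > 0" using wqam Z.empty_face by (force simp: weak_quasi_arith_matroid_def)
  show "fps_to_fls (Hilb TYPE('k) (ind_poset \<Delta> (zmod_group m) (zmod_proj m)))
      = fls_X ^ r * arith_tutte E \<Delta> m (1 / fls_X) 1 / (1 - fls_X) ^ r" if "m {} = 1"
    using that
    by (subst Z.Hilb_ind_poset[OF wqam_matroid assms, where m = m and ?g0.0 = 0])
      (auto simp: carrier_zmod_group zmod_proj_def)
  \<comment> \<open>The kernel of the projection to Z/m({}): the residues divisible by
    \<open>m {}\<close>.\<close>
  let ?C = "\<lambda>S. {k \<in> {0..<int (m S)}. k mod int (m {}) = 0}"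
  interpret T: projection_system \<Delta> ?C "\<lambda>S k. k mod int (m S)"
    by (rule Z.fiber_projection_system)
  have "m S = m {} * card (?C S)" if "S \<in> \<Delta>" for S
    using wqam_dvd[OF that, of "{}"] card_multiples_below[OF m0] by (auto elim!: dvdE)
  moreover have "k = 0" if "0 \<le> k" "k < int (m {})" "int (m {}) dvd k" for k
    using that zdvd_not_zless[of k "int (m {})"] by linarith
  then have "?C {} = {0}" using m0 by auto
  moreover have "carrier (torsion_free_part (zmod_group m) (zmod_proj m) S) = ?C S" if "S \<in> \<Delta>" for S
    using Z.carrier_torsion_free_part[of "zmod_group m" S "zmod_proj m"] that
    by (simp add: carrier_zmod_group zmod_proj_def) (simp add: zmod_group_def)
  ultimately show "fps_to_fls (Hilb TYPE('k) (tf_ind_poset \<Delta> (zmod_group m) (zmod_proj m)))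
      = 1 / of_nat (m {}) * (fls_X ^ r * arith_tutte E \<Delta> m (1 / fls_X) 1 / (1 - fls_X) ^ r)"
    unfolding tf_ind_poset_def
    by (intro T.Hilb_ind_poset[OF wqam_matroid assms]) (auto simp: m0 zmod_proj_def)
qed

end


subsection \<open>The index of a lattice and of its dual\<close>

text \<open>The half-open cube contains one representative of each class of dual vectors modulo
  integer vectors. \<open>\<rightarrow>\<^sub>E\<close> fixes the values off \<open>S\<close>, so
  that points can be counted.\<close>

definition dual_points :: "'a set \<Rightarrow> ('a \<Rightarrow> int) set \<Rightarrow> ('a \<Rightarrow> real) set" where
  "dual_points S L = {q \<in> S \<rightarrow>\<^sub>E {0..<1}. \<forall>l\<in>L. (\<Sum>s\<in>S. q s * real_of_int (l s)) \<in> \<int>}"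

text \<open>Lattice vectors are functions on the whole type, apart from the coordinate set
  \<open>S\<close>. An induction can thus drop a coordinate without restricting the
  functions.\<close>

locale int_lattice =
  fixes L :: "('a \<Rightarrow> int) set"
  assumes lattice_zero: "(\<lambda>_. 0) \<in> L"
    and lattice_add: "x \<in> L \<Longrightarrow> y \<in> L \<Longrightarrow> (\<lambda>s. x s + y s) \<in> L"
    and lattice_uminus: "x \<in> L \<Longrightarrow> (\<lambda>s. - x s) \<in> L"
begin

lemma lattice_mult:
  assumes "x \<in> L"
  shows "(\<lambda>s. c * x s) \<in> L"
proof (induction c rule: int_induct[of _ 0])
  case base
  then show ?case using lattice_zero by simp
next
  case (step1 i)
  then show ?case using lattice_add[OF _ assms, of "\<lambda>s. i * x s"] by (simp add: distrib_right)
next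
  case (step2 i)
  then show ?case
    using lattice_add[OF _ lattice_uminus[OF assms], of "\<lambda>s. i * x s"] by (simp add: left_diff_distrib)
qed

lemma lattice_diff_mult: "x \<in> L \<Longrightarrow> y \<in> L \<Longrightarrow> (\<lambda>s. x s - c * y s) \<in> L"
  using lattice_add[OF _ lattice_mult[of y "- c"], of x] by simp

text \<open>The coordinates at \<open>a\<close> form a non-zero subgroup of the integers.
  \<open>d\<close> is its least positive member; a non-zero remainder modulo \<open>d\<close> would
  be a smaller one.\<close>

lemma lattice_coordinate_generator:
  assumes "x \<in> L" "x a \<noteq> 0"
  obtains l0 d where "l0 \<in> L" "l0 a = int d" "d > 0" "\<And>l. l \<in> L \<Longrightarrow> int d dvd l a"
proof -
  let ?P = "\<lambda>d. d > 0 \<and> (\<exists>l\<in>L. l a = int d)"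
  have "\<exists>d. ?P d"
  proof (cases "x a > 0")
    case True
    then show ?thesis using assms(1) by (intro exI[of _ "nat (x a)"]) auto
  next
    case False
    then show ?thesis using assms lattice_uminus
      by (intro exI[of _ "nat (- x a)"] conjI bexI[of _ "\<lambda>s. - x s"]) auto
  qed
  then have P: "?P (LEAST d. ?P d)" by (rule LeastI_ex)
  define d where "d = (LEAST d. ?P d)"
  obtain l0 where l0: "l0 \<in> L" "l0 a = int d" "d > 0" using P unfolding d_def by blast
  have "int d dvd l a" if l: "l \<in> L" for l
  proof (rule ccontr)
    assume "\<not> int d dvd l a"
    then have pos: "l a mod int d > 0" using l0(3)
      by (metis dvd_eq_mod_eq_0 of_nat_0_less_iff order_less_le pos_mod_sign)
    have "l a mod int d = l a - (l a div int d) * l0 a"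
      unfolding l0(2) by (simp add: minus_div_mult_eq_mod)
    then have "?P (nat (l a mod int d))"
      using pos lattice_diff_mult[OF l l0(1), of "l a div int d"] by auto
    then have "d \<le> nat (l a mod int d)" unfolding d_def by (rule Least_le)
    then show False using pos_mod_bound[of "int d" "l a"] l0(3) pos by linarith
  qed
  then show thesis using that l0 by blast
qed

end

text \<open>Induction on the rank: projecting \<open>L\<close> to the coordinate \<open>a\<close> has image \<open>d\<int>\<close> and
  kernel \<open>L'\<close>.  Both the index of \<open>L\<close> and the number of dual points modulo \<open>\<int>\<^sup>S\<close>
  are \<open>d\<close> times the ones of \<open>L'\<close>.\<close>

lemma dual_points_insert:
  fixes L :: "('a \<Rightarrow> int) set"
  assumes "int_lattice L" and a: "finite S" "a \<notin> S"
    and l0: "l0 \<in> L" "l0 a = int d" "d > 0" "\<And>l. l \<in> L \<Longrightarrow> int d dvd l a"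
  shows "bij_betw (\<lambda>(q, j). q(a := (real j + frac (- (\<Sum>s\<in>S. q s * real_of_int (l0 s)))) / real d))
    (dual_points S {l \<in> L. l a = 0} \<times> {..<d}) (dual_points (insert a S) L)"
proof -
  interpret int_lattice L by fact
  let ?L' = "{l \<in> L. l a = 0}"
  let ?u = "\<lambda>q. \<Sum>s\<in>S. q s * real_of_int (l0 s)"
  \<comment> \<open>Pairing with \<open>l0\<close> requires \<open>q a * real d + ?u q\<close> to be
    an integer. Its solutions \<open>q a\<close> in [0,1) are the d values indexed by
    \<open>j < d\<close>.\<close>
  let ?f = "\<lambda>(q, j). q(a := (real j + frac (- ?u q)) / real d)"
  have pair: "(\<Sum>s\<in>insert a S. (q(a := c)) s * real_of_int (l s)) = c * l a + (\<Sum>s\<in>S. q s * real_of_int (l s))"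
    for q c and l :: "'a \<Rightarrow> int"
    using a by (simp add: sum.insert) (intro sum.cong; auto)
  \<comment> \<open>\<open>l0\<close> and the vectors vanishing at \<open>a\<close> generate
    \<open>L\<close>, so integrality has to be checked on these only.\<close>
  have split: "\<exists>c l'. l' \<in> ?L' \<and> l a = c * int d \<and> (\<forall>s. l s = c * l0 s + l' s)" if l: "l \<in> L" for l
  proof -
    obtain c where "l a = c * int d" using l0(4)[OF l] by (metis dvd_def mult.commute)
    then show ?thesis using lattice_diff_mult[OF l l0(1), of c] l0(2)
      by (intro exI[of _ c] exI[of _ "\<lambda>s. l s - c * l0 s"]) auto
  qed
  show ?thesis
  proof (rule bij_betw_byWitness[of _ "\<lambda>q. (restrict q S, nat \<lfloor>q a * real d\<rfloor>)"])
    show "?f ` (dual_points S ?L' \<times> {..<d}) \<subseteq> dual_points (insert a S) L"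
    proof (clarsimp)
      fix q j assume q: "q \<in> dual_points S ?L'" and j: "j < d"
      let ?c = "(real j + frac (- ?u q)) / real d"
      have "real j + frac (- ?u q) < real d" using j frac_lt_1[of "- ?u q"] by linarith
      then have "0 \<le> ?c" "?c < 1" using l0(3) by (simp_all add: frac_ge_0)
      then have "q(a := ?c) \<in> insert a S \<rightarrow>\<^sub>E {0..<1}"
        using q by (auto simp: dual_points_def PiE_iff extensional_def)
      moreover have "(\<Sum>s\<in>insert a S. (q(a := ?c)) s * real_of_int (l s)) \<in> \<int>" if l: "l \<in> L" for l
      proof -
        obtain c l' where l': "l' \<in> ?L'" "l a = c * int d" "\<forall>s. l s = c * l0 s + l' s" using split[OF l] by blast
        have "(\<Sum>s\<in>S. q s * real_of_int (l s)) = c * ?u q + (\<Sum>s\<in>S. q s * real_of_int (l' s))"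
          using l'(3) by (simp add: sum_distrib_left sum.distrib algebra_simps)
        moreover have "?c * l a = c * (real j + frac (- ?u q))" using l'(2) l0(3) by simp
        moreover have "c * (real j + frac (- ?u q)) + c * ?u q = of_int (c * (int j - \<lfloor>- ?u q\<rfloor>))"
          by (simp add: frac_def algebra_simps)
        ultimately have "(\<Sum>s\<in>insert a S. (q(a := ?c)) s * real_of_int (l s))
            = of_int (c * (int j - \<lfloor>- ?u q\<rfloor>)) + (\<Sum>s\<in>S. q s * real_of_int (l' s))"
          unfolding pair by linarith
        then show ?thesis using q l'(1) by (auto simp: dual_points_def)
      qed
      ultimately show "q(a := ?c) \<in> dual_points (insert a S) L" by (simp add: dual_points_def)
    qed
    show "(\<lambda>q. (restrict q S, nat \<lfloor>q a * real d\<rfloor>)) ` dual_points (insert a S) L \<subseteq> dual_points S ?L' \<times> {..<d}"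
    proof (clarsimp, intro conjI)
      fix q assume q: "q \<in> dual_points (insert a S) L"
      have qa: "0 \<le> q a" "q a < 1" using q by (auto simp: dual_points_def PiE_iff)
      have "(\<Sum>s\<in>S. restrict q S s * real_of_int (l s)) \<in> \<int>" if "l \<in> ?L'" for l
      proof -
        have "(\<Sum>s\<in>insert a S. q s * real_of_int (l s)) \<in> \<int>" using q that by (auto simp: dual_points_def)
        then show ?thesis using a that by (simp add: sum.insert)
      qed
      then show "restrict q S \<in> dual_points S ?L'" using q by (auto simp: dual_points_def PiE_iff)
      have "q a * real d < real d" using qa l0(3) by simp
      then have "\<lfloor>q a * real d\<rfloor> < int d" by (simp add: floor_less_iff)
      then show "nat \<lfloor>q a * real d\<rfloor> < d" using l0(3) by linarith
    qed
    show "\<forall>p\<in>dual_points S ?L' \<times> {..<d}. (restrict (?f p) S, nat \<lfloor>?f p a * real d\<rfloor>) = p"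
    proof
      fix p assume "p \<in> dual_points S ?L' \<times> {..<d}"
      then obtain q j where p: "p = (q, j)" and q: "q \<in> dual_points S ?L'" by blast
      have "restrict (q(a := (real j + frac (- ?u q)) / real d)) S = q"
        using q a(2) by (auto simp: dual_points_def PiE_iff extensional_def fun_eq_iff)
      moreover have "\<lfloor>real j + frac (- ?u q)\<rfloor> = int j"
        by (rule floor_unique) (use frac_lt_1[of "- ?u q"] frac_ge_0[of "- ?u q"] in auto)
      ultimately show "(restrict (?f p) S, nat \<lfloor>?f p a * real d\<rfloor>) = p"
        using l0(3) by (simp add: p)
    qed
    show "\<forall>q\<in>dual_points (insert a S) L. ?f (restrict q S, nat \<lfloor>q a * real d\<rfloor>) = q"
    proof
      fix q assume q: "q \<in> dual_points (insert a S) L"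
      have u: "?u (restrict q S) = ?u q" by (intro sum.cong) auto
      have qa: "0 \<le> q a" using q by (auto simp: dual_points_def PiE_iff)
      have "(\<Sum>s\<in>insert a S. q s * real_of_int (l0 s)) \<in> \<int>" using q l0(1) by (auto simp: dual_points_def)
      then have "q a * real d + ?u q \<in> \<int>" using a l0(2) by (simp add: sum.insert)
      then obtain k where k: "q a * real d + ?u q = of_int k" by (elim Ints_cases)
      then have "- ?u q = q a * real d - of_int k" by simp
      then have "frac (- ?u q) = frac (q a * real d)" by (simp add: frac_def)
      then have "real (nat \<lfloor>q a * real d\<rfloor>) + frac (- ?u q) = q a * real d"
        using qa by (simp add: frac_def)
      then have "(real (nat \<lfloor>q a * real d\<rfloor>) + frac (- ?u (restrict q S))) / real d = q a"
        using l0(3) unfolding u by simp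
      moreover have "(restrict q S)(a := q a) = q"
        using q by (auto simp: dual_points_def PiE_iff extensional_def fun_eq_iff)
      ultimately show "?f (restrict q S, nat \<lfloor>q a * real d\<rfloor>) = q" by simp
    qed
  qed
qed

text \<open>The last assumption says that \<open>L\<close> spans the real space over
  \<open>S\<close>, which forces finite index. \<open>T\<close> represents the integer vectors on
  \<open>S\<close> modulo \<open>L\<close>, so its size is that index.\<close>

lemma lattice_transversal:
  fixes L :: "('a \<Rightarrow> int) set"
  assumes "finite S" "int_lattice L"
    and "\<And>q :: 'a \<Rightarrow> real. (\<forall>l\<in>L. (\<Sum>s\<in>S. q s * real_of_int (l s)) = 0) \<Longrightarrow> \<forall>s\<in>S. q s = 0"
  shows "\<exists>T. finite T \<and> T \<subseteq> extensional S \<and> card T = card (dual_points S L) \<and>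
      (\<forall>w. \<exists>!t. t \<in> T \<and> (\<exists>l\<in>L. \<forall>s\<in>S. w s = l s + t s))"
  using assms
proof (induction S arbitrary: L)
  case empty
  then have "(\<lambda>_. 0) \<in> L" by (simp add: int_lattice.lattice_zero)
  then have "\<exists>!t. t \<in> {\<lambda>_::'a. undefined::int} \<and> (\<exists>l\<in>L. \<forall>s\<in>{}. w s = l s + t s)" for w by auto
  moreover have "dual_points {} L = {\<lambda>_. undefined}" by (auto simp: dual_points_def)
  ultimately show ?case by (intro exI[of _ "{\<lambda>_. undefined}"]) (simp add: extensional_def)
next
  case (insert a S)
  interpret int_lattice L by (rule insert.prems(1))
  let ?L' = "{l \<in> L. l a = 0}"
  have "\<exists>x\<in>L. x a \<noteq> 0"
  proof (rule ccontr)
    assume no: "\<not> (\<exists>x\<in>L. x a \<noteq> 0)"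
    \<comment> \<open>The unit vector at \<open>a\<close> would be orthogonal to
      \<open>L\<close>.\<close>
    have "\<forall>s\<in>insert a S. (if s = a then 1 else 0) = (0::real)"
    proof (rule insert.prems(2), intro ballI sum.neutral)
      fix l s assume "l \<in> L" "s \<in> insert a S"
      then show "(if s = a then 1 else 0) * real_of_int (l s) = 0" using no by auto
    qed
    then show False by simp
  qed
  then obtain l0 d where l0: "l0 \<in> L" "l0 a = int d" "d > 0" "\<And>l. l \<in> L \<Longrightarrow> int d dvd l a"
    using lattice_coordinate_generator by metis
  have L': "int_lattice ?L'"
    by unfold_locales (auto simp: lattice_zero lattice_add lattice_uminus)
  have nondeg: "\<forall>s\<in>S. q s = 0" if q: "\<forall>l\<in>?L'. (\<Sum>s\<in>S. q s * real_of_int (l s)) = 0" for q :: "'a \<Rightarrow> real"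
  proof -
    \<comment> \<open>This value at \<open>a\<close> makes the extension of \<open>q\<close>
      orthogonal to \<open>l0\<close>, and therefore to all of \<open>L\<close>.\<close>
    let ?c = "- (\<Sum>s\<in>S. q s * real_of_int (l0 s)) / real d"
    have "\<forall>s\<in>insert a S. (q(a := ?c)) s = 0"
    proof (rule insert.prems(2), rule ballI)
      fix l assume l: "l \<in> L"
      obtain c where c: "l a = c * int d" using l0(4)[OF l] by (metis dvd_def mult.commute)
      have "(\<lambda>s. l s - c * l0 s) \<in> ?L'" using lattice_diff_mult[OF l l0(1)] c l0(2) by simp
      from bspec[OF q this] have "(\<Sum>s\<in>S. q s * real_of_int (l s - c * l0 s)) = 0" by simp
      then have "(\<Sum>s\<in>S. q s * real_of_int (l s)) = c * (\<Sum>s\<in>S. q s * real_of_int (l0 s))"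
        by (simp add: sum_distrib_left sum_subtractf algebra_simps)
      moreover have "(\<Sum>s\<in>S. (q(a := ?c)) s * real_of_int (l s)) = (\<Sum>s\<in>S. q s * real_of_int (l s))"
        using insert.hyps by (intro sum.cong) auto
      moreover have "?c * real_of_int (l a) = - c * (\<Sum>s\<in>S. q s * real_of_int (l0 s))"
        using c l0(3) by simp
      ultimately show "(\<Sum>s\<in>insert a S. (q(a := ?c)) s * real_of_int (l s)) = 0"
        using insert.hyps by (simp add: sum.insert)
    qed
    then show ?thesis using insert.hyps by (metis fun_upd_other insertCI)
  qed
  obtain T where T: "finite T" "T \<subseteq> extensional S" "card T = card (dual_points S ?L')"
    "\<And>w. \<exists>!t. t \<in> T \<and> (\<exists>l\<in>?L'. \<forall>s\<in>S. w s = l s + t s)"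
    using insert.IH[OF L' nondeg] by blast
  \<comment> \<open>A representative modulo the sublattice is extended at \<open>a\<close> by a
    residue modulo \<open>d\<close>.\<close>
  let ?g = "\<lambda>(t :: 'a \<Rightarrow> int, j :: nat). t(a := int j)"
  have inj: "inj_on ?g (T \<times> {..<d})"
  proof (rule inj_onI, clarsimp)
    fix t j t' j' assume t: "t \<in> T" "t' \<in> T" and eq: "t(a := int j) = t'(a := int j')"
    have "t a = undefined" "t' a = undefined"
      using t T(2) insert.hyps(2) by (auto intro: extensional_arb)
    then have "t a = t' a" by simp
    then have "t = t'" using eq by (metis fun_upd_triv fun_upd_upd)
    moreover have "int j = int j'" using eq by (metis fun_upd_same)
    ultimately show "t = t' \<and> j = j'" by simp
  qed
  let ?T = "?g ` (T \<times> {..<d})"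
  have "card ?T = card T * d" using inj by (simp add: card_image card_cartesian_product)
  also have "\<dots> = card (dual_points (insert a S) L)"
  proof -
    have "card (dual_points S ?L' \<times> {..<d}) = card (dual_points (insert a S) L)"
      by (rule bij_betw_same_card, rule dual_points_insert[of L S a l0 d])
        (simp_all add: insert.prems(1) insert.hyps l0)
    then show ?thesis using T(3) by (simp add: card_cartesian_product)
  qed
  finally have "card ?T = card (dual_points (insert a S) L)" .
  moreover have "?T \<subseteq> extensional (insert a S)" using T(2) by (fastforce simp: extensional_def)
  moreover have "\<exists>!t. t \<in> ?T \<and> (\<exists>l\<in>L. \<forall>s\<in>insert a S. w s = l s + t s)" for w
  proof (rule ex_ex1I)
    \<comment> \<open>Division with remainder at \<open>a\<close>: a multiple of \<open>l0\<close>
      is subtracted, and the other coordinates are then reduced by the sublattice, which does not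
      touch \<open>a\<close>.\<close>
    let ?c = "w a div int d" and ?j = "nat (w a mod int d)"
    obtain t l where t: "t \<in> T" "l \<in> ?L'" "\<forall>s\<in>S. w s - ?c * l0 s = l s + t s"
      using T(4)[of "\<lambda>s. w s - ?c * l0 s"] by blast
    have mem: "(\<lambda>s. l s + ?c * l0 s) \<in> L"
      using lattice_add[OF _ lattice_mult[OF l0(1)], of l] t(2) by simp
    have wa: "w a = l a + ?c * l0 a + int ?j" using t(2) l0(2,3) by simp
    have ws: "w s = l s + ?c * l0 s + t s" if "s \<in> S" for s using bspec[OF t(3) that] by linarith
    have "\<forall>s\<in>insert a S. w s = (l s + ?c * l0 s) + (t(a := int ?j)) s"
    proof
      fix s assume "s \<in> insert a S"
      then show "w s = (l s + ?c * l0 s) + (t(a := int ?j)) s"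
        using wa ws[of s] by (cases "s = a") (simp, metis fun_upd_other insertE)
    qed
    then have "\<exists>l\<in>L. \<forall>s\<in>insert a S. w s = l s + (t(a := int ?j)) s"
      by (rule bexI[OF _ mem])
    moreover have "?j < d" using l0(3) by (simp add: nat_less_iff)
    ultimately show "\<exists>t. t \<in> ?T \<and> (\<exists>l\<in>L. \<forall>s\<in>insert a S. w s = l s + t s)"
      using t(1) by (intro exI[of _ "t(a := int ?j)"] conjI image_eqI[of _ _ "(t, ?j)"]) auto
  next
    fix x y
    assume "x \<in> ?T \<and> (\<exists>l\<in>L. \<forall>s\<in>insert a S. w s = l s + x s)"
      and "y \<in> ?T \<and> (\<exists>l\<in>L. \<forall>s\<in>insert a S. w s = l s + y s)"
    then obtain t j l t' j' l' where x: "x = t(a := int j)" "t \<in> T" "j < d" "l \<in> L" "\<forall>s\<in>insert a S. w s = l s + x s"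
      and y: "y = t'(a := int j')" "t' \<in> T" "j' < d" "l' \<in> L" "\<forall>s\<in>insert a S. w s = l' s + y s"
      by auto
    have dl: "(\<lambda>s. l s - l' s) \<in> L" using lattice_diff_mult[OF x(4) y(4), of 1] by simp
    have "l a + int j = l' a + int j'"
      using bspec[OF x(5) insertI1] bspec[OF y(5) insertI1] by (simp add: x(1) y(1))
    then have "l a - l' a = int j' - int j" by simp
    \<comment> \<open>Two residues below \<open>d\<close> whose difference is divisible by
      \<open>d\<close> are equal.\<close>
    then have "int d dvd int j' - int j" using l0(4)[OF dl] by simp
    then have "j = j'"
      using dvd_imp_le_int[of "int j' - int j" "int d"] x(3) y(3) by fastforce
    then have "l a = l' a" using \<open>l a + int j = l' a + int j'\<close> by simp
    then have mem: "(\<lambda>s. l s - l' s) \<in> ?L'" using dl by simp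
    have "t s = l' s - l s + t' s" if "s \<in> S" for s
    proof -
      have "s \<noteq> a" using that insert.hyps(2) by blast
      then show ?thesis
        using bspec[OF x(5) insertI2[OF that]] bspec[OF y(5) insertI2[OF that]] by (simp add: x(1) y(1))
    qed
    then have "\<forall>s\<in>S. t' s = (l s - l' s) + t s" by simp
    then have "\<exists>l\<in>?L'. \<forall>s\<in>S. t' s = l s + t s" by (rule bexI[OF _ mem])
    moreover have "\<exists>l\<in>?L'. \<forall>s\<in>S. t' s = l s + t' s"
      using lattice_zero by (intro bexI[of _ "\<lambda>_. 0"]) auto
    ultimately have "t = t'" using T(4)[of t'] x(2) y(2) by blast
    then show "x = y" using x(1) y(1) \<open>j = j'\<close> by simp
  qed
  ultimately show ?case using T(1) by (intro exI[of _ ?T]) simp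
qed


subsection \<open>The arithmetic matroid of an integer matrix\<close>

lemma (in group) r_coset_eq_iff:
  assumes "subgroup H G" "x \<in> carrier G" "y \<in> carrier G"
  shows "H #> x = H #> y \<longleftrightarrow> (\<exists>h\<in>H. x = h \<otimes> y)"
proof
  assume "H #> x = H #> y"
  then have "x \<in> H #> y" using rcos_self[OF assms(2,1)] by simp
  then show "\<exists>h\<in>H. x = h \<otimes> y" by (auto simp: r_coset_def)
next
  assume "\<exists>h\<in>H. x = h \<otimes> y"
  then have "x \<in> H #> y" by (auto simp: r_coset_def)
  then show "H #> x = H #> y" using repr_independence[OF _ assms(3,1)] by simp
qed

text \<open>\<open>#>\<close> uses only the multiplication of \<open>G\<close>, so shrinking the
  carrier does not change a coset.\<close>

lemma carrier_Mod_restricted: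
  "carrier (G\<lparr>carrier := W\<rparr> Mod H) = (\<lambda>w. H #>\<^bsub>G\<^esub> w) ` W"
  by (auto simp: FactGroup_def RCOSETS_def r_coset_def)

context
  fixes X :: "int mat"
begin

interpretation V: vec_space "TYPE(real)" "dim_row X" .

abbreviation (input) entry :: "nat \<Rightarrow> nat \<Rightarrow> int" where "entry i s \<equiv> X $$ (i, s)"

section \<open>The matroid of linearly independent columns\<close>

lemma finite_ground: "finite (mat_ground X)" "S \<subseteq> mat_ground X \<Longrightarrow> finite S"
  by (auto simp: mat_ground_def intro: finite_subset)

lemma real_col_carrier: "s \<in> mat_ground X \<Longrightarrow> real_col X s \<in> carrier_vec (dim_row X)"
  by (rule carrier_vecI) (simp add: real_col_def)

lemma real_col_image_carrier: "S \<subseteq> mat_ground X \<Longrightarrow> real_col X ` S \<subseteq> carrier_vec (dim_row X)"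
  using real_col_carrier by blast

lemma real_col_index:
  "s \<in> mat_ground X \<Longrightarrow> i < dim_row X \<Longrightarrow> real_col X s $ i = real_of_int (entry i s)"
  by (simp add: real_col_def mat_ground_def)

lemma lincomb_real_col_index:
  assumes "S \<subseteq> mat_ground X" "inj_on (real_col X) S" "i < dim_row X"
  shows "V.lincomb b (real_col X ` S) $ i = (\<Sum>s\<in>S. b (real_col X s) * real_of_int (entry i s))"
proof -
  have "V.lincomb b (real_col X ` S) $ i = (\<Sum>v\<in>real_col X ` S. b v * v $ i)"
    by (rule V.lincomb_index[OF assms(3) real_col_image_carrier[OF assms(1)]])
  also have "\<dots> = (\<Sum>s\<in>S. b (real_col X s) * real_col X s $ i)"
    using sum.reindex[OF assms(2), of "\<lambda>v. b v * v $ i"] by (simp add: comp_def)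
  also have "\<dots> = (\<Sum>s\<in>S. b (real_col X s) * real_of_int (entry i s))"
    by (intro sum.cong refl) (use assms real_col_index in auto)
  finally show ?thesis .
qed

lemma lincomb_real_col_carrier:
  "S \<subseteq> mat_ground X \<Longrightarrow> V.lincomb b (real_col X ` S) \<in> carrier_vec (dim_row X)"
  using V.lincomb_closed[OF real_col_image_carrier, of S b] by simp

text \<open>Passes from sets of vectors to coefficient functions on indices. The injectivity clause
  is absorbed, since two equal columns already give a non-trivial relation between indices.\<close>

lemma mat_indep_iff:
  "S \<in> mat_indep X \<longleftrightarrow> S \<subseteq> mat_ground X \<and>
    (\<forall>a. (\<forall>i<dim_row X. (\<Sum>s\<in>S. a s * real_of_int (entry i s)) = 0) \<longrightarrow> (\<forall>s\<in>S. a s = 0))"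
proof (cases "S \<subseteq> mat_ground X")
  case True
  note fin = finite_ground(2)[OF True]
  show ?thesis
  proof
    assume "S \<in> mat_indep X"
    then have inj: "inj_on (real_col X) S" and li: "\<not> V.lin_dep (real_col X ` S)"
      by (auto simp: mat_indep_def)
    have "a s = 0" if a: "\<forall>i<dim_row X. (\<Sum>s\<in>S. a s * real_of_int (entry i s)) = 0" and s: "s \<in> S" for a s
    proof (rule ccontr)
      assume "a s \<noteq> 0"
      \<comment> \<open>Coefficients are carried from indices to vectors along the inverse of the
        injective column map.\<close>
      let ?b = "\<lambda>v. a (inv_into S (real_col X) v)"
      have b: "?b (real_col X s) = a s" if "s \<in> S" for s using inj that by simp
      have "V.lincomb ?b (real_col X ` S) = 0\<^sub>v (dim_row X)"
      proof (rule eq_vecI)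
        fix i assume "i < dim_vec (0\<^sub>v (dim_row X) :: real vec)"
        then have i: "i < dim_row X" by simp
        show "V.lincomb ?b (real_col X ` S) $ i = 0\<^sub>v (dim_row X) $ i"
          unfolding lincomb_real_col_index[OF True inj i] using a i b by simp
      qed (use lincomb_real_col_carrier[OF True, of ?b] in simp)
      then have "V.lin_dep (real_col X ` S)"
        using fin s b[OF s] \<open>a s \<noteq> 0\<close>
        by (intro V.lin_dep_crit[where A = "real_col X ` S" and a = ?b and v = "real_col X s"]) auto
      then show False using li by simp
    qed
    then show "S \<subseteq> mat_ground X \<and>
      (\<forall>a. (\<forall>i<dim_row X. (\<Sum>s\<in>S. a s * real_of_int (entry i s)) = 0) \<longrightarrow> (\<forall>s\<in>S. a s = 0))"
      using True by blast
  next
    assume R: "S \<subseteq> mat_ground X \<and>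
      (\<forall>a. (\<forall>i<dim_row X. (\<Sum>s\<in>S. a s * real_of_int (entry i s)) = 0) \<longrightarrow> (\<forall>s\<in>S. a s = 0))"
    have inj: "inj_on (real_col X) S"
    proof (rule inj_onI, rule ccontr)
      fix s t assume st: "s \<in> S" "t \<in> S" "real_col X s = real_col X t" "s \<noteq> t"
      \<comment> \<open>The relation stating that the columns \<open>s\<close> and \<open>t\<close>
        coincide.\<close>
      let ?a = "\<lambda>x. of_bool (x = s) - of_bool (x = t) :: real"
      have "(\<Sum>x\<in>S. ?a x * real_of_int (entry i x)) = 0" if i: "i < dim_row X" for i
      proof -
        have "(\<Sum>x\<in>S. ?a x * real_of_int (entry i x)) = real_of_int (entry i s) - real_of_int (entry i t)"
          using fin st by (simp add: left_diff_distrib sum_subtractf of_bool_def if_distrib[of "\<lambda>x. x * _"] cong: if_cong)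
        also have "\<dots> = 0" using real_col_index[OF subsetD[OF True st(1)] i] real_col_index[OF subsetD[OF True st(2)] i] st(3)
          by simp
        finally show ?thesis .
      qed
      then have "?a s = 0" using R[THEN conjunct2, THEN spec[of _ ?a]] st(1) by blast
      then show False using st(4) by simp
    qed
    have "\<not> V.lin_dep (real_col X ` S)"
    proof
      assume "V.lin_dep (real_col X ` S)"
      then obtain b v where b: "V.lincomb b (real_col X ` S) = 0\<^sub>v (dim_row X)" "v \<in> real_col X ` S" "b v \<noteq> 0"
        using V.finite_lin_dep[of "real_col X ` S"] fin real_col_image_carrier[OF True] by auto
      have "\<forall>s\<in>S. b (real_col X s) = 0"
        using R[THEN conjunct2, THEN spec[of _ "\<lambda>s. b (real_col X s)"]]
          lincomb_real_col_index[OF True inj, of _ b] b(1) by simp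
      then show False using b by auto
    qed
    then show "S \<in> mat_indep X" using True inj by (simp add: mat_indep_def)
  qed
qed (auto simp: mat_indep_def)

lemma mat_indepD:
  assumes "S \<in> mat_indep X"
  shows "S \<subseteq> mat_ground X" "finite S" "inj_on (real_col X) S" "V.lin_indpt (real_col X ` S)"
    and "(\<And>i. i < dim_row X \<Longrightarrow> (\<Sum>s\<in>S. a s * real_of_int (entry i s)) = 0) \<Longrightarrow> s \<in> S \<Longrightarrow> a s = 0"
  using assms finite_ground(2) mat_indep_iff[of S] by (auto simp: mat_indep_def)

lemma mat_indep_mono:
  assumes "S \<in> mat_indep X" "T \<subseteq> S"
  shows "T \<in> mat_indep X"
  unfolding mat_indep_iff
proof (intro conjI allI impI ballI)
  fix a s
  assume a: "\<forall>i<dim_row X. (\<Sum>s\<in>T. a s * real_of_int (entry i s)) = 0" and s: "s \<in> T"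
  have "(\<Sum>s\<in>S. (if s \<in> T then a s else 0) * real_of_int (entry i s)) = (\<Sum>s\<in>T. a s * real_of_int (entry i s))" for i
    using mat_indepD(2)[OF assms(1)] assms(2) by (intro sum.mono_neutral_cong_right) auto
  then have "(if s \<in> T then a s else 0) = 0"
    using mat_indepD(5)[OF assms(1), of "\<lambda>s. if s \<in> T then a s else 0" s] a s assms(2) by auto
  then show "a s = 0" using s by simp
qed (use mat_indepD(1)[OF assms(1)] assms(2) in blast)

lemma empty_mat_indep: "{} \<in> mat_indep X"
  by (simp add: mat_indep_iff)

text \<open>If no column of \<open>T\<close> extends \<open>S\<close>, all of them lie in the span
  of \<open>S\<close>, contradicting the Steinitz replacement theorem.\<close>

lemma mat_indep_exchange:
  assumes S: "S \<in> mat_indep X" and T: "T \<in> mat_indep X" and "card S < card T"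
  shows "\<exists>x\<in>T - S. insert x S \<in> mat_indep X"
proof (rule ccontr)
  assume no: "\<not> ?thesis"
  note S' = mat_indepD[OF S] and T' = mat_indepD[OF T]
  have "real_col X ` T \<subseteq> V.span (real_col X ` S)"
  proof
    fix v assume "v \<in> real_col X ` T"
    then obtain x where x: "v = real_col X x" "x \<in> T" by blast
    show "v \<in> V.span (real_col X ` S)"
    proof (cases "v \<in> real_col X ` S")
      case True
      then show ?thesis using V.in_own_span[OF real_col_image_carrier[OF S'(1)]] by blast
    next
      case False
      then have "x \<notin> S" using x by blast
      then have "insert x S \<notin> mat_indep X" using no x by blast
      moreover have "inj_on (real_col X) (insert x S)" using S'(3) False x \<open>x \<notin> S\<close> by (simp add: inj_on_insert)
      moreover have "insert x S \<subseteq> mat_ground X" using S'(1) T'(1) x by blast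
      ultimately have "V.lin_dep (real_col X ` S \<union> {v})" using x by (simp add: mat_indep_def)
      then show ?thesis
        using V.lin_dep_iff_in_span[OF _ S'(4) _ False] real_col_image_carrier[OF S'(1)]
          real_col_carrier[of x] T'(1) x by auto
    qed
  qed
  \<comment> \<open>The upper bound on \<open>card C\<close> is negative.\<close>
  then obtain C :: "real vec set" where "int (card C) \<le> int (card (real_col X ` S)) - int (card (real_col X ` T))"
    using V.replacement[of "real_col X ` T" "real_col X ` S"] S'(2) T'(2,4) real_col_image_carrier[OF S'(1)]
    by auto
  then show False using assms(3) card_image[OF S'(3)] card_image[OF T'(3)] by simp
qed

lemma matroid_mat: "matroid (mat_ground X) (mat_indep X)"
  unfolding matroid_def
  using finite_ground mat_indepD(1) empty_mat_indep mat_indep_mono mat_indep_exchange by auto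

text \<open>A maximal independent set of columns has as many elements as the rank; choosing one
  index per vector gives an independent index set of that size.\<close>

lemma matroid_rank_mat:
  "matroid_rank (mat_indep X) (mat_ground X) = vec_space.rank (dim_row X) (map_mat real_of_int X)"
proof -
  let ?A = "map_mat real_of_int X"
  have A: "?A \<in> carrier_mat (dim_row X) (dim_col X)" by simp
  have cols: "set (cols ?A) = real_col X ` mat_ground X"
    by (auto simp: cols_def mat_ground_def real_col_def)
  have "\<not> V.lin_dep {}" using mat_indepD(4)[OF empty_mat_indep] by simp
  then obtain B where B: "maximal B (\<lambda>T. T \<subseteq> set (cols ?A) \<and> V.lin_indpt T)"
    using maximal_exists_superset[of "set (cols ?A)" "\<lambda>T. T \<subseteq> set (cols ?A) \<and> V.lin_indpt T" "{}"] by auto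
  then have B': "B \<subseteq> real_col X ` mat_ground X" "V.lin_indpt B" unfolding maximal_def cols by auto
  obtain S where S: "S \<subseteq> mat_ground X" "inj_on (real_col X) S" "B = real_col X ` S"
    using B'(1) subset_image_inj by metis
  have SI: "S \<in> mat_indep X" using S B' by (simp add: mat_indep_def)
  have rank: "V.rank ?A = card S" using V.rank_card_indpt[OF A B] S card_image by metis
  show ?thesis unfolding rank matroid_rank_def
  proof (rule Max_eqI)
    show "finite {card S | S. S \<in> mat_indep X \<and> S \<subseteq> mat_ground X}"
      using finite_ground(1) by (simp add: setcompr_eq_image)
    show "card S \<in> {card S | S. S \<in> mat_indep X \<and> S \<subseteq> mat_ground X}" using SI S by blast
    fix k assume "k \<in> {card S | S. S \<in> mat_indep X \<and> S \<subseteq> mat_ground X}"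
    then obtain T where T: "k = card T" "T \<in> mat_indep X" by blast
    note T' = mat_indepD[OF T(2)]
    have "card (real_col X ` T) \<le> V.rank ?A"
      by (rule V.rank_ge_card_indpt[OF A]) (use T' cols in auto)
    then show "k \<le> card S" using T card_image[OF T'(3)] rank by simp
  qed
qed

text \<open>The lattice of the vectors \<open>X\<^sup>T u\<close>, indexed by all natural numbers.\<close>

definition row_lattice :: "(nat \<Rightarrow> int) set" where
  "row_lattice = range (\<lambda>(u :: nat \<Rightarrow> int) s. \<Sum>i<dim_row X. entry i s * u i)"

lemma int_lattice_row: "int_lattice row_lattice"
proof
  show "(\<lambda>_. 0) \<in> row_lattice" unfolding row_lattice_def by (rule range_eqI[of _ _ "\<lambda>_. 0"]) simp
  show "(\<lambda>s. x s + y s) \<in> row_lattice" if xy: "x \<in> row_lattice" "y \<in> row_lattice" for x y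
  proof -
    obtain u v where "x = (\<lambda>s. \<Sum>i<dim_row X. entry i s * u i)" "y = (\<lambda>s. \<Sum>i<dim_row X. entry i s * v i)"
      using xy unfolding row_lattice_def by blast
    then show ?thesis unfolding row_lattice_def
      by (intro range_eqI[of _ _ "\<lambda>i. u i + v i"]) (simp add: distrib_left sum.distrib)
  qed
  show "(\<lambda>s. - x s) \<in> row_lattice" if x: "x \<in> row_lattice" for x
  proof -
    obtain u where "x = (\<lambda>s. \<Sum>i<dim_row X. entry i s * u i)" using x unfolding row_lattice_def by blast
    then show ?thesis unfolding row_lattice_def
      by (intro range_eqI[of _ _ "\<lambda>i. - u i"]) (simp add: sum_negf)
  qed
qed

text \<open>Adjointness: pairing \<open>q\<close> with X^T u is pairing X q with u.\<close>

lemma pairing_row_lattice: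
  "(\<Sum>s\<in>S. q s * real_of_int (\<Sum>i<dim_row X. entry i s * u i))
    = (\<Sum>i<dim_row X. real_of_int (u i) * (\<Sum>s\<in>S. q s * real_of_int (entry i s)))"
  by (simp add: sum_distrib_left, subst sum.swap) (simp add: mult_ac)

lemma row_lattice_unit:
  "i < dim_row X \<Longrightarrow> (\<lambda>s. entry i s) \<in> row_lattice"
  unfolding row_lattice_def
  by (rule range_eqI[of _ _ "\<lambda>j. of_bool (j = i)"]) (auto simp: fun_eq_iff of_bool_def if_distrib sum.delta cong: if_cong)

text \<open>The rows test the coordinates of X q one by one, and the other lattice vectors are
  integer combinations of rows.\<close>

lemma dual_points_row_lattice:
  "dual_points S row_lattice =
    {q \<in> S \<rightarrow>\<^sub>E {0..<1}. \<forall>i<dim_row X. (\<Sum>s\<in>S. q s * real_of_int (entry i s)) \<in> \<int>}" (is "?L = ?R")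
proof (intro equalityI subsetI)
  fix q assume "q \<in> ?L"
  then show "q \<in> ?R" using row_lattice_unit by (fastforce simp: dual_points_def)
next
  fix q assume q: "q \<in> ?R"
  have "(\<Sum>s\<in>S. q s * real_of_int (l s)) \<in> \<int>" if l: "l \<in> row_lattice" for l
  proof -
    obtain u where "l = (\<lambda>s. \<Sum>i<dim_row X. entry i s * u i)" using l unfolding row_lattice_def by blast
    then show ?thesis unfolding \<open>l = _\<close> pairing_row_lattice using q by (auto intro!: Ints_sum[of "{..<dim_row X}"] Ints_mult[OF Ints_of_int])
  qed
  then show "q \<in> ?L" using q by (simp add: dual_points_def)
qed

text \<open>A vector orthogonal to all rows is a linear relation between the columns in
  \<open>S\<close>, so independence is the spanning condition of
  \<open>lattice_transversal\<close>.\<close>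

lemma row_lattice_transversal:
  assumes S: "S \<in> mat_indep X"
  shows "\<exists>T. finite T \<and> T \<subseteq> extensional S \<and> card T = card (dual_points S row_lattice) \<and>
      (\<forall>w. \<exists>!t. t \<in> T \<and> (\<exists>l\<in>row_lattice. \<forall>s\<in>S. w s = l s + t s))"
proof (rule lattice_transversal[OF mat_indepD(2)[OF S] int_lattice_row])
  fix q :: "nat \<Rightarrow> real"
  assume q: "\<forall>l\<in>row_lattice. (\<Sum>s\<in>S. q s * real_of_int (l s)) = 0"
  have "(\<Sum>s\<in>S. q s * real_of_int (entry i s)) = 0" if "i < dim_row X" for i
    using bspec[OF q row_lattice_unit[OF that]] by simp
  then show "\<forall>s\<in>S. q s = 0" using mat_indepD(5)[OF S] by blast
qed

end


subsection \<open>The multiplicity function of an integer matrix\<close>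

context
  fixes X :: "int mat"
begin

interpretation V: vec_space "TYPE(real)" "dim_row X" .

abbreviation (input) Zr :: "int vec monoid" where "Zr \<equiv> monoid_vec TYPE(int) (dim_row X)"

lemma group_Zr: "group Zr"
  by (rule comm_group.axioms(2)[OF comm_group_vec])

lemma inv_Zr: "v \<in> carrier_vec (dim_row X) \<Longrightarrow> inv\<^bsub>Zr\<^esub> v = - v"
  by (rule group.inv_equality[OF group_Zr]) (auto simp: monoid_vec_simps)

definition int_comb :: "nat set \<Rightarrow> (nat \<Rightarrow> int) \<Rightarrow> int vec" where
  "int_comb S k = vec (dim_row X) (\<lambda>i. \<Sum>s\<in>S. k s * X $$ (i, s))"

lemma int_comb_carrier [simp]: "int_comb S k \<in> carrier_vec (dim_row X)"
  by (simp add: int_comb_def)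

lemma col_carrier: "s \<in> mat_ground X \<Longrightarrow> col X s \<in> carrier_vec (dim_row X)"
  by (simp add: col_def)

lemma subgroup_int_combs: "subgroup (range (int_comb S)) Zr"
proof (rule group.subgroupI[OF group_Zr])
  show "range (int_comb S) \<subseteq> carrier Zr" by (auto simp: monoid_vec_simps)
  show "inv\<^bsub>Zr\<^esub> v \<in> range (int_comb S)" if v: "v \<in> range (int_comb S)" for v
  proof -
    obtain k where k: "v = int_comb S k" using v by blast
    have "inv\<^bsub>Zr\<^esub> v = int_comb S (\<lambda>s. - k s)"
      unfolding k inv_Zr[OF int_comb_carrier]
      by (rule eq_vecI) (simp_all add: int_comb_def sum_negf)
    then show ?thesis by blast
  qed
  show "v \<otimes>\<^bsub>Zr\<^esub> w \<in> range (int_comb S)" if vw: "v \<in> range (int_comb S)" "w \<in> range (int_comb S)" for v w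
  proof -
    obtain k l where k: "v = int_comb S k" "w = int_comb S l" using vw by blast
    have "v \<otimes>\<^bsub>Zr\<^esub> w = int_comb S (\<lambda>s. k s + l s)"
      unfolding k monoid_vec_simps
      by (rule eq_vecI) (simp_all add: int_comb_def sum.distrib distrib_right)
    then show ?thesis by blast
  qed
qed simp

lemma col_lattice_eq:
  assumes S: "S \<subseteq> mat_ground X"
  shows "col_lattice X S = range (int_comb S)"
proof
  have fin: "finite S" using S by (auto simp: mat_ground_def intro: finite_subset)
  have c: "col X ` S \<subseteq> carrier Zr" using S col_carrier by (auto simp: monoid_vec_simps)
  show "col_lattice X S \<subseteq> range (int_comb S)"
    unfolding col_lattice_def
  proof (rule group.generate_subgroup_incl[OF group_Zr _ subgroup_int_combs], rule image_subsetI)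
    fix s assume s: "s \<in> S"
    have "col X s = int_comb S (\<lambda>t. of_bool (t = s))"
    proof (rule eq_vecI)
      fix i assume "i < dim_vec (int_comb S (\<lambda>t. of_bool (t = s)))"
      then have i: "i < dim_row X" by (simp add: int_comb_def)
      have "(\<Sum>t\<in>S. of_bool (t = s) * X $$ (i, t)) = X $$ (i, s)"
        using fin s by (simp add: of_bool_def if_distrib[of "\<lambda>x. x * _"] cong: if_cong)
      then show "col X s $ i = int_comb S (\<lambda>t. of_bool (t = s)) $ i"
        using i s S by (auto simp: int_comb_def mat_ground_def simp del: sum_of_bool_mult_eq)
    qed (simp add: int_comb_def)
    then show "col X s \<in> range (int_comb S)" by blast
  qed
  interpret H: subgroup "col_lattice X S" Zr
    unfolding col_lattice_def by (rule group.generate_is_subgroup[OF group_Zr c])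
  have zero: "0\<^sub>v (dim_row X) \<in> col_lattice X S" using H.one_closed by (simp add: monoid_vec_simps)
  have add: "v + w \<in> col_lattice X S" if "v \<in> col_lattice X S" "w \<in> col_lattice X S" for v w
    using H.m_closed[OF that] by (simp add: monoid_vec_simps)
  have neg: "- v \<in> col_lattice X S" if "v \<in> col_lattice X S" for v
    using H.m_inv_closed[OF that] inv_Zr[of v] H.mem_carrier[OF that] by (simp add: monoid_vec_simps)
  have mult: "c \<cdot>\<^sub>v col X s \<in> col_lattice X S" if s: "s \<in> S" for c s
  proof (induction c rule: int_induct[of _ 0])
    case base
    have "(0::int) \<cdot>\<^sub>v col X s = 0\<^sub>v (dim_row X)" by (rule eq_vecI) simp_all
    then show ?case using zero by simp
  next
    have cs: "col X s \<in> col_lattice X S" unfolding col_lattice_def by (rule generate.incl) (use s in blast)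
    case (step1 c)
    have "(c + 1) \<cdot>\<^sub>v col X s = c \<cdot>\<^sub>v col X s + col X s" by (rule eq_vecI) (simp_all add: distrib_right)
    then show ?case using add[OF step1(2) cs] by simp
  next
    have cs: "col X s \<in> col_lattice X S" unfolding col_lattice_def by (rule generate.incl) (use s in blast)
    case (step2 c)
    have "(c - 1) \<cdot>\<^sub>v col X s = c \<cdot>\<^sub>v col X s + - col X s" by (rule eq_vecI) (simp_all add: left_diff_distrib)
    then show ?case using add[OF step2(2) neg[OF cs]] by simp
  qed
  show "range (int_comb S) \<subseteq> col_lattice X S"
  proof (rule image_subsetI)
    fix k
    have "int_comb F k \<in> col_lattice X S" if "finite F" "F \<subseteq> S" for F
      using that
    proof (induction F)
      case empty
      have "int_comb {} k = 0\<^sub>v (dim_row X)" by (rule eq_vecI) (simp_all add: int_comb_def)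
      then show ?case using zero by simp
    next
      case (insert s F)
      have "s < dim_col X" using insert.prems S by (auto simp: mat_ground_def)
      then have "int_comb (insert s F) k = k s \<cdot>\<^sub>v col X s + int_comb F k"
        by (intro eq_vecI) (simp_all add: int_comb_def insert.hyps)
      then show ?case using add[OF mult] insert by simp
    qed
    then show "int_comb S k \<in> col_lattice X S" using fin by blast
  qed
qed

text \<open>Coefficients in a span are attached to vectors; injectivity of the columns lets them be
  indexed by \<open>S\<close>.\<close>

lemma col_saturation_iff:
  assumes S: "S \<in> mat_indep X"
  shows "v \<in> col_saturation X S \<longleftrightarrow> v \<in> carrier_vec (dim_row X) \<and>
    (\<exists>a. \<forall>i<dim_row X. real_of_int (v $ i) = (\<Sum>s\<in>S. a s * real_of_int (X $$ (i, s))))"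
proof -
  note S' = mat_indepD[OF S]
  have span: "V.span (real_col X ` S) = {V.lincomb b (real_col X ` S) | b. b \<in> real_col X ` S \<rightarrow> UNIV}"
    using V.finite_span[OF finite_imageI[OF S'(2)]] real_col_image_carrier[OF S'(1)] by simp
  have eq_iff: "map_vec real_of_int v = V.lincomb b (real_col X ` S) \<longleftrightarrow>
      (\<forall>i<dim_row X. real_of_int (v $ i) = (\<Sum>s\<in>S. b (real_col X s) * real_of_int (X $$ (i, s))))"
    if v: "v \<in> carrier_vec (dim_row X)" for b
    using lincomb_real_col_carrier[OF S'(1), of b] v lincomb_real_col_index[OF S'(1,3)]
    by (auto simp: vec_eq_iff)
  have "(\<exists>b. \<forall>i<dim_row X. real_of_int (v $ i) = (\<Sum>s\<in>S. b (real_col X s) * real_of_int (X $$ (i, s))))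
    \<longleftrightarrow> (\<exists>a. \<forall>i<dim_row X. real_of_int (v $ i) = (\<Sum>s\<in>S. a s * real_of_int (X $$ (i, s))))"
    (is "?L \<longleftrightarrow> ?R")
  proof
    assume ?R
    then obtain a where a: "\<forall>i<dim_row X. real_of_int (v $ i) = (\<Sum>s\<in>S. a s * real_of_int (X $$ (i, s)))" by blast
    have "(\<Sum>s\<in>S. a (inv_into S (real_col X) (real_col X s)) * real_of_int (X $$ (i, s)))
        = (\<Sum>s\<in>S. a s * real_of_int (X $$ (i, s)))" for i
      using S'(3) by (intro sum.cong) auto
    then show ?L using a by (intro exI[of _ "\<lambda>v. a (inv_into S (real_col X) v)"]) simp
  next
    assume ?L
    then obtain b where "\<forall>i<dim_row X. real_of_int (v $ i) = (\<Sum>s\<in>S. b (real_col X s) * real_of_int (X $$ (i, s)))"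
      by blast
    then show ?R by (rule exI[of _ "\<lambda>s. b (real_col X s)"])
  qed
  moreover have "v \<in> col_saturation X S \<longleftrightarrow> v \<in> carrier_vec (dim_row X) \<and>
      (\<exists>b. map_vec real_of_int v = V.lincomb b (real_col X ` S))"
    unfolding col_saturation_def span by auto
  ultimately show ?thesis using eq_iff by (simp cong: conj_cong)
qed

text \<open>The bijection is q \<mapsto> X[S] q modulo the column lattice. Independence makes real
  coefficients unique, and reducing them modulo 1 changes the vector by an integer combination of
  columns.\<close>

theorem mat_mult_eq_card_dual_points:
  assumes S: "S \<in> mat_indep X"
  shows "mat_mult X S = card (dual_points S (row_lattice X))"
proof -
  note S' = mat_indepD[OF S]
  let ?L = "col_lattice X S"
  have L: "?L = range (int_comb S)" by (rule col_lattice_eq[OF S'(1)])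
  have sub: "subgroup ?L Zr" unfolding L by (rule subgroup_int_combs)
  let ?D = "dual_points S (row_lattice X)"
  let ?lc = "\<lambda>q i. \<Sum>s\<in>S. q s * real_of_int (X $$ (i, s))"
  \<comment> \<open>On dual points the sums are already integers; the floor just converts them to
    type \<open>int\<close>.\<close>
  define f where "f q = vec (dim_row X) (\<lambda>i. \<lfloor>?lc q i\<rfloor>)" for q
  have f: "real_of_int (f q $ i) = ?lc q i" if "q \<in> ?D" "i < dim_row X" for q i
    using that by (auto simp: f_def dual_points_row_lattice elim: Ints_cases)
  have fc: "f q \<in> carrier Zr" for q by (simp add: f_def monoid_vec_simps)
  have cos: "?L #>\<^bsub>Zr\<^esub> v = ?L #>\<^bsub>Zr\<^esub> w \<longleftrightarrow> (\<exists>k. \<forall>i<dim_row X. v $ i = (\<Sum>s\<in>S. k s * X $$ (i, s)) + w $ i)"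
    if vw: "v \<in> carrier_vec (dim_row X)" "w \<in> carrier_vec (dim_row X)" for v w
  proof -
    have "?L #>\<^bsub>Zr\<^esub> v = ?L #>\<^bsub>Zr\<^esub> w \<longleftrightarrow> (\<exists>k. v = int_comb S k + w)"
      using group.r_coset_eq_iff[OF group_Zr sub, of v w] vw by (simp add: monoid_vec_simps L)
    also have "\<dots> \<longleftrightarrow> (\<exists>k. \<forall>i<dim_row X. v $ i = (\<Sum>s\<in>S. k s * X $$ (i, s)) + w $ i)"
      using vw by (simp add: vec_eq_iff int_comb_def)
    finally show ?thesis .
  qed
  have "bij_betw (\<lambda>q. ?L #>\<^bsub>Zr\<^esub> f q) ?D ((\<lambda>v. ?L #>\<^bsub>Zr\<^esub> v) ` col_saturation X S)"
    unfolding bij_betw_def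
  proof
    show "inj_on (\<lambda>q. ?L #>\<^bsub>Zr\<^esub> f q) ?D"
    proof (rule inj_onI)
      fix p q assume pq: "p \<in> ?D" "q \<in> ?D" "?L #>\<^bsub>Zr\<^esub> f p = ?L #>\<^bsub>Zr\<^esub> f q"
      then obtain k where k: "\<forall>i<dim_row X. f p $ i = (\<Sum>s\<in>S. k s * X $$ (i, s)) + f q $ i"
        using cos[of "f p" "f q"] fc[of p] fc[of q] by (auto simp: monoid_vec_simps)
      \<comment> \<open>By independence p - q is the integer vector \<open>k\<close>; as both points
        lie in [0,1), it must vanish.\<close>
      have "(\<Sum>s\<in>S. (p s - q s - real_of_int (k s)) * real_of_int (X $$ (i, s))) = 0" if i: "i < dim_row X" for i
      proof -
        have "?lc p i = (\<Sum>s\<in>S. real_of_int (k s) * real_of_int (X $$ (i, s))) + ?lc q i"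
          using k i f[OF pq(1) i] f[OF pq(2) i] by (metis (no_types, lifting) of_int_add of_int_mult of_int_sum sum.cong)
        then show ?thesis by (simp add: left_diff_distrib sum_subtractf)
      qed
      then have k': "p s - q s = real_of_int (k s)" if "s \<in> S" for s
        using mat_indepD(5)[OF S, of "\<lambda>s. p s - q s - real_of_int (k s)" s] that by simp
      have "p s = q s" if s: "s \<in> S" for s
      proof -
        have "0 \<le> p s" "p s < 1" "0 \<le> q s" "q s < 1"
          using pq(1,2) s by (auto simp: dual_points_def PiE_iff)
        then have "\<bar>real_of_int (k s)\<bar> < 1" using k'[OF s] by linarith
        then have "k s = 0" by linarith
        then show ?thesis using k'[OF s] by simp
      qed
      then show "p = q"
        using pq(1,2) by (intro PiE_ext[of p S _ q]) (auto simp: dual_points_def)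
    qed
    show "(\<lambda>q. ?L #>\<^bsub>Zr\<^esub> f q) ` ?D = (\<lambda>v. ?L #>\<^bsub>Zr\<^esub> v) ` col_saturation X S"
    proof (intro equalityI image_subsetI)
      fix q assume q: "q \<in> ?D"
      have "f q \<in> col_saturation X S"
        unfolding col_saturation_iff[OF S] using f[OF q] fc[of q] by (auto simp: monoid_vec_simps)
      then show "?L #>\<^bsub>Zr\<^esub> f q \<in> (\<lambda>v. ?L #>\<^bsub>Zr\<^esub> v) ` col_saturation X S" by blast
    next
      fix v assume "v \<in> col_saturation X S"
      then obtain a where v: "v \<in> carrier_vec (dim_row X)"
        and a: "\<forall>i<dim_row X. real_of_int (v $ i) = ?lc a i"
        unfolding col_saturation_iff[OF S] by blast
      \<comment> \<open>Fractional parts of the coefficients of \<open>v\<close>; the floors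
        describe the lattice vector that is removed.\<close>
      let ?q = "restrict (\<lambda>s. frac (a s)) S"
      have lc: "?lc ?q i = real_of_int (v $ i - (\<Sum>s\<in>S. \<lfloor>a s\<rfloor> * X $$ (i, s)))" if i: "i < dim_row X" for i
      proof -
        have "?lc ?q i = (\<Sum>s\<in>S. (a s - real_of_int \<lfloor>a s\<rfloor>) * real_of_int (X $$ (i, s)))"
          by (intro sum.cong) (auto simp: frac_def)
        then show ?thesis using a i by (simp add: left_diff_distrib sum_subtractf)
      qed
      have q: "?q \<in> ?D"
        unfolding dual_points_row_lattice using lc by (auto simp: frac_ge_0 frac_lt_1)
      have "\<forall>i<dim_row X. v $ i = (\<Sum>s\<in>S. \<lfloor>a s\<rfloor> * X $$ (i, s)) + f ?q $ i"
      proof (intro allI impI)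
        fix i assume i: "i < dim_row X"
        have "f ?q $ i = v $ i - (\<Sum>s\<in>S. \<lfloor>a s\<rfloor> * X $$ (i, s))"
          using f[OF q i] lc[OF i] by (metis of_int_eq_iff)
        then show "v $ i = (\<Sum>s\<in>S. \<lfloor>a s\<rfloor> * X $$ (i, s)) + f ?q $ i" by simp
      qed
      then have "?L #>\<^bsub>Zr\<^esub> v = ?L #>\<^bsub>Zr\<^esub> f ?q"
        using cos[OF v, of "f ?q"] fc[of ?q] by (auto simp: monoid_vec_simps)
      then show "?L #>\<^bsub>Zr\<^esub> v \<in> (\<lambda>q. ?L #>\<^bsub>Zr\<^esub> f q) ` ?D" using q by blast
    qed
  qed
  then have "card ?D = card ((\<lambda>v. ?L #>\<^bsub>Zr\<^esub> v) ` col_saturation X S)" by (rule bij_betw_same_card)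
  then show ?thesis by (simp add: mat_mult_def Coset.order_def carrier_Mod_restricted)
qed

end


subsection \<open>The group structure of an integer matrix\<close>

text \<open>The formula of \<open>mat_proj\<close> without the deleted element, usable for arbitrary
  subsets.\<close>

definition coset_restrict :: "int mat \<Rightarrow> nat set \<Rightarrow> (nat \<Rightarrow> int) set \<Rightarrow> (nat \<Rightarrow> int) set" where
  "coset_restrict X S C = (\<Union>w\<in>C. mat_I X S #>\<^bsub>int_power S\<^esub> restrict w S)"

lemma mat_proj_eq: "mat_proj X S s = coset_restrict X S"
  by (simp add: fun_eq_iff mat_proj_def coset_restrict_def)

lemma carrier_int_power: "carrier (int_power S) = extensional S"
  by (simp add: PiE_def)

lemma group_int_power: "group (int_power S)"
  by simp

context
  fixes X :: "int mat"
begin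

interpretation L: int_lattice "row_lattice X" by (rule int_lattice_row)

lemma mat_I_iff:
  assumes S: "S \<subseteq> mat_ground X"
  shows "w \<in> mat_I X S \<longleftrightarrow> w \<in> extensional S \<and> (\<exists>l\<in>row_lattice X. \<forall>s\<in>S. w s = l s)"
proof -
  have sp: "col X s \<bullet> u = (\<Sum>i<dim_row X. X $$ (i, s) * u $ i)"
    if "u \<in> carrier_vec (dim_row X)" "s \<in> S" for u s
    using that S by (auto simp: scalar_prod_def mat_ground_def atLeast0LessThan intro!: sum.cong)
  have "(\<exists>u\<in>carrier_vec (dim_row X). \<forall>s\<in>S. w s = col X s \<bullet> u) \<longleftrightarrow> (\<exists>l\<in>row_lattice X. \<forall>s\<in>S. w s = l s)"
  proof
    assume "\<exists>u\<in>carrier_vec (dim_row X). \<forall>s\<in>S. w s = col X s \<bullet> u"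
    then obtain u where u: "u \<in> carrier_vec (dim_row X)" "\<forall>s\<in>S. w s = col X s \<bullet> u" by blast
    have mem: "(\<lambda>s. \<Sum>i<dim_row X. X $$ (i, s) * u $ i) \<in> row_lattice X" by (auto simp: row_lattice_def)
    have "\<forall>s\<in>S. w s = (\<Sum>i<dim_row X. X $$ (i, s) * u $ i)" using u sp by simp
    then show "\<exists>l\<in>row_lattice X. \<forall>s\<in>S. w s = l s" by (rule bexI[OF _ mem])
  next
    assume "\<exists>l\<in>row_lattice X. \<forall>s\<in>S. w s = l s"
    then obtain u where u: "\<forall>s\<in>S. w s = (\<Sum>i<dim_row X. X $$ (i, s) * u i)"
      unfolding row_lattice_def by blast
    have "\<forall>s\<in>S. w s = col X s \<bullet> vec (dim_row X) u" using u sp[of "vec (dim_row X) u"] by simp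
    then show "\<exists>u\<in>carrier_vec (dim_row X). \<forall>s\<in>S. w s = col X s \<bullet> u"
      by (rule bexI) simp
  qed
  then show ?thesis unfolding mat_I_def carrier_int_power by simp
qed

lemma subgroup_mat_I:
  assumes S: "S \<subseteq> mat_ground X"
  shows "subgroup (mat_I X S) (int_power S)"
proof (rule group.subgroupI[OF group_int_power])
  show sub: "mat_I X S \<subseteq> carrier (int_power S)" unfolding carrier_int_power using mat_I_iff[OF S] by blast
  have "(\<lambda>s\<in>S. 0) \<in> mat_I X S"
    unfolding mat_I_iff[OF S] using L.lattice_zero by (intro conjI bexI[of _ "\<lambda>_. 0"]) auto
  then show "mat_I X S \<noteq> {}" by blast
  show "inv\<^bsub>int_power S\<^esub> w \<in> mat_I X S" if w: "w \<in> mat_I X S" for w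
  proof -
    obtain l where l: "l \<in> row_lattice X" "\<forall>s\<in>S. w s = l s" using w mat_I_iff[OF S] by blast
    have "inv\<^bsub>int_power S\<^esub> w = (\<lambda>s\<in>S. - w s)"
      using w sub by (subst inv_product_group) auto
    then show ?thesis unfolding mat_I_iff[OF S]
      using l L.lattice_uminus by (intro conjI bexI[of _ "\<lambda>s. - l s"]) auto
  qed
  show "v \<otimes>\<^bsub>int_power S\<^esub> w \<in> mat_I X S" if vw: "v \<in> mat_I X S" "w \<in> mat_I X S" for v w
  proof -
    obtain k l where l: "k \<in> row_lattice X" "\<forall>s\<in>S. v s = k s" "l \<in> row_lattice X" "\<forall>s\<in>S. w s = l s"
      using vw mat_I_iff[OF S] by blast
    then show ?thesis unfolding mat_I_iff[OF S]
      using L.lattice_add by (intro conjI bexI[of _ "\<lambda>s. k s + l s"]) auto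
  qed
qed

lemma mat_I_coset_eq_iff:
  assumes S: "S \<subseteq> mat_ground X" and w: "w \<in> extensional S" "t \<in> extensional S"
  shows "mat_I X S #>\<^bsub>int_power S\<^esub> w = mat_I X S #>\<^bsub>int_power S\<^esub> t
    \<longleftrightarrow> (\<exists>l\<in>row_lattice X. \<forall>s\<in>S. w s = l s + t s)"
proof -
  have "mat_I X S #>\<^bsub>int_power S\<^esub> w = mat_I X S #>\<^bsub>int_power S\<^esub> t
      \<longleftrightarrow> (\<exists>h\<in>mat_I X S. w = h \<otimes>\<^bsub>int_power S\<^esub> t)"
    by (rule group.r_coset_eq_iff[OF group_int_power subgroup_mat_I[OF S]])
      (use w in \<open>simp_all only: carrier_int_power\<close>)
  also have "\<dots> \<longleftrightarrow> (\<exists>l\<in>row_lattice X. \<forall>s\<in>S. w s = l s + t s)"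
  proof
    assume "\<exists>h\<in>mat_I X S. w = h \<otimes>\<^bsub>int_power S\<^esub> t"
    then obtain h where h: "h \<in> mat_I X S" "w = (\<lambda>s\<in>S. h s + t s)" by auto
    then obtain l where "l \<in> row_lattice X" "\<forall>s\<in>S. h s = l s" using mat_I_iff[OF S] by blast
    then show "\<exists>l\<in>row_lattice X. \<forall>s\<in>S. w s = l s + t s" using h(2) by (intro bexI[of _ l]) auto
  next
    assume "\<exists>l\<in>row_lattice X. \<forall>s\<in>S. w s = l s + t s"
    then obtain l where l: "l \<in> row_lattice X" "\<forall>s\<in>S. w s = l s + t s" by blast
    have "restrict l S \<in> mat_I X S" unfolding mat_I_iff[OF S] using l(1) by auto
    moreover have "w = restrict l S \<otimes>\<^bsub>int_power S\<^esub> t"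
      using l(2) w(1) by (auto simp: fun_eq_iff extensional_def)
    ultimately show "\<exists>h\<in>mat_I X S. w = h \<otimes>\<^bsub>int_power S\<^esub> t" by blast
  qed
  finally show ?thesis .
qed

text \<open>Two multiples of \<open>w\<close> are congruent modulo the lattice, as it has finite index.\<close>

lemma mat_W_eq:
  assumes S: "S \<in> mat_indep X"
  shows "mat_W X S = extensional S"
proof -
  obtain T where T: "finite T" "\<And>w. \<exists>!t. t \<in> T \<and> (\<exists>l\<in>row_lattice X. \<forall>s\<in>S. w s = l s + t s)"
    using row_lattice_transversal[OF S] by auto
  have "\<exists>u\<in>carrier_vec (dim_row X). \<forall>s\<in>S. real_of_int (w s) = real_col X s \<bullet> u" for w
  proof -
    have "\<forall>n :: nat. \<exists>t. t \<in> T \<and> (\<exists>l\<in>row_lattice X. \<forall>s\<in>S. int n * w s = l s + t s)"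
    proof
      fix n :: nat
      show "\<exists>t. t \<in> T \<and> (\<exists>l\<in>row_lattice X. \<forall>s\<in>S. int n * w s = l s + t s)"
        using ex1_implies_ex[OF T(2)[of "\<lambda>s. int n * w s"]] by simp
    qed
    then obtain c where c: "\<And>n. c n \<in> T" "\<And>n. \<exists>l\<in>row_lattice X. \<forall>s\<in>S. int n * w s = l s + c n s"
      by metis
    \<comment> \<open>Infinitely many multiples of \<open>w\<close> share finitely many
      representatives.\<close>
    have "\<not> inj c"
      using finite_subset[OF image_subsetI[of UNIV c T] T(1)] c(1) finite_imageD infinite_UNIV_nat by blast
    then obtain n n' where n: "c n = c n'" "n < n'" unfolding inj_on_def by (metis linorder_neqE_nat)
    obtain l l' where l: "l \<in> row_lattice X" "\<forall>s\<in>S. int n * w s = l s + c n s"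
      "l' \<in> row_lattice X" "\<forall>s\<in>S. int n' * w s = l' s + c n' s"
      using c(2)[of n] c(2)[of n'] by blast
    have "(\<lambda>s. l' s - l s) \<in> row_lattice X" using L.lattice_diff_mult[OF l(3,1), of 1] by simp
    then obtain u where u: "(\<lambda>s. l' s - l s) = (\<lambda>s. \<Sum>i<dim_row X. X $$ (i, s) * u i)"
      unfolding row_lattice_def by blast
    let ?d = "real n' - real n"
    \<comment> \<open>\<open>l' - l\<close> equals (n' - n) w on \<open>S\<close>, so dividing a
      preimage by n' - n solves the real system.\<close>
    let ?u = "vec (dim_row X) (\<lambda>i. real_of_int (u i) / ?d)"
    have d: "?d \<noteq> 0" using n(2) by simp
    have "real_of_int (w s) = real_col X s \<bullet> ?u" if s: "s \<in> S" for s
    proof -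
      have "s < dim_col X" using mat_indepD(1)[OF S] s by (auto simp: mat_ground_def)
      then have "real_col X s \<bullet> ?u = (\<Sum>i<dim_row X. real_of_int (X $$ (i, s)) * real_of_int (u i) / ?d)"
        by (auto simp: scalar_prod_def real_col_def atLeast0LessThan intro!: sum.cong)
      also have "\<dots> = real_of_int (l' s - l s) / ?d"
        unfolding fun_cong[OF u] by (simp add: sum_divide_distrib)
      also have "l' s - l s = (int n' - int n) * w s"
        using bspec[OF l(2) s] bspec[OF l(4) s] n(1) by (simp add: left_diff_distrib)
      finally show ?thesis using d by simp
    qed
    then show ?thesis by (intro bexI[of _ ?u]) simp_all
  qed
  then show ?thesis unfolding mat_W_def carrier_int_power by blast
qed

lemma carrier_mat_group:
  "S \<in> mat_indep X \<Longrightarrow>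
    carrier (mat_group X S) = (\<lambda>w. mat_I X S #>\<^bsub>int_power S\<^esub> w) ` extensional S"
  by (simp only: mat_group_def carrier_Mod_restricted mat_W_eq)

text \<open>As W(S) is all of Z^S, the transversal of the row lattice represents the whole group,
  and its size was computed as the number of dual points.\<close>

lemma card_mat_group:
  assumes S: "S \<in> mat_indep X"
  shows "finite (carrier (mat_group X S))" "card (carrier (mat_group X S)) = mat_mult X S"
proof -
  note cos = mat_I_coset_eq_iff[OF mat_indepD(1)[OF S]]
  obtain T where T: "finite T" "T \<subseteq> extensional S" "card T = card (dual_points S (row_lattice X))"
    "\<And>w. \<exists>!t. t \<in> T \<and> (\<exists>l\<in>row_lattice X. \<forall>s\<in>S. w s = l s + t s)"
    using row_lattice_transversal[OF S] by auto
  have refl: "\<exists>l\<in>row_lattice X. \<forall>s\<in>S. t s = l s + t s" for t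
    using L.lattice_zero by (intro bexI[of _ "\<lambda>_. 0"]) auto
  have bij: "bij_betw (\<lambda>t. mat_I X S #>\<^bsub>int_power S\<^esub> t) T (carrier (mat_group X S))"
    unfolding bij_betw_def carrier_mat_group[OF S]
  proof
    show "inj_on (\<lambda>t. mat_I X S #>\<^bsub>int_power S\<^esub> t) T"
    proof (rule inj_onI)
      fix t t' assume t: "t \<in> T" "t' \<in> T"
        and eq: "mat_I X S #>\<^bsub>int_power S\<^esub> t = mat_I X S #>\<^bsub>int_power S\<^esub> t'"
      have "\<exists>l\<in>row_lattice X. \<forall>s\<in>S. t s = l s + t' s" using eq cos[of t t'] t T(2) by blast
      then show "t = t'" using T(4)[of t] t refl[of t] by blast
    qed
    show "(\<lambda>t. mat_I X S #>\<^bsub>int_power S\<^esub> t) ` T = (\<lambda>w. mat_I X S #>\<^bsub>int_power S\<^esub> w) ` extensional S"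
    proof (intro equalityI image_subsetI)
      fix w :: "nat \<Rightarrow> int" assume w: "w \<in> extensional S"
      obtain t where t: "t \<in> T" "\<exists>l\<in>row_lattice X. \<forall>s\<in>S. w s = l s + t s"
        using ex1_implies_ex[OF T(4)[of w]] by blast
      then have "mat_I X S #>\<^bsub>int_power S\<^esub> w = mat_I X S #>\<^bsub>int_power S\<^esub> t"
        using cos[OF w, of t] T(2) by blast
      then show "mat_I X S #>\<^bsub>int_power S\<^esub> w \<in> (\<lambda>t. mat_I X S #>\<^bsub>int_power S\<^esub> t) ` T"
        using t(1) by blast
    qed (use T(2) in blast)
  qed
  show "finite (carrier (mat_group X S))" using bij_betw_finite[OF bij] T(1) by blast
  show "card (carrier (mat_group X S)) = mat_mult X S"
    using bij_betw_same_card[OF bij] T(3) mat_mult_eq_card_dual_points[OF S] by simp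
qed

text \<open>Restriction maps I(S) into I(T), so all members of a coset restrict into the same
  coset.\<close>

lemma coset_restrict_coset:
  assumes S: "S \<subseteq> mat_ground X" and T: "T \<subseteq> S" and w: "w \<in> extensional S"
  shows "coset_restrict X T (mat_I X S #>\<^bsub>int_power S\<^esub> w) = mat_I X T #>\<^bsub>int_power T\<^esub> restrict w T"
proof -
  have T': "T \<subseteq> mat_ground X" using S T by blast
  have "mat_I X T #>\<^bsub>int_power T\<^esub> restrict w' T = mat_I X T #>\<^bsub>int_power T\<^esub> restrict w T"
    if w': "w' \<in> mat_I X S #>\<^bsub>int_power S\<^esub> w" for w'
  proof -
    obtain h where h: "h \<in> mat_I X S" "w' = (\<lambda>s\<in>S. h s + w s)" using w' by (auto simp: r_coset_def)
    obtain l where l: "l \<in> row_lattice X" "\<forall>s\<in>S. h s = l s" using h(1) mat_I_iff[OF S] by blast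
    have "\<forall>s\<in>T. restrict w' T s = l s + restrict w T s" using h(2) l(2) T by auto
    then show ?thesis using l(1) by (subst mat_I_coset_eq_iff[OF T']) auto
  qed
  moreover have "w \<in> mat_I X S #>\<^bsub>int_power S\<^esub> w"
    by (rule group.rcos_self[OF group_int_power _ subgroup_mat_I[OF S]]) (use w in \<open>simp only: carrier_int_power\<close>)
  ultimately show ?thesis unfolding coset_restrict_def by blast
qed

lemma projection_system_mat:
  "projection_system (mat_indep X) (\<lambda>S. carrier (mat_group X S)) (coset_restrict X)"
proof
  show "finite (mat_indep X)"
    using finite_ground(1)[of X] mat_indepD(1)[of _ X] by (meson PowI finite_Pow_iff finite_subset subsetI)
  show "finite S" if "S \<in> mat_indep X" for S using mat_indepD(2)[OF that] .
  show "T \<in> mat_indep X" if "S \<in> mat_indep X" "T \<subseteq> S" for S T using mat_indep_mono[OF that] .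
  show "{} \<in> mat_indep X" by (rule empty_mat_indep)
  show "finite (carrier (mat_group X S))" if "S \<in> mat_indep X" for S by (rule card_mat_group[OF that])
  show "coset_restrict X T g \<in> carrier (mat_group X T)"
    if S: "S \<in> mat_indep X" and T: "T \<subseteq> S" and g: "g \<in> carrier (mat_group X S)" for S T g
  proof -
    obtain w where w: "w \<in> extensional S" "g = mat_I X S #>\<^bsub>int_power S\<^esub> w"
      using g carrier_mat_group[OF S] by blast
    show ?thesis
      unfolding w(2) coset_restrict_coset[OF mat_indepD(1)[OF S] T w(1)]
        carrier_mat_group[OF mat_indep_mono[OF S T]] by (rule imageI[OF restrict_extensional])
  qed
  show "coset_restrict X S g = g" if S: "S \<in> mat_indep X" and g: "g \<in> carrier (mat_group X S)" for S g
  proof -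
    obtain w where w: "w \<in> extensional S" "g = mat_I X S #>\<^bsub>int_power S\<^esub> w"
      using g carrier_mat_group[OF S] by blast
    show ?thesis
      unfolding w(2) coset_restrict_coset[OF mat_indepD(1)[OF S] subset_refl w(1)] extensional_restrict[OF w(1)] ..
  qed
  show "coset_restrict X U (coset_restrict X T g) = coset_restrict X U g"
    if S: "S \<in> mat_indep X" and UT: "U \<subseteq> T" and T: "T \<subseteq> S" and g: "g \<in> carrier (mat_group X S)" for S U T g
  proof -
    obtain w where w: "w \<in> extensional S" "g = mat_I X S #>\<^bsub>int_power S\<^esub> w"
      using g carrier_mat_group[OF S] by blast
    have "restrict (restrict w T) U = restrict w U" using UT by (auto simp: fun_eq_iff)
    moreover have "coset_restrict X U (mat_I X T #>\<^bsub>int_power T\<^esub> restrict w T)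
        = mat_I X U #>\<^bsub>int_power U\<^esub> restrict (restrict w T) U"
      by (rule coset_restrict_coset[OF mat_indepD(1)[OF mat_indep_mono[OF S T]] UT restrict_extensional])
    ultimately show ?thesis
      unfolding w(2) coset_restrict_coset[OF mat_indepD(1)[OF S] T w(1)]
        coset_restrict_coset[OF mat_indepD(1)[OF S] subset_trans[OF UT T] w(1)] by simp
  qed
qed

text \<open>There is only one extensional function on the empty set, so the structure of a matrix is
  always torsion-free.\<close>

lemma carrier_mat_group_empty: "carrier (mat_group X {}) = {\<one>\<^bsub>mat_group X {}\<^esub>}"
proof -
  have "mat_I X {} #>\<^bsub>int_power {}\<^esub> \<one>\<^bsub>int_power {}\<^esub> = mat_I X {}"
    using subgroup.subset[OF subgroup_mat_I[of "{}"]] by (intro group.coset_mult_one group_int_power) simp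
  moreover have "extensional {} = {\<one>\<^bsub>int_power {}\<^esub>}" by auto
  ultimately have "carrier (mat_group X {}) = {mat_I X {}}"
    unfolding carrier_mat_group[OF empty_mat_indep] by simp
  then show ?thesis by (simp add: mat_group_def FactGroup_def)
qed

theorem Hilb_mat:
  assumes r: "vec_space.rank (dim_row X) (map_mat real_of_int X) = r"
  shows "mat_mult X {} = 1"
    and "fps_to_fls (Hilb TYPE('k::field) (ind_poset (mat_indep X) (mat_group X) (mat_proj X)))
      = fls_X ^ r * arith_tutte (mat_ground X) (mat_indep X) (mat_mult X) (1 / fls_X) 1 / (1 - fls_X) ^ r"
    and "fps_to_fls (Hilb TYPE('k) (tf_ind_poset (mat_indep X) (mat_group X) (mat_proj X)))
      = fls_X ^ r * arith_tutte (mat_ground X) (mat_indep X) (mat_mult X) (1 / fls_X) 1 / (1 - fls_X) ^ r"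
proof -
  interpret P: projection_system "mat_indep X" "\<lambda>S. carrier (mat_group X S)" "coset_restrict X"
    by (rule projection_system_mat)
  show m: "mat_mult X {} = 1"
    using card_mat_group(2)[OF empty_mat_indep] carrier_mat_group_empty by simp
  \<comment> \<open>Stated for every \<open>G\<close> with the right carriers, to cover the
    torsion-free part as well.\<close>
  have H: "fps_to_fls (Hilb TYPE('k) (ind_poset (mat_indep X) G (mat_proj X)))
      = fls_X ^ r * arith_tutte (mat_ground X) (mat_indep X) (mat_mult X) (1 / fls_X) 1 / (1 - fls_X) ^ r"
    if "\<And>S. S \<in> mat_indep X \<Longrightarrow> carrier (G S) = carrier (mat_group X S)"
    for G :: "nat set \<Rightarrow> (nat \<Rightarrow> int) set monoid"
  proof -
    have "fps_to_fls (Hilb TYPE('k) (ind_poset (mat_indep X) G (mat_proj X)))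
      = 1 / of_nat (mat_mult X {}) * (fls_X ^ r *
          arith_tutte (mat_ground X) (mat_indep X) (mat_mult X) (1 / fls_X) 1 / (1 - fls_X) ^ r)"
      using that m card_mat_group(2) matroid_rank_mat[of X] r carrier_mat_group_empty
      by (intro P.Hilb_ind_poset[OF matroid_mat]) (simp_all add: mat_proj_eq)
    then show ?thesis by (simp only: m of_nat_1 div_by_1 mult_1_left)
  qed
  show "fps_to_fls (Hilb TYPE('k) (ind_poset (mat_indep X) (mat_group X) (mat_proj X)))
      = fls_X ^ r * arith_tutte (mat_ground X) (mat_indep X) (mat_mult X) (1 / fls_X) 1 / (1 - fls_X) ^ r"
    by (rule H) simp
  \<comment> \<open>The target group is trivial, so the kernel is everything.\<close>
  have "carrier (torsion_free_part (mat_group X) (mat_proj X) S) = carrier (mat_group X S)"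
    if S: "S \<in> mat_indep X" for S
    using P.carrier_torsion_free_part[of "mat_group X" S "mat_proj X"] S
      P.proj_closed[OF S empty_subsetI] carrier_mat_group_empty
    by (auto simp: mat_proj_eq)
  then show "fps_to_fls (Hilb TYPE('k) (tf_ind_poset (mat_indep X) (mat_group X) (mat_proj X)))
      = fls_X ^ r * arith_tutte (mat_ground X) (mat_indep X) (mat_mult X) (1 / fls_X) 1 / (1 - fls_X) ^ r"
    unfolding tf_ind_poset_def by (rule H)
qed

end


theorem theorem3p4:
  fixes X :: "int mat" and r N r' :: nat
    and E :: "'e set" and \<Delta> :: "'e set set" and m :: "'e set \<Rightarrow> nat"
  shows
    "(X \<in> carrier_mat r N \<and> vec_space.rank r (map_mat real_of_int X) = r \<longrightarrow>
        (mat_mult X {} = 1 \<longrightarrow>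
           fps_to_fls (Hilb TYPE('k::field)
             (ind_poset (mat_indep X) (mat_group X) (mat_proj X)))
           = fls_X ^ r * arith_tutte (mat_ground X) (mat_indep X) (mat_mult X) (1 / fls_X) 1
             / (1 - fls_X) ^ r) \<and>
        fps_to_fls (Hilb TYPE('k)
          (tf_ind_poset (mat_indep X) (mat_group X) (mat_proj X)))
        = 1 / of_nat (mat_mult X {})
          * (fls_X ^ r * arith_tutte (mat_ground X) (mat_indep X) (mat_mult X) (1 / fls_X) 1
             / (1 - fls_X) ^ r))
     \<and>
     (weak_quasi_arith_matroid E \<Delta> m \<and> matroid_rank \<Delta> E = r' \<longrightarrow>
        (m {} = 1 \<longrightarrow>
           fps_to_fls (Hilb TYPE('k)
             (ind_poset \<Delta> (zmod_group m) (zmod_proj m)))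
           = fls_X ^ r' * arith_tutte E \<Delta> m (1 / fls_X) 1 / (1 - fls_X) ^ r') \<and>
        fps_to_fls (Hilb TYPE('k)
          (tf_ind_poset \<Delta> (zmod_group m) (zmod_proj m)))
        = 1 / of_nat (m {})
          * (fls_X ^ r' * arith_tutte E \<Delta> m (1 / fls_X) 1 / (1 - fls_X) ^ r'))"
proof (intro conjI impI)
  assume X: "X \<in> carrier_mat r N \<and> vec_space.rank r (map_mat real_of_int X) = r"
  then have r: "vec_space.rank (dim_row X) (map_mat real_of_int X) = r" by auto
  show "fps_to_fls (Hilb TYPE('k) (ind_poset (mat_indep X) (mat_group X) (mat_proj X)))
      = fls_X ^ r * arith_tutte (mat_ground X) (mat_indep X) (mat_mult X) (1 / fls_X) 1 / (1 - fls_X) ^ r"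
    by (rule Hilb_mat(2)[OF r])
  show "fps_to_fls (Hilb TYPE('k) (tf_ind_poset (mat_indep X) (mat_group X) (mat_proj X)))
      = 1 / of_nat (mat_mult X {}) * (fls_X ^ r *
          arith_tutte (mat_ground X) (mat_indep X) (mat_mult X) (1 / fls_X) 1 / (1 - fls_X) ^ r)"
    unfolding Hilb_mat(1)[OF r] Hilb_mat(3)[OF r] by simp
next
  assume "weak_quasi_arith_matroid E \<Delta> m \<and> matroid_rank \<Delta> E = r'"
  then have wq: "weak_quasi_arith_matroid E \<Delta> m" and r: "matroid_rank \<Delta> E = r'" by auto
  show "fps_to_fls (Hilb TYPE('k) (ind_poset \<Delta> (zmod_group m) (zmod_proj m)))
      = fls_X ^ r' * arith_tutte E \<Delta> m (1 / fls_X) 1 / (1 - fls_X) ^ r'" if "m {} = 1"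
    by (rule Hilb_zmod(1)[OF wq r that])
  show "fps_to_fls (Hilb TYPE('k) (tf_ind_poset \<Delta> (zmod_group m) (zmod_proj m)))
      = 1 / of_nat (m {}) * (fls_X ^ r' * arith_tutte E \<Delta> m (1 / fls_X) 1 / (1 - fls_X) ^ r')"
    by (rule Hilb_zmod(2)[OF wq r])
qed

end
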